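(* For every $\varepsilon\in(0,\frac12)$, every $n$-vertex weighted graph $G$ (nonnegative edge weights) excluding $K_r$ as a minor admits an embedding of its shortest path metric into $\ell_\infty^{k}$ with $k=O(\frac{1}{\varepsilon})^{r+1}\cdot\log\frac{1}{\varepsilon}\cdot\log\frac{n}{\varepsilon}$ and distortion $3+\varepsilon$.
   Context: An embedding $f:V\to\mathbb{R}^k$ of a (pseudo)metric $(V,d)$ into $\ell_\infty^k$ has distortion $c\cdot t$ if for all $x,y$: $\frac1c d(x,y)\le\|f(x)-f(y)\|_\infty\le t\cdot d(x,y)$, where $\|z\|_\infty=\max_i|z_i|$. *)

theory Defs
  imports Complex_Main "Graph_Theory.Graph_Theory"
begin

text \<open>
  An undirected simple graph is a symmetric loop-free digraph without parallel arcs (locale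
  \<^locale>\<open>graph\<close>), so each edge is a pair of opposite arcs, and an edge weight
  has to agree on the two arcs.
\<close>

locale weighted_graph = graph G for G :: "('a, 'b) pre_digraph" +
  fixes w :: "'b \<Rightarrow> real"
  assumes weight_nonneg: "e \<in> arcs G \<Longrightarrow> 0 \<le> w e"
    and weight_sym: "\<lbrakk>e \<in> arcs G; e' \<in> arcs G; tail G e = head G e'; head G e = tail G e'\<rbrakk>
      \<Longrightarrow> w e = w e'"

text \<open>
  Infimum of the costs of all walks from \<open>u\<close> to \<open>v\<close>. This is meant for connected graphs:
  if \<open>v\<close> is not reachable from \<open>u\<close>, the extended-real distance is infinite and the value below is 0.
\<close>

definition sp_dist :: "('a, 'b) pre_digraph \<Rightarrow> ('b \<Rightarrow> real) \<Rightarrow> 'a \<Rightarrow> 'a \<Rightarrow> real" where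
  "sp_dist G w u v = real_of_ereal (wf_digraph.\<mu> G w u v)"

text \<open>
  \<open>H\<close> is a minor of \<open>G\<close> iff \<open>G\<close> contains pairwise disjoint connected branch sets \<open>B x\<close>, one for each
  vertex \<open>x\<close> of \<open>H\<close>, with an edge of \<open>G\<close> between \<open>B x\<close> and \<open>B y\<close> for each edge \<open>xy\<close> of \<open>H\<close>:
  contracting the branch sets and deleting everything superfluous yields \<open>H\<close>.
  Branch sets are non-empty because \<^const>\<open>Digraph_Component.connected\<close> excludes the null graph.
\<close>

definition minor_of :: "('c, 'd) pre_digraph \<Rightarrow> ('a, 'b) pre_digraph \<Rightarrow> bool" where
  "minor_of H G \<longleftrightarrow> (\<exists>B :: 'c \<Rightarrow> 'a set.
     (\<forall>x \<in> verts H. B x \<subseteq> verts G \<and> Digraph_Component.connected (induce_subgraph G (B x))) \<and>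
     (\<forall>x \<in> verts H. \<forall>y \<in> verts H. x \<noteq> y \<longrightarrow> B x \<inter> B y = {}) \<and>
     (\<forall>x y. (x, y) \<in> arcs_ends H \<longrightarrow> (\<exists>u \<in> B x. \<exists>v \<in> B y. (u, v) \<in> arcs_ends G)))"

definition excludes_complete_minor :: "nat \<Rightarrow> ('a, 'b) pre_digraph \<Rightarrow> bool" where
  "excludes_complete_minor r G \<longleftrightarrow>
     \<not> (\<exists>K :: (nat, nat \<times> nat) pre_digraph. complete_digraph r K \<and> minor_of K G)"

text \<open>
  A point of \<open>k\<close>-dimensional space is a function \<open>nat \<Rightarrow> real\<close> of which only the coordinates below \<open>k\<close>
  matter. The inserted 0 only serves to make the norm on the 0-dimensional space equal to 0.
\<close>

definition linf_norm :: "nat \<Rightarrow> (nat \<Rightarrow> real) \<Rightarrow> real" where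
  "linf_norm k z = Max (insert 0 ((\<lambda>i. \<bar>z i\<bar>) ` {..<k}))"

definition has_distortion ::
  "'a set \<Rightarrow> ('a \<Rightarrow> 'a \<Rightarrow> real) \<Rightarrow> nat \<Rightarrow> ('a \<Rightarrow> nat \<Rightarrow> real) \<Rightarrow> real \<Rightarrow> bool" where
  "has_distortion V d k f D \<longleftrightarrow> (\<exists>c t. 0 < c \<and> 0 < t \<and> D = c * t \<and>
     (\<forall>x \<in> V. \<forall>y \<in> V. 1 / c * d x y \<le> linf_norm k (\<lambda>i. f x i - f y i) \<and>
        linf_norm k (\<lambda>i. f x i - f y i) \<le> t * d x y))"

end

(* Fix a scale R.  A cop decomposition whose parts have radius O(\<epsilon> R) around at most r - 1 shortest
paths, and in which every part is separated from the non-adjacent parts above it by a buffer of order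
\<epsilon> R / r, yields a cover: the clusters are the balls of radius (2 + O(\<epsilon>)) R, inside the part of the graph
below X, around net points of the skeleton of X.  The ball B(x, R) lies in the cluster of a net point of
the topmost part X it meets, and that net point has distance at most (1 + O(\<epsilon>)) R from x; so the
cluster misses every y with d(x, y) > (3 + O(\<epsilon>)) R, and u |-> d(u, complement of the cluster) separates
x from y by R.  The buffers bound by O(1/\<epsilon>)^r, as for generalised colouring numbers, the number of
clusters above a given one that meet it, so that O(1/\<epsilon>)^r colours make clusters of one colour disjoint.

The scales, taken modulo O(log(1/\<epsilon>)/\<epsilon>), share O(log n) coordinates as in measured descent.  Let
\<rho>_\<mu>(u) be the distance from u to its 2^\<mu>-th nearest point, a 1-Lipschitz function.  If the ball around
x does not double between the radii R and 24 R, some \<rho>_\<mu> itself separates x from y by d(x, y) - 2 R.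
Otherwise R is comparable to \<rho>_\<mu>(x) for some \<mu>, and the coordinate \<mu> is devoted, near x, to the
scale R; clusters of one colour are told apart by codes whose lengths are the local growth rates of
balls, so that log n of them suffice for all scales together. *)

theory Submission
  imports Defs "HOL-Library.Discrete_Functions"
begin

section \<open>Walks and shortest paths\<close>

text \<open>The number of colours has to be a power of O(1/\<epsilon>) whose base does not depend on
  r. The buffers must be as thin as \<epsilon> R / r, because a node may widen by one buffer for
  each of its at most r - 2 older neighbours, and in total only by O(\<epsilon> R). Hence a walk of
  length O(R) can cross O(r / \<epsilon>) buffers, and the nodes above are bounded by a binomial
  coefficient, O(r / \<epsilon>) over r - 2, in which the two occurrences of r cancel up to a factor
  O(1)^r.

  In a coordinate that serves many scales, x must see its own scale and y nothing of comparable
  size. Scales of one residue class are far apart, so smaller ones are negligible, and larger ones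
  vanish near y, being truncated by \<rho>_\<mu>. At the right scale y may lie in another cluster of
  the same colour, which has to be silent. For this a cluster with about 2^\<alpha> points has only
  the levels \<mu> between \<alpha> and the logarithm of the number of points within 24 R; but the
  disjoint clusters competing with it fill a ball of that radius, so their number is limited
  accordingly.\<close>

locale wgraph =
  fixes V :: "'a set" and adj :: "'a \<Rightarrow> 'a \<Rightarrow> bool" and W :: "'a \<Rightarrow> 'a \<Rightarrow> real"
  assumes finite_V: "finite V"
    and adj_V: "adj u v \<Longrightarrow> u \<in> V \<and> v \<in> V"
    and adj_sym: "adj u v \<Longrightarrow> adj v u"
    and W_nonneg: "0 \<le> W u v"
    and W_sym: "W u v = W v u"
begin

inductive walk :: "'a set \<Rightarrow> 'a \<Rightarrow> 'a \<Rightarrow> real \<Rightarrow> bool" for S where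
  walk_nil: "u \<in> S \<Longrightarrow> walk S u u 0"
| walk_snoc: "walk S u v l \<Longrightarrow> adj v x \<Longrightarrow> x \<in> S \<Longrightarrow> walk S u x (l + W v x)"

lemma walk_mem: "walk S u v l \<Longrightarrow> u \<in> S \<and> v \<in> S"
  by (induction rule: walk.induct) auto

lemma walk_nonneg: "walk S u v l \<Longrightarrow> 0 \<le> l"
  by (induction rule: walk.induct) (auto simp: W_nonneg)

lemma walk_mono: "walk S u v l \<Longrightarrow> S \<subseteq> T \<Longrightarrow> walk T u v l"
  by (induction rule: walk.induct) (auto intro: walk.intros)

lemma walk_trans: "walk S v x l' \<Longrightarrow> walk S u v l \<Longrightarrow> walk S u x (l + l')"
proof (induction rule: walk.induct)
  case (walk_snoc u' v' l' x)
  then show ?case using walk.walk_snoc[of S u v' "l + l'" x] by (simp add: add.assoc)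
qed auto

lemma walk_edge: "adj u v \<Longrightarrow> u \<in> S \<Longrightarrow> v \<in> S \<Longrightarrow> walk S u v (W u v)"
  using walk_snoc[OF walk_nil, of u S v] by simp

lemma walk_Cons: "adj u v \<Longrightarrow> u \<in> S \<Longrightarrow> walk S v x l \<Longrightarrow> walk S u x (W u v + l)"
  using walk_trans[OF _ walk_edge] walk_mem by metis

lemma walk_sym: "walk S u v l \<Longrightarrow> walk S v u l"
proof (induction rule: walk.induct)
  case (walk_snoc u v l x)
  then show ?case using walk_Cons[of x v S u l] W_sym[of x v] adj_sym by (simp add: add.commute)
qed (rule walk_nil)

lemma walk_first_exit:
  assumes "walk S u v l" "u \<in> H" "v \<notin> H"
  shows "\<exists>p b l1 l2. walk (S \<inter> H) u p l1 \<and> adj p b \<and> b \<in> S \<and> b \<notin> H \<and> walk S b v l2 \<and> l = l1 + W p b + l2"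
proof -
  define ex where "ex = (\<lambda>u v l. \<exists>p b l1 l2. walk (S \<inter> H) u p l1 \<and> adj p b \<and> b \<in> S \<and> b \<notin> H \<and>
    walk S b v l2 \<and> l = l1 + W p b + l2)"
  have "walk (S \<inter> H) u v l \<or> ex u v l"
    using assms(1,2)
  proof (induction rule: walk.induct)
    case (walk_snoc u v l x)
    show ?case
    proof (cases "walk (S \<inter> H) u v l")
      case True
      show ?thesis
      proof (cases "x \<in> H")
        case True
        then show ?thesis using walk.walk_snoc[OF \<open>walk (S \<inter> H) u v l\<close>] walk_snoc by blast
      next
        case False
        then have "ex u x (l + W v x + 0)"
          unfolding ex_def using True walk_snoc walk_nil[of x S] by blast
        then show ?thesis by simp
      qed
    next
      case False
      then obtain p b l1 l2 where *: "walk (S \<inter> H) u p l1" "adj p b" "b \<in> S" "b \<notin> H" "walk S b v l2"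
          "l = l1 + W p b + l2"
        using walk_snoc unfolding ex_def by blast
      have "walk S b x (l2 + W v x)" using * walk_snoc by (auto intro: walk.intros)
      then have "ex u x (l + W v x)" unfolding ex_def
        by (intro exI[of _ p] exI[of _ b] exI[of _ l1] exI[of _ "l2 + W v x"]) (use * in simp)
      then show ?thesis by blast
    qed
  qed (auto intro: walk.intros)
  then show ?thesis using assms walk_mem unfolding ex_def by blast
qed

lemma walk_within:
  assumes "walk S u v l" "u \<in> T" "\<And>x y. x \<in> S \<Longrightarrow> x \<in> T \<Longrightarrow> adj x y \<Longrightarrow> y \<in> S \<Longrightarrow> y \<in> T"
  shows "walk (S \<inter> T) u v l"
  using assms
proof (induction rule: walk.induct)
  case (walk_snoc u v l x)
  then have "walk (S \<inter> T) u v l" by blast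
  from walk.walk_snoc[OF this walk_snoc(2)] walk_mem[OF this] show ?case
    using walk_snoc by blast
qed (simp add: walk_nil)

lemma walk_leave_start:
  assumes "walk S u v l" "u \<noteq> v"
  shows "\<exists>a l'. adj u a \<and> walk (S - {u}) a v l' \<and> W u a + l' \<le> l"
  using assms
proof (induction rule: walk.induct)
  case (walk_snoc u v l x)
  show ?case
  proof (cases "u = v")
    case True
    then show ?thesis using walk_snoc walk_nil[of x "S - {u}"] walk_nonneg[of S u v l]
      by (intro exI[of _ x] exI[of _ 0]) auto
  next
    case False
    then obtain a l' where "adj u a" "walk (S - {u}) a v l'" "W u a + l' \<le> l"
      using walk_snoc by blast
    then show ?thesis using walk_snoc walk.walk_snoc[of "S - {u}" a v l' x]
      by (intro exI[of _ a] exI[of _ "l' + W v x"]) auto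
  qed
qed simp

text \<open>There may be infinitely many walks. After its last visit to \<open>u\<close> a walk
  stays in the smaller set \<open>S - {u}\<close>, so only finitely many continuations compete, each
  optimal by induction.\<close>

lemma walk_min_ex:
  assumes "finite S" "walk S u v l"
  shows "\<exists>m. walk S u v m \<and> (\<forall>l'. walk S u v l' \<longrightarrow> m \<le> l')"
  using assms
proof (induction "card S" arbitrary: S u l rule: less_induct)
  case less
  show ?case
  proof (cases "u = v")
    case True
    then show ?thesis using less walk_mem[OF less(3)] walk_nonneg walk_nil by blast
  next
    case False
    define A where "A = {a \<in> S - {u}. adj u a \<and> (\<exists>l. walk (S - {u}) a v l)}"
    have uS: "u \<in> S" using walk_mem less by blast
    have "card (S - {u}) < card S" using less uS by (meson card_Diff1_less)
    then have "\<forall>a\<in>A. \<exists>m. walk (S - {u}) a v m \<and> (\<forall>l'. walk (S - {u}) a v l' \<longrightarrow> m \<le> l')"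
      using less(1)[of "S - {u}"] less(2) unfolding A_def by blast
    then obtain m where m: "\<And>a. a \<in> A \<Longrightarrow> walk (S - {u}) a v (m a)"
        "\<And>a l'. a \<in> A \<Longrightarrow> walk (S - {u}) a v l' \<Longrightarrow> m a \<le> l'"
      by metis
    have lv: "\<exists>a\<in>A. W u a + m a \<le> l'" if wl: "walk S u v l'" for l'
    proof -
      obtain a l'' where a: "adj u a" "walk (S - {u}) a v l''" "W u a + l'' \<le> l'"
        using walk_leave_start[OF wl False] by blast
      then have "a \<in> A" unfolding A_def using walk_mem[OF a(2)] by auto
      then show ?thesis using m(2)[OF _ a(2)] a by force
    qed
    have "finite A" using less(2) unfolding A_def by auto
    moreover have "A \<noteq> {}" using lv[OF less(3)] by blast
    ultimately obtain a0 where a0: "a0 \<in> A" "\<And>a. a \<in> A \<Longrightarrow> W u a0 + m a0 \<le> W u a + m a"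
      using ex_min_if_finite[of "(\<lambda>a. W u a + m a) ` A"] by (fastforce simp: not_less)
    have "walk S u v (W u a0 + m a0)"
      using a0 m(1)[OF a0(1)] uS walk_mono[of "S - {u}" a0 v "m a0" S]
      unfolding A_def by (intro walk_Cons) auto
    then show ?thesis using lv a0 by (metis order_trans)
  qed
qed

section \<open>Distances and shortest paths\<close>

definition gdist :: "'a set \<Rightarrow> 'a \<Rightarrow> 'a \<Rightarrow> real" where
  "gdist S u v = (SOME m. walk S u v m \<and> (\<forall>l'. walk S u v l' \<longrightarrow> m \<le> l'))"

lemma
  assumes "finite S" "walk S u v l"
  shows walk_gdist: "walk S u v (gdist S u v)" and gdist_le: "gdist S u v \<le> l"
  using someI_ex[OF walk_min_ex[OF assms]] assms unfolding gdist_def by auto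

definition conn :: "'a set \<Rightarrow> bool" where
  "conn S \<longleftrightarrow> S \<noteq> {} \<and> (\<forall>u\<in>S. \<forall>v\<in>S. \<exists>l. walk S u v l)"

lemma conn_union:
  assumes "conn S" "conn T" "s \<in> S" "t \<in> T" "s = t \<or> adj s t"
  shows "conn (S \<union> T)"
proof -
  have st: "\<exists>l. walk (S \<union> T) s t l"
    using assms walk_edge[of s t "S \<union> T"] walk_nil[of s "S \<union> T"] by auto
  have *: "\<exists>l. walk (S \<union> T) s x l" if x: "x \<in> S \<union> T" for x
  proof (cases "x \<in> S")
    case True
    then show ?thesis using assms walk_mono[of S s x _ "S \<union> T"] unfolding conn_def by blast
  next
    case False
    then obtain l where "walk (S \<union> T) t x l"
      using assms x walk_mono[of T t x _ "S \<union> T"] unfolding conn_def by blast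
    then show ?thesis using st walk_trans by blast
  qed
  have "\<exists>l. walk (S \<union> T) x y l" if "x \<in> S \<union> T" "y \<in> S \<union> T" for x y
    using *[OF that(1)] *[OF that(2)] walk_trans[OF _ walk_sym] by meson
  then show ?thesis unfolding conn_def using assms(3) by blast
qed

text \<open>Since \<^const>\<open>walk\<close> with target set \<open>P\<close> stays in \<open>P\<close>, this says that \<open>P\<close> is the vertex set of a
  shortest path of \<open>S\<close> issuing from \<open>r\<close>, positions on it being measured by the distance from \<open>r\<close>.\<close>

definition geo :: "'a set \<Rightarrow> 'a \<Rightarrow> 'a set \<Rightarrow> bool" where
  "geo S r P \<longleftrightarrow> r \<in> P \<and> P \<subseteq> S \<and> (\<forall>t\<in>P. \<forall>t'\<in>P. walk P t t' \<bar>gdist S r t - gdist S r t'\<bar>)"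

text \<open>Induction along a walk of minimal length: its prefixes are minimal too, so each new
  vertex is joined to the earlier ones by a walk whose length is the difference of the distances
  from \<open>r\<close>. The bound \<open>gdist S r t \<le> l\<close> is carried along to resolve
  the absolute values.\<close>

lemma geo_ex:
  assumes "finite S" "walk S r v l"
  shows "\<exists>P. geo S r P \<and> v \<in> P"
proof -
  have "walk S r v l \<Longrightarrow> (\<forall>l'. walk S r v l' \<longrightarrow> l \<le> l') \<Longrightarrow> 
    (\<exists>P. geo S r P \<and> v \<in> P \<and> (\<forall>t\<in>P. gdist S r t \<le> l))" for l
  proof (induction rule: walk.induct)
    case (walk_nil r)
    have "gdist S r r = 0"
      using walk_gdist[OF assms(1) walk.walk_nil[OF walk_nil(1)]] gdist_le[OF assms(1) walk.walk_nil[OF walk_nil(1)]]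
        walk_nonneg by fastforce
    then show ?case using walk_nil by (intro exI[of _ "{r}"]) (auto simp: geo_def intro: walk.walk_nil)
  next
    case (walk_snoc r v l x)
    have min: "l \<le> l'" if "walk S r v l'" for l'
      using walk_snoc.prems walk.walk_snoc[OF that walk_snoc(2,3)] by fastforce
    then obtain P where P: "geo S r P" "v \<in> P" "\<forall>t\<in>P. gdist S r t \<le> l" using walk_snoc.IH by blast
    have gv: "gdist S r v = l"
      using gdist_le[OF assms(1) walk_snoc(1)] walk_gdist[OF assms(1) walk_snoc(1)] min by force
    have wx: "walk S r x (l + W v x)" using walk_snoc by (auto intro: walk.intros)
    have gx: "gdist S r x = l + W v x"
      using gdist_le[OF assms(1) wx] walk_gdist[OF assms(1) wx] walk_snoc.prems by force
    have w1: "walk (insert x P) t x \<bar>gdist S r t - gdist S r x\<bar>" if "t \<in> P" for t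
    proof -
      have "walk P t v \<bar>gdist S r t - gdist S r v\<bar>" using P that unfolding geo_def by blast
      moreover have "\<bar>gdist S r t - gdist S r v\<bar> = l - gdist S r t" using P that gv by auto
      ultimately have "walk (insert x P) t v (l - gdist S r t)" using walk_mono[of P t v _ "insert x P"] by auto
      from walk.walk_snoc[OF this walk_snoc(2)]
      have "walk (insert x P) t x (l - gdist S r t + W v x)" by simp
      moreover have "gdist S r t \<le> gdist S r x" using P(3) that gx W_nonneg[of v x] by force
      ultimately show ?thesis using gx by (simp add: algebra_simps)
    qed
    have "geo S r (insert x P)"
      unfolding geo_def
    proof (intro conjI ballI)
      fix t t' assume "t \<in> insert x P" "t' \<in> insert x P"
      then consider "t = x" "t' = x" | "t = x" "t' \<in> P" | "t \<in> P" "t' = x" | "t \<in> P" "t' \<in> P" by auto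
      then show "walk (insert x P) t t' \<bar>gdist S r t - gdist S r t'\<bar>"
      proof cases
        case 1 then show ?thesis by (auto intro: walk.walk_nil)
      next
        case 2 then show ?thesis using walk_sym[OF w1[of t']] by (simp add: abs_minus_commute)
      next
        case 3 then show ?thesis using w1 by simp
      next
        case 4 then show ?thesis using P walk_mono[of P t t' _ "insert x P"] unfolding geo_def by blast
      qed
    qed (use P walk_snoc in \<open>auto simp: geo_def\<close>)
    then show ?case using P gx W_nonneg[of v x] by (intro exI[of _ "insert x P"]) force
  qed
  then show ?thesis using walk_min_ex[OF assms] by blast
qed

text \<open>One point is kept from each nonempty distance interval of length
  \<open>\<delta>\<close>. Points within \<open>l\<close> of \<open>q\<close> differ by at most
  \<open>2 * l\<close> in their distance from \<open>r\<close>, so they occupy at most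
  \<open>2 * l / \<delta> + 2\<close> intervals. Since \<open>P\<close> is shortest in
  \<open>S\<close>, the count holds for walks in all of \<open>S\<close>.\<close>

lemma geo_net:
  assumes "finite S" "geo S r P" "0 < \<delta>"
  shows "\<exists>Z\<subseteq>P. (\<forall>t\<in>P. \<exists>z\<in>Z. \<exists>l\<le>\<delta>. walk P t z l) \<and>
    (\<forall>q l. 0 \<le> l \<longrightarrow> real (card {z\<in>Z. \<exists>l'\<le>l. walk S q z l'}) \<le> 2 * l / \<delta> + 2)"
proof -
  define D where "D = gdist S r"
  define f where "f = (\<lambda>t. \<lfloor>D t / \<delta>\<rfloor>)"
  define g where "g = (\<lambda>b. SOME t. t \<in> P \<and> f t = b)"
  define Z where "Z = g ` f ` P"
  have g: "g (f t) \<in> P \<and> f (g (f t)) = f t" if "t \<in> P" for t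
    unfolding g_def by (rule someI[of _ t]) (use that in auto)
  have ZP: "Z \<subseteq> P" using g unfolding Z_def by auto
  have finP: "finite P" using assms finite_subset unfolding geo_def by blast
  have net: "\<exists>z\<in>Z. \<exists>l\<le>\<delta>. walk P t z l" if "t \<in> P" for t
  proof -
    have "f (g (f t)) = f t" using g that by blast
    then have "\<bar>D t / \<delta> - D (g (f t)) / \<delta>\<bar> \<le> 1" unfolding f_def by linarith
    then have "\<bar>(D t - D (g (f t))) / \<delta>\<bar> \<le> 1" by (simp add: diff_divide_distrib)
    then have "\<bar>D t - D (g (f t))\<bar> \<le> \<delta>" using assms(3) by (simp add: abs_divide field_simps)
    then show ?thesis using assms(2) g[OF that] that unfolding Z_def geo_def D_def by blast
  qed
  have cnt: "real (card {z\<in>Z. \<exists>l'\<le>l. walk S q z l'}) \<le> 2 * l / \<delta> + 2" if "0 \<le> l" for q l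
  proof (cases "{z\<in>Z. \<exists>l'\<le>l. walk S q z l'} = {}")
    case True
    show ?thesis unfolding True using that assms by simp
  next
    case False
    define B where "B = {z\<in>Z. \<exists>l'\<le>l. walk S q z l'}"
    have "finite Z" unfolding Z_def using finP by simp
    then have finB: "finite B" "B \<noteq> {}" using False unfolding B_def by auto
    have inj: "inj_on f B" 
    proof (rule inj_onI)
      fix x y assume "x \<in> B" "y \<in> B" "f x = f y"
      then obtain s t where st: "x = g (f s)" "y = g (f t)" "s \<in> P" "t \<in> P" unfolding B_def Z_def by auto
      then have "f s = f t" using g[of s] g[of t] \<open>f x = f y\<close> by simp
      then show "x = y" using st by simp
    qed
    have diff: "D y - D x \<le> 2 * l" if xy: "x \<in> B" "y \<in> B" for x y
    proof -
      obtain l1 l2 where l: "l1 \<le> l" "l2 \<le> l" "walk S q x l1" "walk S q y l2" using xy unfolding B_def by blast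
      have "walk S r x (D x)"
      proof -
        have "x \<in> P" "r \<in> P" "P \<subseteq> S" using xy ZP assms(2) unfolding B_def geo_def by auto
        then have "\<exists>l. walk S r x l" using assms(2) walk_mono unfolding geo_def by blast
        then show ?thesis unfolding D_def using walk_gdist[OF assms(1)] by blast
      qed
      from walk_trans[OF l(4) walk_trans[OF walk_sym[OF l(3)] this]]
      have "walk S r y (D x + l1 + l2)" .
      then have "D y \<le> D x + l1 + l2" unfolding D_def using gdist_le[OF assms(1)] by blast
      then show ?thesis using l by linarith
    qed
    obtain x where x: "x \<in> B" "\<And>y. y \<in> B \<Longrightarrow> D x \<le> D y"
      using finB ex_min_if_finite[of "D ` B"] by (fastforce simp: not_less)
    have "f ` B \<subseteq> {f x..f x + \<lfloor>2 * l / \<delta>\<rfloor> + 1}"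
    proof (intro subsetI; elim imageE)
      fix w y assume wy: "w = f y" "y \<in> B"
      have "D y / \<delta> \<le> D x / \<delta> + 2 * l / \<delta>" using diff[OF x(1) wy(2)] assms(3) by (simp add: field_simps)
      moreover have "D x / \<delta> \<le> D y / \<delta>" using x(2)[OF wy(2)] assms(3) by (simp add: field_simps)
      ultimately show "w \<in> {f x..f x + \<lfloor>2 * l / \<delta>\<rfloor> + 1}" unfolding wy f_def by simp linarith
    qed
    then have "card (f ` B) \<le> card {f x..f x + \<lfloor>2 * l / \<delta>\<rfloor> + 1}" by (intro card_mono) auto
    then have "card B \<le> nat (\<lfloor>2 * l / \<delta>\<rfloor> + 2)" using card_image[OF inj] by simp
    moreover have "0 \<le> 2 * l / \<delta>" using that assms by simp
    ultimately have "real (card B) \<le> 2 * l / \<delta> + 2" by linarith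
    then show ?thesis unfolding B_def .
  qed
  show ?thesis using ZP net cnt by blast
qed

end

section \<open>Cop decompositions with buffers\<close>

text \<open>
  Vertices are assigned to nodes one step at a time. A step takes place in a connected component \<open>H\<close> of
  the vertices not assigned so far and assigns some vertices of \<open>H\<close> to a node. Then \<open>tm v\<close> is the component
  in which \<open>v\<close> was assigned (\<open>{}\<close> if \<open>v\<close> is still free), and \<open>nd v\<close> is its node, identified with the
  component in which that node was created. So \<open>H \<subset> tm v\<close> says that \<open>v\<close> was assigned before \<open>H\<close> came up,
  and a node is older than another one that lies below it iff it is the larger set.
\<close>

context wgraph
begin

definition free :: "('a \<Rightarrow> 'a set) \<Rightarrow> 'a set" where
  "free tm = {v \<in> V. tm v = {}}"

definition nodes :: "('a \<Rightarrow> 'a set) \<Rightarrow> ('a \<Rightarrow> 'a set) \<Rightarrow> 'a set set" where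
  "nodes nd tm = nd ` (V - free tm)"

definition part :: "('a \<Rightarrow> 'a set) \<Rightarrow> ('a \<Rightarrow> 'a set) \<Rightarrow> 'a set \<Rightarrow> 'a set \<Rightarrow> 'a set" where
  "part nd tm H X = {v \<in> V. nd v = X \<and> H \<subset> tm v}"

definition nbs :: "('a \<Rightarrow> 'a set) \<Rightarrow> ('a \<Rightarrow> 'a set) \<Rightarrow> 'a set \<Rightarrow> 'a set set" where
  "nbs nd tm H = {X. \<exists>x\<in>H. \<exists>v\<in>part nd tm H X. adj x v}"

text \<open>The walks that measure the distance to \<open>Z\<close> stay in \<open>Z\<close> and may
  cross nodes younger than \<open>Z\<close>, but they avoid what nodes older than \<open>Z\<close>
  had taken before \<open>H\<close> came up.\<close>

definition region :: "('a \<Rightarrow> 'a set) \<Rightarrow> ('a \<Rightarrow> 'a set) \<Rightarrow> 'a set \<Rightarrow> 'a set \<Rightarrow> 'a set" where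
  "region nd tm H Z = {v \<in> Z. \<not> (H \<subset> tm v \<and> Z \<subset> nd v)}"

definition clean :: "real \<Rightarrow> ('a \<Rightarrow> 'a set) \<Rightarrow> ('a \<Rightarrow> 'a set) \<Rightarrow> 'a set \<Rightarrow> 'a set \<Rightarrow> bool" where
  "clean \<gamma> nd tm H Z \<longleftrightarrow> (\<forall>a\<in>H. \<forall>q\<in>part nd tm H Z. \<forall>l. walk (region nd tm H Z) a q l \<longrightarrow> \<gamma> \<le> l)"

definition skel :: "('a \<Rightarrow> 'a set) \<Rightarrow> ('a \<Rightarrow> 'a set) \<Rightarrow> 'a set \<Rightarrow> 'a set" where
  "skel nd tm Y = {v \<in> V. nd v = Y \<and> tm v = Y}"

definition full :: "('a \<Rightarrow> 'a set) \<Rightarrow> ('a \<Rightarrow> 'a set) \<Rightarrow> 'a set \<Rightarrow> 'a set" where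
  "full nd tm Y = {v \<in> V. nd v = Y \<and> tm v \<noteq> {}}"

text \<open>The walk may use all vertices assigned to the node so far, so the bound survives any
  further growth.\<close>

definition rad :: "('a \<Rightarrow> 'a set) \<Rightarrow> ('a \<Rightarrow> 'a set) \<Rightarrow> 'a \<Rightarrow> real \<Rightarrow> bool" where
  "rad nd tm v \<beta> \<longleftrightarrow> (\<exists>t l. t \<in> skel nd tm (nd v) \<and> walk (full nd tm (nd v)) v t l \<and> l \<le> \<beta>)"

text \<open>
  A node grows by \<open>\<gamma>\<close> for each older neighbour that gets cut off. The number \<open>cnt\<close> counts those
  for which this is completed, and \<open>charged\<close> allows for one such \<open>Z\<close> being processed: meanwhile the
  distance to \<open>Z\<close> replaces the summand \<open>\<gamma>\<close>.
\<close>

definition cnt :: "real \<Rightarrow> ('a \<Rightarrow> 'a set) \<Rightarrow> ('a \<Rightarrow> 'a set) \<Rightarrow> 'a set \<Rightarrow> 'a set \<Rightarrow> real" where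
  "cnt \<gamma> nd tm H Y = real (card {Z \<in> nbs nd tm Y. Z \<notin> nbs nd tm H \<and> clean \<gamma> nd tm H Z})"

definition component :: "'a set \<Rightarrow> 'a set \<Rightarrow> bool" where
  "component U H \<longleftrightarrow> conn H \<and> H \<subseteq> U \<and> (\<forall>x\<in>H. \<forall>y\<in>U. adj x y \<longrightarrow> y \<in> H)"

definition complete_minor :: "nat \<Rightarrow> bool" where
  "complete_minor m \<longleftrightarrow> (\<exists>B :: nat \<Rightarrow> 'a set. (\<forall>i<m. B i \<subseteq> V \<and> conn (B i)) \<and>
     (\<forall>i<m. \<forall>j<m. i \<noteq> j \<longrightarrow> B i \<inter> B j = {} \<and> (\<exists>u\<in>B i. \<exists>v\<in>B j. adj u v)))"

definition charged :: "real \<Rightarrow> ('a \<Rightarrow> 'a set) \<Rightarrow> ('a \<Rightarrow> 'a set) \<Rightarrow> 'a set \<Rightarrow> 'a set \<Rightarrow> bool" where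
  "charged \<gamma> nd tm H Z \<longleftrightarrow> (\<forall>Y\<in>nbs nd tm H. \<forall>v\<in>part nd tm H Y.
     rad nd tm v (\<gamma> * cnt \<gamma> nd tm H Y) \<or>
     (Z \<in> nbs nd tm Y \<and> Z \<notin> nbs nd tm H \<and> \<not> clean \<gamma> nd tm H Z \<and>
      rad nd tm v (\<gamma> * (cnt \<gamma> nd tm H Y + 1)) \<and>
      (\<forall>q\<in>part nd tm H Z. \<forall>l. walk (region nd tm H Z) v q l \<longrightarrow> rad nd tm v (\<gamma> * cnt \<gamma> nd tm H Y + l))))"

lemma rad_mono: "rad nd tm v \<beta> \<Longrightarrow> \<beta> \<le> \<beta>' \<Longrightarrow> rad nd tm v \<beta>'"
  unfolding rad_def by force

lemma comp_ex:
  assumes "x \<in> U"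
  shows "\<exists>H. component U H \<and> x \<in> H"
proof -
  define H where "H = {y. \<exists>l. walk U x y l}"
  have HU: "H \<subseteq> U" using walk_mem unfolding H_def by blast
  have xH: "x \<in> H" unfolding H_def using assms walk_nil by blast
  have w: "walk H x y l" if "walk U x y l" for y l
  proof -
    have "walk (U \<inter> H) x y l"
      using that xH by (rule walk_within) (auto simp: H_def intro: walk_snoc)
    then show ?thesis using walk_mono by blast
  qed
  have "conn H" unfolding conn_def
  proof (intro conjI ballI)
    fix u v assume "u \<in> H" "v \<in> H"
    then obtain l l' where "walk H x u l" "walk H x v l'" using w unfolding H_def by blast
    then show "\<exists>l. walk H u v l" using walk_trans walk_sym by blast
  qed (use xH in auto)
  moreover have "\<forall>x\<in>H. \<forall>y\<in>U. adj x y \<longrightarrow> y \<in> H" unfolding H_def by (auto intro: walk_snoc)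
  ultimately show ?thesis using HU xH unfolding component_def by blast
qed

lemma comp_subset_or_disjoint:
  assumes "component U H" "conn C" "C \<subseteq> U"
  shows "C \<subseteq> H \<or> C \<inter> H = {}"
proof (rule ccontr)
  assume "\<not> ?thesis"
  then obtain x y where xy: "x \<in> C" "x \<in> H" "y \<in> C" "y \<notin> H" by blast
  then obtain l where "walk C x y l" using assms unfolding conn_def by blast
  from walk_first_exit[OF this xy(2,4)] walk_mem assms show False
    unfolding component_def by blast
qed

end

text \<open>The combinatorial part of the bookkeeping. Together \<open>earlier_out\<close> and
  \<open>closed\<close> say that \<open>tm u\<close> was a component of the vertices free at that
  time: vertices assigned earlier are outside it, and whatever is adjacent to it from outside had
  been assigned earlier.\<close>

locale cop_base = wgraph V adj W for V :: "'a set" and adj W +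
  fixes nd tm :: "'a \<Rightarrow> 'a set"
  assumes self: "v \<in> V - free tm \<Longrightarrow> v \<in> tm v \<and> tm v \<subseteq> nd v \<and> nd v \<subseteq> V"
    and root: "v \<in> V - free tm \<Longrightarrow> \<exists>u \<in> V - free tm. tm u = nd v \<and> nd u = nd v"
    and laminar: "\<lbrakk>u \<in> V - free tm; v \<in> V - free tm\<rbrakk> \<Longrightarrow> tm u \<subseteq> tm v \<or> tm v \<subseteq> tm u \<or> tm u \<inter> tm v = {}"
    and earlier_out: "\<lbrakk>u \<in> V - free tm; v \<in> V - free tm; tm u \<subset> tm v\<rbrakk> \<Longrightarrow> v \<notin> tm u"
    and closed: "\<lbrakk>u \<in> V - free tm; x \<in> tm u; y \<in> V - tm u; adj x y\<rbrakk> \<Longrightarrow> tm u \<subset> tm y"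
    and free_closed: "\<lbrakk>x \<in> free tm; y \<in> V - free tm; adj x y\<rbrakk> \<Longrightarrow> x \<in> tm y"
begin

abbreviation "N \<equiv> nodes nd tm"
abbreviation "K \<equiv> nbs nd tm"
abbreviation "sk \<equiv> skel nd tm"

text \<open>A walk in \<open>H\<close> that leaves \<open>tm v\<close> would enter a vertex that is
  assigned by \<open>closed\<close>, whereas \<open>H\<close> is free.\<close>

lemma comp_in_tm:
  assumes "component (free tm) H" "v \<in> V - free tm" "H \<inter> tm v \<noteq> {}"
  shows "H \<subset> tm v"
proof -
  obtain x where x: "x \<in> H" "x \<in> tm v" using assms by blast
  have "H \<subseteq> tm v"
  proof
    fix y assume "y \<in> H"
    show "y \<in> tm v"
    proof (rule ccontr)
      assume y: "y \<notin> tm v"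
      obtain l where "walk H x y l" using assms(1) x \<open>y \<in> H\<close> unfolding component_def conn_def by blast
      from walk_first_exit[OF this x(2) y] obtain p b where pb: "p \<in> tm v" "b \<notin> tm v" "b \<in> H" "adj p b"
        using walk_mem by blast
      then have "tm v \<subset> tm b" using closed[OF assms(2) pb(1) _ pb(4)] adj_V by blast
      then show False using pb(3) assms(1) unfolding component_def free_def by blast
    qed
  qed
  moreover have "v \<in> tm v" "v \<notin> H" using assms self unfolding component_def by auto
  ultimately show ?thesis by blast
qed

lemma part_nonfree: "v \<in> part nd tm H X \<Longrightarrow> v \<in> V - free tm \<and> nd v = X \<and> H \<subset> tm v"
  unfolding part_def free_def by auto

lemma nbs_psubset: "X \<in> K H \<Longrightarrow> H \<subset> X"
  unfolding nbs_def using part_nonfree self by blast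

lemma nbs_nodes: "X \<in> K H \<Longrightarrow> X \<in> N"
  unfolding nbs_def nodes_def using part_nonfree by blast

lemma finite_nodes: "finite (N)"
  unfolding nodes_def using finite_V by simp

lemma finite_nbs: "finite (K H)"
  using finite_nodes nbs_nodes by (metis finite_subset subsetI)

lemma node_root: "X \<in> N \<Longrightarrow> \<exists>u \<in> V - free tm. tm u = X \<and> nd u = X \<and> u \<in> X"
  unfolding nodes_def using root self by blast

lemma nodes_laminar: "X \<in> N \<Longrightarrow> Z \<in> N \<Longrightarrow> X \<subseteq> Z \<or> Z \<subseteq> X \<or> X \<inter> Z = {}"
  using node_root laminar by metis

lemma node_not_in_free: "X \<in> N \<Longrightarrow> H \<subseteq> free tm \<Longrightarrow> \<not> X \<subseteq> H"
  using node_root by blast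

text \<open>All neighbours contain the nonempty set \<open>H\<close>, so laminarity makes them a
  chain.\<close>

lemma nbs_comparable:
  assumes "X \<in> K H" "Z \<in> K H"
  shows "X \<subseteq> Z \<or> Z \<subseteq> X"
proof -
  have "H \<noteq> {}" using assms unfolding nbs_def by blast
  then show ?thesis using nodes_laminar[OF nbs_nodes[OF assms(1)] nbs_nodes[OF assms(2)]]
     nbs_psubset[OF assms(1)] nbs_psubset[OF assms(2)] by blast
qed

lemma comp_boundary:
  assumes "component (free tm) H" "x \<in> H" "y \<in> V" "y \<notin> H" "adj x y"
  shows "y \<in> part nd tm H (nd y) \<and> nd y \<in> K H"
proof -
  have y: "y \<in> V - free tm" using assms unfolding component_def by blast
  moreover have "x \<in> free tm" using assms unfolding component_def by blast
  ultimately have "x \<in> tm y" using free_closed assms(5) by blast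
  then have "H \<subset> tm y" using comp_in_tm[OF assms(1) y] assms(2) by blast
  then have "y \<in> part nd tm H (nd y)" using assms unfolding part_def by blast
  then show ?thesis using assms unfolding nbs_def by blast
qed

end

text \<open>The invariants named \<open>node_\<close> describe existing nodes and persist; those
  named \<open>comp_\<close> describe the components still to be treated and supply the former when
  a component becomes a node. \<open>comp_clique\<close> and \<open>comp_conn\<close> are there to
  exhibit a complete minor. The number \<open>k\<close> plays the role of r - 2.\<close>

locale cop_state = cop_base V adj W nd tm for V :: "'a set" and adj W nd tm +
  fixes \<gamma> :: real and k :: nat
  assumes gamma_pos: "0 < \<gamma>"
    and no_minor: "\<not> complete_minor (k + 2)"
    and node_card: "Y \<in> N \<Longrightarrow> card (K Y) \<le> k"
    and node_clean: "\<lbrakk>Y \<in> N; Z \<in> N; Y \<subset> Z; Z \<notin> K Y\<rbrakk> \<Longrightarrow> clean \<gamma> nd tm Y Z"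
    and node_clique: "\<lbrakk>Y \<in> N; Z \<in> K Y; X \<in> K Y; X \<subset> Z\<rbrakk> \<Longrightarrow> Z \<in> K X"
    and node_skel: "Y \<in> N \<Longrightarrow>
      \<exists>r \<P>. finite \<P> \<and> card \<P> \<le> k + 1 \<and> \<Union>\<P> = sk Y \<and> (\<forall>P\<in>\<P>. geo Y r P)"
    and node_rad: "v \<in> V - free tm \<Longrightarrow> rad nd tm v (\<gamma> * k)"
    and comp_clique: "\<lbrakk>component (free tm) H; X \<in> K H; X' \<in> K H; X \<noteq> X'\<rbrakk> \<Longrightarrow>
      \<exists>u\<in>part nd tm H X. \<exists>u'\<in>part nd tm H X'. adj u u'"
    and comp_conn: "\<lbrakk>component (free tm) H; X \<in> K H\<rbrakk> \<Longrightarrow> conn (part nd tm H X)"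
    and comp_nbs: "\<lbrakk>component (free tm) H; Y \<in> K H; Z \<in> K H; Y \<subset> Z\<rbrakk> \<Longrightarrow> Z \<in> K Y"
    and comp_clean: "\<lbrakk>component (free tm) H; Y \<in> K H; Z \<in> N; Y \<subset> Z; Z \<notin> K H\<rbrakk> \<Longrightarrow>
      Z \<in> K Y \<or> clean \<gamma> nd tm H Z"
    and comp_charged: "component (free tm) H \<Longrightarrow> \<exists>Z. charged \<gamma> nd tm H Z"
begin

text \<open>Contracting the parts of \<open>k + 1\<close> neighbours, and \<open>H\<close> itself,
  would give a complete minor on \<open>k + 2\<close> vertices.\<close>

lemma comp_card:
  assumes "component (free tm) H"
  shows "card (K H) \<le> k"
proof (rule ccontr)
  assume "\<not> ?thesis"
  then obtain S where S: "S \<subseteq> K H" "card S = k + 1" "finite S"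
    by (metis Suc_eq_plus1 not_less_eq_eq obtain_subset_with_card_n)
  then obtain f where f: "bij_betw f {..<k + 1} S"
    using ex_bij_betw_nat_finite[OF S(3)] by (auto simp: atLeast0LessThan)
  define B where "B = (\<lambda>i. if i < k + 1 then part nd tm H (f i) else H)"
  have fK: "f i \<in> K H" if "i < k + 1" for i
    using f that S(1) bij_betwE by blast
  have finj: "f i \<noteq> f j" if "i < k + 1" "j < k + 1" "i \<noteq> j" for i j
    using f that unfolding bij_betw_def inj_on_def by blast
  have "complete_minor (k + 2)"
    unfolding complete_minor_def
  proof (intro exI[of _ B] conjI allI impI)
    fix i assume "i < k + 2"
    show "B i \<subseteq> V" using assms unfolding B_def part_def component_def free_def by auto
    show "conn (B i)" using assms comp_conn[OF assms fK] unfolding B_def component_def by auto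
    fix j assume j: "j < k + 2" and "i \<noteq> j"
    then consider "i < k + 1" "j < k + 1" | "i < k + 1" "j = k + 1" | "i = k + 1" "j < k + 1"
      using \<open>i < k + 2\<close> by linarith
    then show "B i \<inter> B j = {}"
    proof cases
      case 1 then show ?thesis using finj[of i j] \<open>i \<noteq> j\<close> unfolding B_def part_def by auto
    next
      case 2 then show ?thesis using assms part_nonfree unfolding B_def component_def by fastforce
    next
      case 3 then show ?thesis using assms part_nonfree unfolding B_def component_def by fastforce
    qed
    consider "i < k + 1" "j < k + 1" | "i < k + 1" "j = k + 1" | "i = k + 1" "j < k + 1"
      using \<open>i < k + 2\<close> \<open>i \<noteq> j\<close> j by linarith
    then show "\<exists>u\<in>B i. \<exists>v\<in>B j. adj u v"
    proof cases
      case 1 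
      then show ?thesis using comp_clique[OF assms fK[of i] fK[of j] finj[of i j]] \<open>i \<noteq> j\<close> unfolding B_def by simp
    next
      case 2 then show ?thesis using fK[of i] adj_sym unfolding B_def nbs_def by fastforce
    next
      case 3 then show ?thesis using fK[of j] unfolding B_def nbs_def by fastforce
    qed
  qed
  then show False using no_minor by blast
qed

end

section \<open>A single step of the construction\<close>

text \<open>
  One step in the component \<open>H\<close>: the vertices of \<open>T\<close> either form the skeleton of a new node \<open>Y = H\<close> or are
  added to the neighbouring node \<open>Y\<close>.
\<close>

locale cop_step = cop_state V adj W nd tm \<gamma> k for V :: "'a set" and adj W nd tm \<gamma> k +
  fixes H T Y :: "'a set" and nd' tm' :: "'a \<Rightarrow> 'a set"
  defines "nd' \<equiv> \<lambda>v. if v \<in> T then Y else nd v"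
    and "tm' \<equiv> \<lambda>v. if v \<in> T then H else tm v"
  assumes H: "component (free tm) H" and T: "T \<subseteq> H" "T \<noteq> {}"
    and conn_T: "conn (part nd tm H Y \<union> T)"
    and Y_cases: "Y = H \<or> Y \<in> K H"
    and new_clean: "\<lbrakk>Y = H; Z \<in> N; H \<subset> Z; Z \<notin> K H\<rbrakk> \<Longrightarrow> clean \<gamma> nd tm H Z"
    and new_adj: "\<lbrakk>Y = H; X \<in> K H\<rbrakk> \<Longrightarrow> \<exists>u\<in>T. \<exists>u'\<in>part nd tm H X. adj u u'"
    and new_skel: "Y = H \<Longrightarrow> \<exists>r \<P>. finite \<P> \<and> card \<P> \<le> k + 1 \<and> \<Union>\<P> = T \<and> (\<forall>P\<in>\<P>. geo H r P)"
begin

lemma HV: "H \<subseteq> free tm" "H \<subseteq> V" "H \<noteq> {}" "conn H"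
  using H unfolding component_def free_def conn_def by auto

lemma tm_H: "v \<in> H \<Longrightarrow> tm v = {}"
  using HV unfolding free_def by blast

lemma free': "free tm' = free tm - T"
  using HV T unfolding free_def tm'_def by auto

lemma assigned': "v \<in> V - free tm' \<longleftrightarrow> v \<in> V - free tm \<or> v \<in> T"
  using free' HV T by auto

lemma T_assigned: "v \<in> T \<Longrightarrow> v \<in> V \<and> v \<notin> V - free tm"
  using HV T by auto

lemma old: "v \<in> V - free tm \<Longrightarrow> tm' v = tm v \<and> nd' v = nd v"
  using T_assigned unfolding tm'_def nd'_def by auto

lemma new: "v \<in> T \<Longrightarrow> tm' v = H \<and> nd' v = Y"
  unfolding tm'_def nd'_def by auto

lemma HY: "H \<subseteq> Y"
  using Y_cases nbs_psubset by blast

lemma YV: "Y \<subseteq> V"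
proof (cases "Y = H")
  case False
  then show ?thesis using Y_cases nbs_nodes[of Y H] node_root[of Y] self by blast
qed (use HV in simp)

sublocale new: cop_base V adj W nd' tm'
proof unfold_locales
  fix v assume "v \<in> V - free tm'"
  then consider "v \<in> V - free tm" | "v \<in> T" using assigned' by blast
  note cv = this
  show "v \<in> tm' v \<and> tm' v \<subseteq> nd' v \<and> nd' v \<subseteq> V"
    using cv
  proof cases
    case 1 then show ?thesis using old self by simp
  next
    case 2 then show ?thesis using new T HY YV by auto
  qed
  show "\<exists>u\<in>V - free tm'. tm' u = nd' v \<and> nd' u = nd' v"
    using cv
  proof cases
    case 1 
    then obtain u where u: "u \<in> V - free tm" "tm u = nd v" "nd u = nd v" using root by blast
    have "u \<in> V - free tm'" using u assigned' by blast
    then show ?thesis using old[OF 1] old[OF u(1)] u by auto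
  next
    case 2
    show ?thesis
    proof (cases "Y = H")
      case True
      then show ?thesis using 2 new assigned' by blast
    next
      case False
      then obtain u where u: "u \<in> V - free tm" "tm u = Y" "nd u = Y"
        using Y_cases nbs_nodes node_root by blast
      have "u \<in> V - free tm'" using u assigned' by blast
      then show ?thesis using new[OF 2] old[OF u(1)] u by auto
    qed
  qed
next
  fix u v assume uv: "u \<in> V - free tm'" "v \<in> V - free tm'"
  have *: "H \<subset> tm u \<or> H \<inter> tm u = {}" if "u \<in> V - free tm" for u
    using comp_in_tm[OF H that] by blast
  have uv': "u \<in> V - free tm \<or> u \<in> T" "v \<in> V - free tm \<or> v \<in> T" using assigned' uv by auto
  consider (oo) "u \<in> V - free tm" "v \<in> V - free tm" | (on) "u \<in> V - free tm" "v \<in> T" |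
    (no) "u \<in> T" "v \<in> V - free tm" | (nn) "u \<in> T" "v \<in> T" using uv' by blast
  note cases = this
  show "tm' u \<subseteq> tm' v \<or> tm' v \<subseteq> tm' u \<or> tm' u \<inter> tm' v = {}"
    using cases
  proof cases
    case oo then show ?thesis using laminar[of u v] old by simp
  next
    case on then show ?thesis using *[OF on(1)] old[OF on(1)] new[OF on(2)] by auto
  next
    case no then show ?thesis using *[OF no(2)] old[OF no(2)] new[OF no(1)] by auto
  next
    case nn then show ?thesis using new by simp
  qed
  assume lt: "tm' u \<subset> tm' v"
  show "v \<notin> tm' u"
    using cases
  proof cases
    case oo then show ?thesis using earlier_out[of u v] old lt by simp
  next
    case on 
    then have "tm u \<subset> H" using old[OF on(1)] new[OF on(2)] lt by simp
    then show ?thesis using *[OF on(1)] self[OF on(1)] by blast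
  next
    case no then show ?thesis using new[OF no(1)] HV(1) by auto
  next
    case nn then show ?thesis using new lt by simp
  qed
next
  fix u x y assume a: "u \<in> V - free tm'" "x \<in> tm' u" "y \<in> V - tm' u" "adj x y"
  then consider "u \<in> V - free tm" | "u \<in> T" using assigned' by blast
  then show "tm' u \<subset> tm' y"
  proof cases
    case 1
    then have lt: "tm u \<subset> tm y" using closed a old by auto
    then have "y \<in> V - free tm" using a unfolding free_def by blast
    then show ?thesis using old[OF 1] old[of y] lt by simp
  next
    case 2
    have "x \<in> H" "y \<in> V" "y \<notin> H" using a new[OF 2] by auto
    then have y: "y \<in> part nd tm H (nd y)" using comp_boundary[OF H _ _ _ a(4)] by blast
    have "tm' y = tm y" using part_nonfree[OF y] old[of y] by simp
    then show ?thesis using part_nonfree[OF y] new[OF 2] by simp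
  qed
next
  fix x y assume a: "x \<in> free tm'" "y \<in> V - free tm'" "adj x y"
  then consider "y \<in> V - free tm" | "y \<in> T" using assigned' by blast
  then show "x \<in> tm' y"
  proof cases
    case 1
    have "x \<in> free tm" using a(1) free' by blast
    then show ?thesis using free_closed[OF _ 1 a(3)] old[OF 1] by simp
  next
    case 2
    have "x \<in> free tm" using a(1) free' by blast
    then have "x \<in> H" using H 2 T adj_sym[OF a(3)] unfolding component_def by blast
    then show ?thesis using new[OF 2] by simp
  qed
qed

lemma tm_cond: "\<not> H2 \<subset> H \<Longrightarrow> (H2 \<subset> tm' v \<longleftrightarrow> H2 \<subset> tm v)"
  using new T tm_H[of v] unfolding tm'_def by auto

lemma nd_cond: "\<not> H2 \<subset> H \<Longrightarrow> H2 \<subset> tm v \<Longrightarrow> nd' v = nd v"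
  using T tm_H[of v] unfolding nd'_def by auto

text \<open>A vertex of \<open>T\<close> had \<open>tm v = {}\<close> and gets
  \<open>tm' v = H\<close>; neither set properly contains \<open>H2\<close> unless
  \<open>H2 \<subset> H\<close>. So what is recorded relative to \<open>H2\<close> stays frozen,
  which is the point of using sets as time stamps.\<close>

lemma unchanged:
  assumes "\<not> H2 \<subset> H"
  shows "part nd' tm' H2 X = part nd tm H2 X" "nbs nd' tm' H2 = K H2"
    "region nd' tm' H2 X = region nd tm H2 X" "clean \<gamma> nd' tm' H2 X \<longleftrightarrow> clean \<gamma> nd tm H2 X"
proof -
  have eq: "H2 \<subset> tm' v \<and> Q (nd' v) \<longleftrightarrow> H2 \<subset> tm v \<and> Q (nd v)" for v and Q :: "'a set \<Rightarrow> bool"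
    using tm_cond[OF assms] nd_cond[OF assms] by metis
  show 1: "part nd' tm' H2 X = part nd tm H2 X" for X
    using eq[of _ "\<lambda>N. N = X"] unfolding part_def by (simp add: conj_commute)
  show "nbs nd' tm' H2 = K H2" unfolding nbs_def 1 ..
  show 2: "region nd' tm' H2 X = region nd tm H2 X"
    using eq[of _ "\<lambda>N. X \<subset> N"] unfolding region_def by simp
  show "clean \<gamma> nd' tm' H2 X \<longleftrightarrow> clean \<gamma> nd tm H2 X" unfolding clean_def 1 2 ..
qed

lemma node_not_in_H: "X \<in> N \<Longrightarrow> \<not> X \<subseteq> H"
  using node_not_in_free HV(1) by blast

lemma H_not_node: "H \<notin> N"
  using node_not_in_H by blast

lemma nodes': "nodes nd' tm' = insert Y (N)"
proof -
  have "V - free tm' = (V - free tm) \<union> T" using assigned' by blast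
  moreover have "nd' ` (V - free tm) = nd ` (V - free tm)" using old by (intro image_cong) auto
  moreover have "nd' ` T = {Y}" using new T by auto
  ultimately show ?thesis unfolding nodes_def by (simp add: image_Un)
qed

lemma nodes_cases: "X \<in> nodes nd' tm' \<Longrightarrow> X \<in> N \<or> X = H \<and> Y = H"
  unfolding nodes' using Y_cases nbs_nodes[of Y H] by auto

lemma node_unchanged: "X \<in> insert Y (N) \<Longrightarrow> \<not> X \<subset> H"
  using node_not_in_H HY by blast

context
  fixes H' assumes H': "H' \<noteq> {}" "H' \<subseteq> H - T"
begin

lemma sub_psubset: "H' \<subset> H"
  using H' T by blast

lemma sub_tm: "v \<in> V - free tm \<Longrightarrow> H' \<subset> tm' v \<longleftrightarrow> H \<subset> tm v"
proof -
  assume v: "v \<in> V - free tm"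
  have "H \<subset> tm v" if "H' \<subset> tm v"
    using comp_in_tm[OF H v] that sub_psubset H'(1) by blast
  then show ?thesis using old[OF v] sub_psubset by auto
qed

lemma sub_part: "part nd' tm' H' X = part nd tm H X \<union> (if X = Y then T else {})"
proof -
  have "v \<in> part nd' tm' H' X \<longleftrightarrow> v \<in> part nd tm H X \<union> (if X = Y then T else {})" if vV: "v \<in> V" for v
  proof -
    consider "v \<in> V - free tm" | "v \<in> T" | "v \<in> free tm'" using assigned' vV by blast
    then show ?thesis
    proof cases
      case 1 
      then show ?thesis using sub_tm[OF 1] old[OF 1] T_assigned[of v] unfolding part_def by auto
    next
      case 2
      then have "v \<notin> part nd tm H X" using T_assigned part_nonfree by blast
      then show ?thesis using 2 new[OF 2] sub_psubset vV unfolding part_def by auto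
    next
      case 3
      then show ?thesis using new.part_nonfree[of v H' X] part_nonfree[of v H X] free' by auto
    qed
  qed
  moreover have "part nd' tm' H' X \<subseteq> V" "part nd tm H X \<subseteq> V" "T \<subseteq> V" using T HV unfolding part_def by auto
  ultimately show ?thesis by (auto split: if_splits)
qed

lemma sub_nbs: "nbs nd' tm' H' \<subseteq> insert Y (K H)"
  unfolding nbs_def sub_part using H' by (auto split: if_splits)

lemma sub_nbs_old: "Z \<in> N \<Longrightarrow> Z \<notin> K H \<Longrightarrow> Z \<notin> nbs nd' tm' H' \<and> Z \<noteq> Y"
  using sub_nbs Y_cases H_not_node by blast

lemma sub_region: "region nd' tm' H' Z \<subseteq> region nd tm H Z"
proof
  fix v assume v: "v \<in> region nd' tm' H' Z"
  have "\<not> (H \<subset> tm v \<and> Z \<subset> nd v)"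
  proof
    assume a: "H \<subset> tm v \<and> Z \<subset> nd v"
    then have "v \<notin> T" using T_assigned[of v] unfolding free_def by auto
    then show False using v a sub_psubset unfolding region_def tm'_def nd'_def by auto
  qed
  then show "v \<in> region nd tm H Z" using v unfolding region_def by blast
qed

lemma sub_region_eq:
  assumes "\<not> Z \<subset> Y" "Z \<subseteq> V"
  shows "region nd' tm' H' Z = region nd tm H Z"
proof -
  have "H' \<subset> tm' v \<and> Z \<subset> nd' v \<longleftrightarrow> H \<subset> tm v \<and> Z \<subset> nd v" if "v \<in> V" for v
  proof -
    consider "v \<in> V - free tm" | "v \<in> T" | "v \<in> free tm'" using assigned' \<open>v \<in> V\<close> by blast
    then show ?thesis
    proof cases
      case 1 then show ?thesis using sub_tm[OF 1] old[OF 1] by auto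
    next
      case 2 then show ?thesis using new[OF 2] assms T_assigned[OF 2] unfolding free_def by auto
    next
      case 3 then show ?thesis using free' unfolding free_def by auto
    qed
  qed
  then show ?thesis using assms(2) unfolding region_def by blast
qed

text \<open>\<open>Z\<close> gains no vertices and the region can only shrink, so a buffer once
  completed persists.\<close>

lemma sub_clean:
  assumes "Z \<in> N" "Z \<notin> K H" "clean \<gamma> nd tm H Z"
  shows "clean \<gamma> nd' tm' H' Z"
proof -
  have "part nd' tm' H' Z = part nd tm H Z" using sub_part sub_nbs_old assms by simp
  then show ?thesis using assms(3) sub_psubset walk_mono[OF _ sub_region] unfolding clean_def by blast
qed

lemma sub_cnt_set:
  assumes "X \<in> K H"
  shows "{Z \<in> K X. Z \<notin> K H \<and> clean \<gamma> nd tm H Z} \<subseteq>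
    {Z \<in> nbs nd' tm' X. Z \<notin> nbs nd' tm' H' \<and> clean \<gamma> nd' tm' H' Z}"
proof -
  have "\<not> X \<subset> H" using nbs_psubset[OF assms] by blast
  then show ?thesis using unchanged(2)[of X] sub_clean sub_nbs_old nbs_nodes by blast
qed

lemma sub_cnt:
  assumes "X \<in> K H"
  shows "cnt \<gamma> nd tm H X \<le> cnt \<gamma> nd' tm' H' X"
  unfolding cnt_def using card_mono[OF _ sub_cnt_set[OF assms]] new.finite_nbs by simp

text \<open>Completing the buffer towards \<open>Z\<close> turns the provisional allowance of one
  \<open>\<gamma>\<close> into a permanent one.\<close>

lemma sub_cnt_Suc:
  assumes "X \<in> K H" "Z \<in> K X" "Z \<notin> K H" "\<not> clean \<gamma> nd tm H Z"
    "clean \<gamma> nd' tm' H' Z"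
  shows "cnt \<gamma> nd tm H X + 1 \<le> cnt \<gamma> nd' tm' H' X"
proof -
  have "\<not> X \<subset> H" using nbs_psubset[OF assms(1)] by blast
  then have "insert Z {Z \<in> K X. Z \<notin> K H \<and> clean \<gamma> nd tm H Z} \<subseteq>
    {Z \<in> nbs nd' tm' X. Z \<notin> nbs nd' tm' H' \<and> clean \<gamma> nd' tm' H' Z}"
    using sub_cnt_set[OF assms(1)] assms unchanged(2)[of X] sub_nbs_old[OF nbs_nodes[OF assms(2)] assms(3)] by simp
  then have "card (insert Z {Z \<in> K X. Z \<notin> K H \<and> clean \<gamma> nd tm H Z}) \<le>
    card {Z \<in> nbs nd' tm' X. Z \<notin> nbs nd' tm' H' \<and> clean \<gamma> nd' tm' H' Z}"
    using new.finite_nbs by (intro card_mono) simp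
  moreover have "finite {Z \<in> K X. Z \<notin> K H \<and> clean \<gamma> nd tm H Z}" using finite_nbs by simp
  ultimately show ?thesis using assms(4) unfolding cnt_def by simp
qed

end

lemma new_comp:
  assumes "component (free tm') H2"
  shows "(H2 \<noteq> {} \<and> H2 \<subseteq> H - T) \<or> (component (free tm) H2 \<and> \<not> H2 \<subset> H \<and> H2 \<inter> H = {})"
proof -
  have c: "conn H2" "H2 \<subseteq> free tm - T" using assms free' unfolding component_def by auto
  then have "H2 \<subseteq> H \<or> H2 \<inter> H = {}" using comp_subset_or_disjoint[OF H] by blast
  moreover have "component (free tm) H2" if "H2 \<inter> H = {}"
    unfolding component_def
  proof (intro conjI ballI impI)
    fix x y assume a: "x \<in> H2" "y \<in> free tm" "adj x y"
    have "y \<notin> H" using a H c(2) adj_sym that unfolding component_def by blast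
    then show "y \<in> H2" using a assms free' T unfolding component_def by blast
  qed (use c in auto)
  ultimately show ?thesis using c unfolding conn_def by auto
qed

lemma part_old: "v \<in> part nd tm H2 X \<Longrightarrow> v \<in> V - free tm"
  using part_nonfree by blast

lemma rad': 
  assumes "v \<in> V - free tm" "rad nd tm v \<beta>"
  shows "rad nd' tm' v \<beta>"
proof -
  have "sk (nd v) \<subseteq> skel nd' tm' (nd v)"
  proof
    fix t assume t: "t \<in> sk (nd v)"
    then have "t \<in> V - free tm" using self[OF assms(1)] unfolding skel_def free_def by auto
    then show "t \<in> skel nd' tm' (nd v)" using t old unfolding skel_def by auto
  qed
  moreover have "full nd tm (nd v) \<subseteq> full nd' tm' (nd v)"
  proof
    fix t assume t: "t \<in> full nd tm (nd v)"
    then have "t \<in> V - free tm" unfolding full_def free_def by auto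
    then show "t \<in> full nd' tm' (nd v)" using t old unfolding full_def by auto
  qed
  ultimately show ?thesis using assms old[OF assms(1)] walk_mono unfolding rad_def by (metis subsetD)
qed

lemma skel_unchanged:
  assumes "X \<in> N"
  shows "skel nd' tm' X = sk X"
proof -
  have "v \<notin> sk X" if "v \<in> T" for v
    using that tm_H[of v] T node_root[OF assms] unfolding skel_def by auto
  moreover have "v \<notin> skel nd' tm' X" if "v \<in> T" for v
    using new[OF that] H_not_node assms unfolding skel_def by auto
  ultimately show ?thesis unfolding skel_def nd'_def tm'_def by auto
qed

text \<open>Only the two assumptions depend on the kind of step. Everything else follows from one
  case distinction: a new component either lies in \<open>H - T\<close> or is an old component away
  from \<open>H\<close>.\<close>

lemma step_state:
  assumes new_rad: "\<And>v. v \<in> T \<Longrightarrow> rad nd' tm' v (\<gamma> * k)"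
    and new_charged: "\<And>H'. component (free tm') H' \<Longrightarrow> H' \<subseteq> H - T \<Longrightarrow> \<exists>Z. charged \<gamma> nd' tm' H' Z"
  shows "cop_state V adj W nd' tm' \<gamma> k"
proof unfold_locales
  show "0 < \<gamma>" "\<not> complete_minor (k + 2)" by (rule gamma_pos no_minor)+
next
  fix X assume X: "X \<in> nodes nd' tm'"
  then have X': "X \<in> N \<or> X = H \<and> Y = H" by (rule nodes_cases)
  have nX: "\<not> X \<subset> H" using node_unchanged X unfolding nodes' by blast
  show "card (nbs nd' tm' X) \<le> k"
    using X' node_card comp_card[OF H] unchanged(2)[OF nX] by auto
  show "\<exists>r \<P>. finite \<P> \<and> card \<P> \<le> k + 1 \<and> \<Union>\<P> = skel nd' tm' X \<and> (\<forall>P\<in>\<P>. geo X r P)"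
  proof (cases "X \<in> N")
    case True
    then show ?thesis using node_skel skel_unchanged by simp
  next
    case False
    then have XY: "X = H" "Y = H" using X' by auto
    have "skel nd' tm' H = T"
    proof
      show "T \<subseteq> skel nd' tm' H" using new XY T HV unfolding skel_def by auto
      show "skel nd' tm' H \<subseteq> T"
      proof
        fix v assume v: "v \<in> skel nd' tm' H"
        show "v \<in> T"
        proof (rule ccontr)
          assume "v \<notin> T"
          then have "tm v = H" "nd v = H" "v \<in> V" using v unfolding skel_def tm'_def nd'_def by auto
          then show False using H_not_node HV(3) unfolding nodes_def free_def by blast
        qed
      qed
    qed
    then show ?thesis using new_skel XY by simp
  qed
  fix Z
  show "clean \<gamma> nd' tm' X Z" if "Z \<in> nodes nd' tm'" "X \<subset> Z" "Z \<notin> nbs nd' tm' X"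
  proof -
    have "Z \<noteq> H" using that(2) nX by blast
    then have "Z \<in> N" using nodes_cases[OF that(1)] by blast
    then have "clean \<gamma> nd tm X Z"
      using X' node_clean[of X Z] new_clean[of Z] that(2,3) unfolding unchanged(2)[OF nX] by blast
    then show ?thesis unfolding unchanged(4)[OF nX] .
  qed
  fix X2
  show "Z \<in> nbs nd' tm' X2" if "Z \<in> nbs nd' tm' X" "X2 \<in> nbs nd' tm' X" "X2 \<subset> Z"
  proof -
    have "\<not> X2 \<subset> H" using new.nbs_psubset[OF that(2)] nX by blast
    then show ?thesis
      using that X' node_clique[of X Z X2] comp_nbs[OF H, of X2 Z]
      unfolding unchanged(2)[OF nX] unchanged(2)[OF \<open>\<not> X2 \<subset> H\<close>] by blast
  qed
next
  fix v assume "v \<in> V - free tm'"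
  then show "rad nd' tm' v (\<gamma> * k)" using assigned' new_rad rad' node_rad by blast
next
  fix H2 X X' assume a: "component (free tm') H2" "X \<in> nbs nd' tm' H2" "X' \<in> nbs nd' tm' H2" "X \<noteq> X'"
  from new_comp[OF a(1)] show "\<exists>u\<in>part nd' tm' H2 X. \<exists>u'\<in>part nd' tm' H2 X'. adj u u'"
  proof (elim disjE conjE)
    assume H2: "H2 \<noteq> {}" "H2 \<subseteq> H - T"
    note sub = sub_nbs[OF H2] sub_part[OF H2]
    show ?thesis
    proof (cases "X \<in> K H \<and> X' \<in> K H")
      case True
      then show ?thesis using comp_clique[OF H, of X X'] a(4) unfolding sub by blast
    next
      case False
      then consider "X = Y" "Y = H" "X' \<in> K H" | "X' = Y" "Y = H" "X \<in> K H"
        using sub(1) a Y_cases by blast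
      then show ?thesis
      proof cases
        case 1 then show ?thesis using new_adj[of X'] unfolding sub by auto
      next
        case 2 then show ?thesis using new_adj[of X] adj_sym unfolding sub by fastforce
      qed
    qed
  next
    assume "component (free tm) H2" "\<not> H2 \<subset> H"
    then show ?thesis using comp_clique a unchanged by simp
  qed
next
  fix H2 X assume a: "component (free tm') H2" "X \<in> nbs nd' tm' H2"
  from new_comp[OF a(1)] show "conn (part nd' tm' H2 X)"
  proof (elim disjE conjE)
    assume H2: "H2 \<noteq> {}" "H2 \<subseteq> H - T"
    show ?thesis using sub_part[OF H2] conn_T sub_nbs[OF H2] a comp_conn[OF H] by auto
  next
    assume "component (free tm) H2" "\<not> H2 \<subset> H"
    then show ?thesis using comp_conn a unchanged by simp
  qed
next
  fix H2 X Z assume a: "component (free tm') H2" "X \<in> nbs nd' tm' H2" "Z \<in> nbs nd' tm' H2" "X \<subset> Z"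
  from new_comp[OF a(1)] show "Z \<in> nbs nd' tm' X"
  proof (elim disjE conjE)
    assume H2: "H2 \<noteq> {}" "H2 \<subseteq> H - T"
    have XZ: "X \<in> insert Y (K H)" "Z \<in> insert Y (K H)" using sub_nbs[OF H2] a by auto
    then have sup: "H \<subseteq> X" using nbs_psubset HY by blast
    then have "Z \<noteq> H" using a by blast
    then have Z: "Z \<in> K H" using XZ Y_cases by blast
    have "Z \<in> K X"
    proof (cases "X \<in> K H")
      case True
      then show ?thesis using comp_nbs[OF H _ Z] a by blast
    next
      case False
      then show ?thesis using XZ Y_cases Z by blast
    qed
    moreover have "\<not> X \<subset> H" using sup by blast
    ultimately show ?thesis using unchanged by simp
  next
    assume c: "component (free tm) H2" and "\<not> H2 \<subset> H" "H2 \<inter> H = {}"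
    then have u: "nbs nd' tm' H2 = K H2" using unchanged by simp
    have "\<not> X \<subset> H" using new.nbs_psubset[OF a(2)] \<open>H2 \<inter> H = {}\<close> c unfolding component_def conn_def by blast
    then show ?thesis using comp_nbs[OF c _ _ a(4)] a(2,3) u unchanged(2)[of X] by simp
  qed
next
  fix H2 X Z assume a: "component (free tm') H2" "X \<in> nbs nd' tm' H2" "Z \<in> nodes nd' tm'" "X \<subset> Z" "Z \<notin> nbs nd' tm' H2"
  from new_comp[OF a(1)] show "Z \<in> nbs nd' tm' X \<or> clean \<gamma> nd' tm' H2 Z"
  proof (elim disjE conjE)
    assume H2: "H2 \<noteq> {}" "H2 \<subseteq> H - T"
    have X: "X \<in> insert Y (K H)" using sub_nbs[OF H2] a by auto
    then have sup: "H \<subseteq> X" using nbs_psubset HY by blast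
    then have "Z \<noteq> H" using a by blast
    then have Z: "Z \<in> N" using nodes_cases[OF a(3)] by blast
    have "Z \<in> K X \<or> Z \<notin> K H \<and> clean \<gamma> nd tm H Z"
    proof (cases "X \<in> K H")
      case True
      then show ?thesis using comp_nbs[OF H _ _ a(4)] comp_clean[OF H _ Z a(4)] by blast
    next
      case False
      then have "X = H" "Y = H" using X Y_cases by auto
      then show ?thesis using new_clean[OF _ Z] a(4) by blast
    qed
    moreover have "\<not> X \<subset> H" using sup by blast
    ultimately show ?thesis using unchanged(2)[of X] sub_clean[OF H2 Z] by auto
  next
    assume c: "component (free tm) H2" and nH: "\<not> H2 \<subset> H" "H2 \<inter> H = {}"
    have "\<not> X \<subset> H" using new.nbs_psubset[OF a(2)] nH c unfolding component_def conn_def by blast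
    moreover have "Z \<noteq> H" using new.nbs_psubset[OF a(2)] a(4) nH c unfolding component_def conn_def by blast
    ultimately have "Z \<in> K X \<or> clean \<gamma> nd tm H2 Z"
      using comp_clean[OF c _ _ a(4)] a(2,5) nodes_cases[OF a(3)] unfolding unchanged(2)[OF nH(1)] by blast
    then show ?thesis using \<open>\<not> X \<subset> H\<close> unchanged(2)[of X] unchanged(4)[OF nH(1)] by simp
  qed
next
  fix H2 assume a: "component (free tm') H2"
  from new_comp[OF a(1)] show "\<exists>Z. charged \<gamma> nd' tm' H2 Z"
  proof (elim disjE conjE)
    assume "H2 \<subseteq> H - T"
    then show ?thesis using new_charged a by blast
  next
    assume c: "component (free tm) H2" and nH: "\<not> H2 \<subset> H" "H2 \<inter> H = {}"
    obtain Z where Z: "charged \<gamma> nd tm H2 Z" using comp_charged[OF c] by blast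
    have nX: "\<not> X \<subset> H" if "X \<in> K H2" for X
      using nbs_psubset[OF that] nH c unfolding component_def conn_def by blast
    have cn: "cnt \<gamma> nd' tm' H2 X = cnt \<gamma> nd tm H2 X" if "X \<in> K H2" for X
      using unchanged[OF nH(1)] unchanged(2)[OF nX[OF that]] unfolding cnt_def by simp
    have "charged \<gamma> nd' tm' H2 Z"
      unfolding charged_def unchanged[OF nH(1)]
    proof (intro ballI)
      fix X v assume X: "X \<in> K H2" and v: "v \<in> part nd tm H2 X"
      note r = rad'[OF part_old[OF v]]
      show "rad nd' tm' v (\<gamma> * cnt \<gamma> nd' tm' H2 X) \<or> Z \<in> nbs nd' tm' X \<and> Z \<notin> K H2 \<and> \<not> clean \<gamma> nd tm H2 Z \<and>
        rad nd' tm' v (\<gamma> * (cnt \<gamma> nd' tm' H2 X + 1)) \<and> (\<forall>q\<in>part nd tm H2 Z. \<forall>l. walk (region nd tm H2 Z) v q l \<longrightarrow>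
        rad nd' tm' v (\<gamma> * cnt \<gamma> nd' tm' H2 X + l))"
        using Z X v r unfolding charged_def cn[OF X] unchanged(2)[OF nX[OF X]] by blast
    qed
    then show ?thesis by blast
  qed
qed

end

section \<open>Creating a node and growing a node\<close>

context cop_state
begin

text \<open>Once all nodes cut off from \<open>H\<close> are buffered, \<open>H\<close> can become a
  node. Its skeleton consists of shortest paths of \<open>H\<close> from \<open>r\<close> to a
  vertex next to each neighbouring part, so that the new part touches all of them and the clique of
  parts is extended.\<close>

lemma step_new:
  assumes H: "component (free tm) H"
    and cl: "\<And>Z. \<lbrakk>Z \<in> N; H \<subset> Z; Z \<notin> K H\<rbrakk> \<Longrightarrow> clean \<gamma> nd tm H Z"
  shows "\<exists>nd' tm'. cop_state V adj W nd' tm' \<gamma> k \<and> free tm' \<subset> free tm"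
proof -
  have HU: "H \<subseteq> free tm" "conn H" using H unfolding component_def by auto
  then obtain r where r: "r \<in> H" unfolding conn_def by blast
  have "H \<subseteq> V" using HU unfolding free_def by blast
  then have finH: "finite H" by (rule finite_subset[OF _ finite_V])
  have "\<exists>x P. x \<in> H \<and> (\<exists>u'\<in>part nd tm H X. adj x u') \<and> geo H r P \<and> x \<in> P" if X: "X \<in> K H" for X
  proof -
    obtain x where x: "x \<in> H" "\<exists>u'\<in>part nd tm H X. adj x u'" using X unfolding nbs_def by blast
    then obtain l where "walk H r x l" using HU r unfolding conn_def by blast
    then show ?thesis using geo_ex[OF finH] x by blast
  qed
  then obtain x P where xP: "\<And>X. X \<in> K H \<Longrightarrow>
      x X \<in> H \<and> (\<exists>u'\<in>part nd tm H X. adj (x X) u') \<and> geo H r (P X) \<and> x X \<in> P X"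
    by metis
  \<comment> \<open>The trivial path \<open>{r}\<close> keeps the skeleton nonempty when
    \<open>H\<close> has no neighbours; it accounts for the \<open>+ 1\<close> in the number of
    paths.\<close>
  define \<P> where "\<P> = insert {r} (P ` K H)"
  define T where "T = \<Union>\<P>"
  have geoP: "geo H r Q" if "Q \<in> \<P>" for Q
    using that xP r walk_nil unfolding \<P>_def geo_def by auto
  have TH: "T \<subseteq> H" using geoP unfolding T_def geo_def by blast
  have rT: "r \<in> T" unfolding T_def \<P>_def by blast
  have wT: "\<exists>l. walk T r u l" if "u \<in> T" for u
  proof -
    obtain Q where Q: "Q \<in> \<P>" "u \<in> Q" using \<open>u \<in> T\<close> unfolding T_def by blast
    then obtain l where "walk Q r u l" using geoP[OF Q(1)] unfolding geo_def by blast
    then show ?thesis using walk_mono[of Q r u l T] Q unfolding T_def by blast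
  qed
  have connT: "conn T" unfolding conn_def
  proof (intro conjI ballI)
    fix u v assume "u \<in> T" "v \<in> T"
    then show "\<exists>l. walk T u v l" using wT walk_trans walk_sym by meson
  qed (use rT in blast)
  have H_not: "H \<notin> N" using node_not_in_free HU by blast
  have partH: "part nd tm H H = {}"
    using H_not part_nonfree unfolding nodes_def by blast
  define nd' where "nd' = (\<lambda>v. if v \<in> T then H else nd v)"
  define tm' where "tm' = (\<lambda>v. if v \<in> T then H else tm v)"
  have cardP: "card \<P> \<le> k + 1"
    using comp_card[OF H] card_image_le[OF finite_nbs, of P H] finite_nbs[of H]
    unfolding \<P>_def by (simp add: card_insert_if)
  interpret st: cop_step V adj W nd tm \<gamma> k H T H nd' tm'
  proof unfold_locales
    show "nd' \<equiv> \<lambda>v. if v \<in> T then H else nd v" "tm' \<equiv> \<lambda>v. if v \<in> T then H else tm v"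
      unfolding nd'_def tm'_def by auto
    show "conn (part nd tm H H \<union> T)" using partH connT by simp
    show "\<exists>r \<P>. finite \<P> \<and> card \<P> \<le> k + 1 \<and> \<Union>\<P> = T \<and> (\<forall>P\<in>\<P>. geo H r P)"
      using geoP cardP finite_nbs T_def \<P>_def by (intro exI[of _ r] exI[of _ \<P>]) auto
    show "\<exists>u\<in>T. \<exists>u'\<in>part nd tm H X. adj u u'" if "X \<in> K H" for X
      using xP[OF that] that unfolding T_def \<P>_def by blast
  qed (use H TH rT cl in auto)
  have rad0: "rad nd' tm' v 0" if "v \<in> T" for v
  proof -
    have "v \<in> V" using that TH HU unfolding free_def by auto
    then have "v \<in> skel nd' tm' (nd' v)" "v \<in> full nd' tm' (nd' v)"
      using st.new[OF that] st.HV unfolding skel_def full_def by auto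
    then show ?thesis unfolding rad_def using walk_nil by blast
  qed
  obtain Zc where Zc: "charged \<gamma> nd tm H Zc" using comp_charged[OF H] by blast
  have "cop_state V adj W nd' tm' \<gamma> k"
  proof (rule st.step_state)
    show "rad nd' tm' v (\<gamma> * k)" if "v \<in> T" for v
      using rad_mono[OF rad0[OF that]] gamma_pos by simp
    fix H' assume H': "component (free tm') H'" "H' \<subseteq> H - T"
    then have ne: "H' \<noteq> {}" unfolding component_def conn_def by blast
    have "charged \<gamma> nd' tm' H' Zc"
      unfolding charged_def
    proof (intro ballI disjI1)
      fix X v assume X: "X \<in> nbs nd' tm' H'" and v: "v \<in> part nd' tm' H' X"
      show "rad nd' tm' v (\<gamma> * cnt \<gamma> nd' tm' H' X)"
      proof (cases "X \<in> K H")
        case True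
        then have "X \<noteq> H" using nbs_psubset by blast
        then have v: "v \<in> part nd tm H X" using v st.sub_part[OF ne H'(2)] by simp
        \<comment> \<open>With all buffers in place the second alternative of \<open>charged\<close>
          is void.\<close>
        have "\<not> (Zc \<in> K X \<and> Zc \<notin> K H \<and> \<not> clean \<gamma> nd tm H Zc)"
          using cl[of Zc] nbs_nodes[of Zc X] nbs_psubset[of Zc X] nbs_psubset[OF True] by blast
        then have "rad nd tm v (\<gamma> * cnt \<gamma> nd tm H X)"
          using Zc True v unfolding charged_def by blast
        then have "rad nd' tm' v (\<gamma> * cnt \<gamma> nd tm H X)" using st.rad' part_nonfree[OF v] by blast
        then show ?thesis using rad_mono st.sub_cnt[OF ne H'(2) True] gamma_pos by simp
      next
        case False
        then have "X = H" using st.sub_nbs[OF ne H'(2)] X by blast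
        then have "v \<in> T" using v st.sub_part[OF ne H'(2)] partH by simp
        then show ?thesis using rad_mono[OF rad0] gamma_pos unfolding cnt_def by simp
      qed
    qed
    then show "\<exists>Z. charged \<gamma> nd' tm' H' Z" ..
  qed
  moreover have "free tm' \<subset> free tm" using st.free' rT TH HU by blast
  ultimately show ?thesis by blast
qed

text \<open>
  If a node \<open>Z\<close> is cut off from \<open>H\<close> but too close to it, a shortest violating walk leaves \<open>H\<close> into a node
  below \<open>Z\<close>, which absorbs the last vertex of the walk in \<open>H\<close>.
\<close>

lemma step_grow:
  assumes H: "component (free tm) H"
    and Z1: "Z1 \<in> N" "H \<subset> Z1" "Z1 \<notin> K H" "\<not> clean \<gamma> nd tm H Z1"
  shows "\<exists>nd' tm'. cop_state V adj W nd' tm' \<gamma> k \<and> free tm' \<subset> free tm"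
proof -
  have HU: "H \<subseteq> free tm" "H \<noteq> {}" using H unfolding component_def conn_def by auto
  \<comment> \<open>\<open>charged\<close> allows an unfinished summand for one node only. So a node
    in progress is continued until its buffer is complete, and only then may \<open>Z1\<close> be
    taken up.\<close>
  obtain Z where Z: "Z \<in> N" "H \<subset> Z" "Z \<notin> K H" "\<not> clean \<gamma> nd tm H Z"
    and ch: "charged \<gamma> nd tm H Z"
  proof -
    obtain Zc where Zc: "charged \<gamma> nd tm H Zc" using comp_charged[OF H] by blast
    show thesis
    proof (cases "Zc \<in> N \<and> H \<subset> Zc \<and> Zc \<notin> K H \<and> \<not> clean \<gamma> nd tm H Zc")
      case True
      then show ?thesis using that Zc by blast
    next
      case False
      have "rad nd tm v (\<gamma> * cnt \<gamma> nd tm H X)" if "X \<in> K H" "v \<in> part nd tm H X" for X v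
      proof -
        have "\<not> (Zc \<in> K X \<and> Zc \<notin> K H \<and> \<not> clean \<gamma> nd tm H Zc)"
          using False nbs_nodes[of Zc X] nbs_psubset[of Zc X] nbs_psubset[OF that(1)] by blast
        then show ?thesis using Zc that unfolding charged_def by blast
      qed
      then have "charged \<gamma> nd tm H Z1" unfolding charged_def by blast
      then show ?thesis using that Z1 by blast
    qed
  qed
  define D where "D = region nd tm H Z"
  have ZV: "Z \<subseteq> V" using Z(1) node_root self by blast
  have finD: "finite D" using ZV finite_V finite_subset unfolding D_def region_def by fastforce
  obtain a q0 l0 where a: "a \<in> H" "q0 \<in> part nd tm H Z" "walk D a q0 l0" "l0 < \<gamma>"
    using Z(4) unfolding clean_def D_def by force
  define Q where "Q = {q \<in> part nd tm H Z. \<exists>l. walk D a q l}"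
  have "finite Q" "Q \<noteq> {}" using a finite_V unfolding Q_def part_def by auto
  then obtain q where q: "q \<in> Q" "\<And>q'. q' \<in> Q \<Longrightarrow> gdist D a q \<le> gdist D a q'"
    using ex_min_if_finite[of "gdist D a ` Q"] by (fastforce simp: not_less)
  define m where "m = gdist D a q"
  have qp: "q \<in> part nd tm H Z" and wq: "walk D a q m"
    using q walk_gdist[OF finD] unfolding Q_def m_def by auto
  have m_min: "m \<le> l'" if "q' \<in> part nd tm H Z" "walk D a q' l'" for q' l'
    using q(2)[of q'] gdist_le[OF finD that(2)] that unfolding Q_def m_def by force
  have m\<gamma>: "m < \<gamma>" using m_min[OF a(2,3)] a(4) by simp
  have "q \<notin> H" using part_nonfree[OF qp] HU by blast
  from walk_first_exit[OF wq a(1) this] obtain p b l1 l2 where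
    pb: "walk (D \<inter> H) a p l1" "adj p b" "b \<in> D" "b \<notin> H" "walk D b q l2" "m = l1 + W p b + l2"
    by blast
  have pH: "p \<in> H" "p \<in> D" using walk_mem[OF pb(1)] by auto
  have b: "b \<in> part nd tm H (nd b)" "nd b \<in> K H"
    using comp_boundary[OF H pH(1) _ pb(4,2)] adj_V[OF pb(2)] by auto
  define Y where "Y = nd b"
  have Y: "b \<in> part nd tm H Y" "Y \<in> K H" using b unfolding Y_def by auto
  \<comment> \<open>The walk avoids the nodes above \<open>Z\<close>, and \<open>Z\<close> is not
    adjacent to \<open>H\<close>; so the node met at \<open>b\<close> lies strictly below
    \<open>Z\<close>. By \<open>comp_clean\<close> the buffer can then be missing only if
    \<open>Z\<close> is a neighbour of \<open>Y\<close>, which entitles \<open>Y\<close> to grow on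
    behalf of \<open>Z\<close>.\<close>
  have "\<not> Z \<subset> Y" using pb(3) part_nonfree[OF Y(1)] unfolding D_def region_def by blast
  moreover have "Y \<noteq> Z" using Y(2) Z(3) by blast
  moreover have "Y \<subseteq> Z \<or> Z \<subseteq> Y"
    using nodes_laminar[OF nbs_nodes[OF Y(2)] Z(1)] nbs_psubset[OF Y(2)] Z(2) HU(2) by blast
  ultimately have YZ: "Y \<subset> Z" by blast
  then have ZY: "Z \<in> K Y" using comp_clean[OF H Y(2) Z(1) _ Z(3)] Z(4) by blast
  define T where "T = {p}"
  define nd' where "nd' = (\<lambda>v. if v \<in> T then Y else nd v)"
  define tm' where "tm' = (\<lambda>v. if v \<in> T then H else tm v)"
  have YH: "Y \<noteq> H" using nbs_psubset[OF Y(2)] by blast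
  interpret st: cop_step V adj W nd tm \<gamma> k H T Y nd' tm'
  proof unfold_locales
    show "nd' \<equiv> \<lambda>v. if v \<in> T then Y else nd v" "tm' \<equiv> \<lambda>v. if v \<in> T then H else tm v"
      unfolding nd'_def tm'_def by auto
    have "conn T" unfolding T_def conn_def using walk_nil by blast
    then show "conn (part nd tm H Y \<union> T)"
      using conn_union[OF comp_conn[OF H Y(2)] _ Y(1), of T p] adj_sym[OF pb(2)] unfolding T_def by simp
  qed (use H pH Y YH T_def in auto)
  define c where "c = cnt \<gamma> nd tm H"
  have l2: "0 \<le> l2" "0 \<le> l1" "0 \<le> W p b" using walk_nonneg pb W_nonneg by blast+
  \<comment> \<open>Either the finished budget suffices at \<open>b\<close>, or the rest of the walk
    from \<open>b\<close> to \<open>q\<close> serves as the unfinished summand.\<close>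
  have radb: "rad nd tm b (\<gamma> * c Y + l2)"
    using ch Y qp pb(5) rad_mono[of nd tm b "\<gamma> * c Y" "\<gamma> * c Y + l2"] l2
    unfolding charged_def c_def D_def by auto
  have radp: "rad nd' tm' p (\<gamma> * c Y + (W p b + l2))"
  proof -
    have nb: "nd' b = Y" "nd' p = Y" "tm' p = H"
      using st.old[of b] part_nonfree[OF Y(1)] st.new[of p] unfolding T_def by auto
    obtain t l where tl: "t \<in> skel nd' tm' Y" "walk (full nd' tm' Y) b t l" "l \<le> \<gamma> * c Y + l2"
      using st.rad'[OF _ radb] part_nonfree[OF Y(1)] nb(1) unfolding rad_def by auto
    have "p \<in> full nd' tm' Y" unfolding full_def using nb adj_V[OF pb(2)] HU(2) by auto
    from walk_Cons[OF pb(2) this tl(2)] have "walk (full nd' tm' Y) p t (W p b + l)" .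
    then show ?thesis unfolding rad_def nb(2) using tl by fastforce
  qed
  have radp1: "rad nd' tm' p (\<gamma> * (c Y + 1))"
    using rad_mono[OF radp] m\<gamma> pb(6) l2 by (simp add: algebra_simps)
  \<comment> \<open>Preceded by the walk from \<open>a\<close> to \<open>p\<close>, a shorter walk
    from \<open>p\<close> to \<open>Z\<close> would beat the minimum \<open>m\<close>.\<close>
  have radp2: "rad nd' tm' p (\<gamma> * c Y + l')" if "q' \<in> part nd tm H Z" "walk D p q' l'" for q' l'
  proof -
    have "walk D a p l1" using pb(1) walk_mono[of "D \<inter> H" a p l1 D] by blast
    from m_min[OF that(1) walk_trans[OF that(2) this]]
    show ?thesis using rad_mono[OF radp, of "\<gamma> * c Y + l'"] pb(6) by simp
  qed
  \<comment> \<open>\<open>Z\<close> is a neighbour of \<open>Y\<close> that is not counted yet, so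
    one more unit still fits into \<open>k\<close>.\<close>
  have ck: "c Y + 1 \<le> k"
  proof -
    let ?S = "{Z \<in> K Y. Z \<notin> K H \<and> clean \<gamma> nd tm H Z}"
    have "card (insert Z ?S) \<le> card (K Y)"
      using ZY finite_nbs by (intro card_mono) auto
    moreover have "card (insert Z ?S) = card ?S + 1" using Z(4) finite_nbs by simp
    ultimately show ?thesis using node_card[OF nbs_nodes[OF Y(2)]] unfolding c_def cnt_def by simp
  qed
  have "cop_state V adj W nd' tm' \<gamma> k"
  proof (rule st.step_state)
    show "rad nd' tm' v (\<gamma> * k)" if "v \<in> T" for v
      using rad_mono[OF radp1] ck gamma_pos that unfolding T_def by simp
    fix H' assume H': "component (free tm') H'" "H' \<subseteq> H - T"
    then have ne: "H' \<noteq> {}" unfolding component_def conn_def by blast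
    note sub = ne H'(2)
    have "charged \<gamma> nd' tm' H' Z"
      unfolding charged_def
    proof (intro ballI)
      fix X v assume X: "X \<in> nbs nd' tm' H'" and v: "v \<in> part nd' tm' H' X"
      have XH: "X \<in> K H" using st.sub_nbs[OF sub] X Y(2) by blast
      let ?c' = "cnt \<gamma> nd' tm' H' X"
      have cc: "\<gamma> * c X \<le> \<gamma> * ?c'" using st.sub_cnt[OF sub XH] gamma_pos unfolding c_def by simp
      have "rad nd' tm' v (\<gamma> * c X) \<or> (Z \<in> K X \<and> rad nd' tm' v (\<gamma> * (c X + 1)) \<and>
        (\<forall>q\<in>part nd tm H Z. \<forall>l. walk D v q l \<longrightarrow> rad nd' tm' v (\<gamma> * c X + l)))"
      proof (cases "v \<in> part nd tm H X")
        case True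
        note r = st.rad'[OF conjunct1[OF part_nonfree[OF True]]]
        show ?thesis using ch XH True r unfolding charged_def c_def D_def by blast
      next
        case False
        then have "X = Y" "v = p" using v st.sub_part[OF sub, of X] unfolding T_def by (auto split: if_splits)
        then show ?thesis using ZY radp1 radp2 by blast
      qed
      then show "rad nd' tm' v (\<gamma> * ?c') \<or> Z \<in> nbs nd' tm' X \<and> Z \<notin> nbs nd' tm' H' \<and> \<not> clean \<gamma> nd' tm' H' Z \<and>
        rad nd' tm' v (\<gamma> * (?c' + 1)) \<and> (\<forall>q\<in>part nd' tm' H' Z. \<forall>l. walk (region nd' tm' H' Z) v q l \<longrightarrow>
        rad nd' tm' v (\<gamma> * ?c' + l))"
      proof (elim disjE conjE)
        assume "rad nd' tm' v (\<gamma> * c X)"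
        then show ?thesis using rad_mono cc by blast
      next
        assume r: "Z \<in> K X" "rad nd' tm' v (\<gamma> * (c X + 1))"
          "\<forall>q\<in>part nd tm H Z. \<forall>l. walk D v q l \<longrightarrow> rad nd' tm' v (\<gamma> * c X + l)"
        show ?thesis
        \<comment> \<open>If the buffer towards \<open>Z\<close> is now complete, the increased
          count pays for the unfinished summand; otherwise the charge is carried on.\<close>
        proof (cases "clean \<gamma> nd' tm' H' Z")
          case True
          have "c X + 1 \<le> ?c'" using st.sub_cnt_Suc[OF sub XH r(1) Z(3,4) True] unfolding c_def .
          then show ?thesis using rad_mono[OF r(2)] gamma_pos by simp
        next
          case False
          have "\<not> X \<subset> H" using nbs_psubset[OF XH] by blast
          then have 1: "Z \<in> nbs nd' tm' X" using r(1) st.unchanged(2) by simp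
          have 2: "Z \<notin> nbs nd' tm' H'" "Z \<noteq> Y" using st.sub_nbs_old[OF sub Z(1,3)] by auto
          have 3: "rad nd' tm' v (\<gamma> * (?c' + 1))"
            using rad_mono[OF r(2)] cc by (simp add: algebra_simps)
          have 4: "part nd' tm' H' Z = part nd tm H Z" using st.sub_part[OF sub] 2 by simp
          have 5: "region nd' tm' H' Z = D" using st.sub_region_eq[OF sub _ ZV] YZ unfolding D_def by blast
          have "rad nd' tm' v (\<gamma> * ?c' + l)" if "q \<in> part nd tm H Z" "walk D v q l" for q l
            using r(3) that rad_mono[of nd' tm' v "\<gamma> * c X + l" "\<gamma> * ?c' + l"] cc by auto
          then show ?thesis using 1 2 3 False unfolding 4 5 by blast
        qed
      qed
    qed
    then show "\<exists>Z. charged \<gamma> nd' tm' H' Z" ..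
  qed
  moreover have "free tm' \<subset> free tm" using st.free' pH HU unfolding T_def by blast
  ultimately show ?thesis by blast
qed

lemma step: "free tm \<noteq> {} \<Longrightarrow> \<exists>nd' tm'. cop_state V adj W nd' tm' \<gamma> k \<and> free tm' \<subset> free tm"
  using comp_ex step_new step_grow by (metis ex_in_conv)

end

context wgraph
begin

theorem cop_decomposition:
  assumes "0 < \<gamma>" "\<not> complete_minor (k + 2)"
  shows "\<exists>nd tm. cop_state V adj W nd tm \<gamma> k \<and> free tm = {}"
proof -
  have "cop_state V adj W nd tm \<gamma> k \<Longrightarrow> \<exists>nd tm. cop_state V adj W nd tm \<gamma> k \<and> free tm = {}" for nd tm
  proof (induction "card (free tm)" arbitrary: nd tm rule: less_induct)
    case less
    show ?case
    proof (cases "free tm = {}")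
      case False
      then obtain nd' tm' where s: "cop_state V adj W nd' tm' \<gamma> k" "free tm' \<subset> free tm"
        using cop_state.step[OF less(2)] by blast
      have "finite (free tm)" using finite_V unfolding free_def by simp
      then show ?thesis using less(1)[OF psubset_card_mono s(1)] s(2) by blast
    qed (use less in blast)
  qed
  moreover have "cop_state V adj W (\<lambda>_. {}) (\<lambda>_. {}) \<gamma> k"
    by unfold_locales (use assms in \<open>auto simp: free_def nodes_def nbs_def part_def charged_def\<close>)
  ultimately show ?thesis by blast
qed

end

section \<open>Counting the nodes above within a given distance\<close>

locale cop_final = cop_state V adj W nd tm \<gamma> k for V :: "'a set" and adj W nd tm \<gamma> k +
  assumes free_empty: "free tm = {}"
begin

definition final_region :: "'a set \<Rightarrow> 'a set" where
  "final_region X = {v \<in> V. nd v \<subseteq> X}"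

lemma V_assigned: "v \<in> V \<Longrightarrow> v \<in> V - free tm"
  using free_empty by simp

lemma nd_node: "v \<in> V \<Longrightarrow> nd v \<in> N"
  unfolding nodes_def using V_assigned by blast

lemma in_nd: "v \<in> V \<Longrightarrow> v \<in> tm v \<and> tm v \<subseteq> nd v \<and> v \<in> nd v \<and> nd v \<subseteq> V"
  using self[OF V_assigned] by blast

lemma final_region_sub: "final_region X \<subseteq> X" "final_region X \<subseteq> V"
  unfolding final_region_def using in_nd by auto

lemma final_region_mono: "X \<subseteq> Z \<Longrightarrow> final_region X \<subseteq> final_region Z"
  unfolding final_region_def by auto

lemma nd_comparable:
  assumes "x \<in> nd u" "x \<in> nd v" "u \<in> V" "v \<in> V"
  shows "nd u \<subseteq> nd v \<or> nd v \<subseteq> nd u"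
  using nodes_laminar[OF nd_node nd_node, OF assms(3,4)] assms by blast

text \<open>When the first endpoint was assigned, both endpoints lay in the same component; so both
  nodes contain a common vertex.\<close>

lemma adj_comparable:
  assumes "adj u v"
  shows "nd u \<subseteq> nd v \<or> nd v \<subseteq> nd u"
proof -
  have uv: "u \<in> V" "v \<in> V" using adj_V assms by auto
  show ?thesis
  proof (cases "v \<in> tm u")
    case True
    then show ?thesis using in_nd uv nd_comparable[of v u v] by blast
  next
    case False
    then have "tm u \<subset> tm v" using closed[OF V_assigned[OF uv(1)] _ _ assms] in_nd[OF uv(1)] uv by blast
    then show ?thesis using in_nd uv nd_comparable[of u u v] by blast
  qed
qed

text \<open>Choose \<open>p\<close> in \<open>B\<close> with a maximal node. A walk leaving the
  vertices below it would cross an edge to a vertex whose node is comparable with this one, hence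
  larger, against maximality.\<close>

lemma capture:
  assumes "conn B" "B \<subseteq> V"
  shows "\<exists>p\<in>B. B \<subseteq> final_region (nd p)"
proof -
  have "finite B" using assms(2) finite_V by (rule finite_subset)
  then have "finite (nd ` B)" "nd ` B \<noteq> {}" using assms unfolding conn_def by auto
  then obtain X where X: "X \<in> nd ` B" "\<And>Z. Z \<in> nd ` B \<Longrightarrow> X \<subseteq> Z \<Longrightarrow> X = Z"
    using finite_has_maximal by metis
  then obtain p where p: "p \<in> B" "nd p = X" by blast
  have "nd v \<subseteq> X" if v: "v \<in> B" for v
  proof (rule ccontr)
    assume nv: "\<not> nd v \<subseteq> X"
    obtain l where w: "walk B p v l" using assms v p unfolding conn_def by blast
    have "p \<in> {v. nd v \<subseteq> X}" "v \<notin> {v. nd v \<subseteq> X}" using p nv by auto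
    from walk_first_exit[OF w this] obtain a b where ab: "a \<in> B" "nd a \<subseteq> X" "adj a b" "b \<in> B" "\<not> nd b \<subseteq> X"
      using walk_mem by blast
    then have "nd a \<subseteq> nd b" using adj_comparable[OF ab(3)] by blast
    then have "nd b \<subseteq> X \<or> X \<subseteq> nd b"
      using nd_comparable[of a b p] in_nd[of a] ab p assms by blast
    then show False using X(2)[of "nd b"] ab by blast
  qed
  then show ?thesis using p assms unfolding final_region_def by blast
qed

lemma node_out: 
  assumes "Y \<in> N" "v \<in> Y" shows "\<not> Y \<subset> tm v"
proof
  assume a: "Y \<subset> tm v"
  obtain u where u: "u \<in> V - free tm" "tm u = Y" "nd u = Y" using node_root assms(1) by blast
  then have "v \<in> V" using assms(2) self by blast
  then show False using earlier_out[OF u(1) V_assigned] u a assms by blast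
qed

lemma node_boundary:
  assumes "Y \<in> N" "x \<in> Y" "y \<notin> Y" "adj x y"
  shows "Y \<subset> tm y" "y \<in> part nd tm Y (nd y)" "nd y \<in> K Y"
proof -
  obtain u where u: "u \<in> V - free tm" "tm u = Y" "nd u = Y" using node_root assms(1) by blast
  show 1: "Y \<subset> tm y" using closed[OF u(1) _ _ assms(4)] u assms adj_V by blast
  show 2: "y \<in> part nd tm Y (nd y)" using 1 adj_V[OF assms(4)] unfolding part_def by blast
  show "nd y \<in> K Y" using 2 assms unfolding nbs_def by blast
qed

lemma skel_notin: "Y \<in> N \<Longrightarrow> z \<in> sk X \<Longrightarrow> Y \<subset> X \<Longrightarrow> z \<notin> Y"
  using node_out[of Y z] unfolding skel_def by blast

lemma nbsI: "x \<in> Y \<Longrightarrow> adj x y \<Longrightarrow> Y \<subset> tm y \<Longrightarrow> nd y \<in> K Y"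
  unfolding nbs_def part_def using adj_V by blast

section \<open>Chains of topmost neighbours\<close>

definition top_nb :: "'a set \<Rightarrow> 'a set \<Rightarrow> 'a set \<Rightarrow> bool" where
  "top_nb Y X Y' \<longleftrightarrow> Y' \<in> K Y \<and> Y' \<subseteq> X \<and> (\<forall>Y''\<in>K Y. Y'' \<subseteq> X \<longrightarrow> Y'' \<subseteq> Y')"

lemma nbs_greatest:
  assumes "S \<subseteq> K Y" "S \<noteq> {}"
  shows "\<exists>Y'\<in>S. \<forall>Y''\<in>S. Y'' \<subseteq> Y'"
proof -
  have "finite S" using assms finite_nbs finite_subset by blast
  then obtain Y' where "Y' \<in> S" "\<And>Z. Z \<in> S \<Longrightarrow> Y' \<subseteq> Z \<Longrightarrow> Y' = Z"
    using finite_has_maximal[OF _ assms(2)] by metis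
  then show ?thesis using nbs_comparable assms by (metis order_refl subsetD)
qed

lemma top_nb_ex:
  assumes "Y0 \<in> N" "a \<in> Y0" "walk (final_region X) a z l" "z \<notin> Y0"
  shows "\<exists>Y. top_nb Y0 X Y"
proof -
  obtain p b where "p \<in> Y0" "adj p b" "b \<in> final_region X" "b \<notin> Y0"
    using walk_first_exit[OF assms(3,2,4)] walk_mem by blast
  then have "nd b \<in> K Y0" "nd b \<subseteq> X" using node_boundary[OF assms(1)] unfolding final_region_def by auto
  then have "\<exists>Y'\<in>{Y \<in> K Y0. Y \<subseteq> X}. \<forall>Y''\<in>{Y \<in> K Y0. Y \<subseteq> X}. Y'' \<subseteq> Y'"
    by (intro nbs_greatest) auto
  then show ?thesis unfolding top_nb_def by blast
qed

text \<open>Only greedy chains count: each hop goes to the topmost neighbour still below the target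
  \<open>X\<close>. So a target containing a neighbour \<open>Y1\<close> is never approached through
  a neighbour strictly below \<open>Y1\<close>, and on this the count in
  \<open>reach_card_aux\<close> rests.\<close>

primrec reach :: "nat \<Rightarrow> 'a set \<Rightarrow> 'a set set" where
  "reach 0 Y = {}"
| "reach (Suc m) Y = {X. \<exists>Y'. top_nb Y X Y' \<and> (X = Y' \<or> X \<in> reach m Y')}"

lemma reachE:
  assumes "X \<in> reach m Y"
  obtains m' Y' where "m = Suc m'" "top_nb Y X Y'" "X = Y' \<or> X \<in> reach m' Y'"
  using assms by (cases m) auto

lemma reach_nodes: "X \<in> reach m Y \<Longrightarrow> X \<in> N"
proof (induction m arbitrary: Y)
  case (Suc m)
  then show ?case using nbs_nodes unfolding reach.simps top_nb_def by blast
qed simp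

lemma finite_reach: "finite (reach m Y)"
  using finite_nodes reach_nodes by (metis finite_subset subsetI)

text \<open>A walk inside \<^term>\<open>final_region X\<close> that leaves \<open>Y0\<close> costs at least \<open>\<gamma>\<close> until it first meets a vertex
  that had been assigned to a node above \<open>Y\<close> when \<open>Y0\<close> was created, since that node is not a
  neighbour of \<open>Y0\<close>.\<close>

lemma hop_stage:
  assumes Y0: "Y0 \<in> N" "a \<in> Y0" and Y: "top_nb Y0 X Y" "Y \<noteq> X"
    and z: "z \<in> sk X" "Y0 \<subset> X"
    and G: "G = {v. \<not> (Y0 \<subset> tm v \<and> Y \<subset> nd v)}"
    and w: "walk (final_region X \<inter> G) a s l0" "walk (final_region X) s z l'"
  shows "\<exists>p q l1 l3. p \<in> Y \<and> p \<in> final_region X \<and> adj p q \<and> walk (final_region X) q z l3 \<and> l' = l1 + W p q + l3 \<and> 0 \<le> l1 \<and>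
    \<gamma> \<le> l0 + l1 + W p q \<and> (\<forall>Y'. top_nb Y X Y' \<longrightarrow> \<not> (Y \<subset> tm q \<and> Y' \<subset> nd q))"
proof -
  have K: "Y \<in> K Y0" "Y \<subset> X" using Y unfolding top_nb_def by auto
  have YN: "Y \<in> N" using nbs_nodes K by blast
  have Y0Y: "Y0 \<subset> Y" using nbs_psubset K by blast
  have zG: "z \<notin> G" using z K unfolding G skel_def by auto
  have sG: "s \<in> G" using walk_mem[OF w(1)] by blast
  from walk_first_exit[OF w(2) sG zG] obtain p q l1 l3 where
    pq: "walk (final_region X \<inter> G) s p l1" "adj p q" "q \<in> final_region X" "q \<notin> G" "walk (final_region X) q z l3" "l' = l1 + W p q + l3"
    by blast
  \<comment> \<open>To leave \<open>Y\<close> is to meet a vertex assigned before \<open>Y\<close>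
    came up, hence before \<open>Y0\<close> and to a node above \<open>Y\<close>; such vertices are
    outside \<open>G\<close>.\<close>
  have "walk (final_region X \<inter> G \<inter> Y) a p (l0 + l1)"
  proof (rule walk_within[OF walk_trans[OF pq(1) w(1)]])
    show "a \<in> Y" using Y0 Y0Y by blast
    fix x y assume xy: "x \<in> final_region X \<inter> G" "x \<in> Y" "adj x y" "y \<in> final_region X \<inter> G"
    show "y \<in> Y"
    proof (rule ccontr)
      assume "y \<notin> Y"
      from node_boundary(1)[OF YN xy(2) this xy(3)] have "Y \<subset> tm y" .
      then have "Y0 \<subset> tm y \<and> Y \<subset> nd y" using Y0Y in_nd[of y] adj_V[OF xy(3)] by blast
      then show False using xy(4) unfolding G by blast
    qed
  qed
  note wap = this
  have p: "p \<in> Y" "p \<in> final_region X" using walk_mem[OF wap] by auto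
  have qV: "q \<in> V" using adj_V pq(2) by blast
  have q: "Y0 \<subset> tm q" "Y \<subset> nd q" "nd q \<subseteq> X" using pq(3,4) unfolding G final_region_def by auto
  \<comment> \<open>\<open>nd q\<close> is below \<open>X\<close> but strictly above the topmost
    neighbour \<open>Y\<close>; so it is no neighbour of \<open>Y0\<close>, and
    \<open>node_clean\<close> gives a buffer between them.\<close>
  have nq: "nd q \<notin> K Y0" using Y q unfolding top_nb_def by blast
  have sub: "final_region X \<inter> G \<inter> Y \<subseteq> region nd tm Y0 (nd q)" using q Y0Y unfolding G region_def by auto
  have "q \<in> region nd tm Y0 (nd q)" using in_nd[OF qV] unfolding region_def by blast
  from walk_snoc[OF walk_mono[OF wap sub] pq(2) this]
  have wq: "walk (region nd tm Y0 (nd q)) a q (l0 + l1 + W p q)" .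
  have "clean \<gamma> nd tm Y0 (nd q)" using node_clean[OF Y0(1) nd_node[OF qV] _ nq] Y0Y q by blast
  moreover have "q \<in> part nd tm Y0 (nd q)" using q qV unfolding part_def by blast
  ultimately have "\<gamma> \<le> l0 + l1 + W p q" using wq Y0(2) unfolding clean_def by blast
  \<comment> \<open>If \<open>q\<close> was assigned before \<open>Y\<close> came up, its node is a
    neighbour of \<open>Y\<close> and cannot exceed the topmost one. So the edge from
    \<open>p\<close> to \<open>q\<close> may open the next stage.\<close>
  moreover have "\<not> (Y \<subset> tm q \<and> Y' \<subset> nd q)" if "top_nb Y X Y'" for Y'
    using that nbsI[OF p(1) pq(2)] q(3) unfolding top_nb_def by blast
  ultimately show ?thesis using p pq walk_nonneg[OF pq(1)] by blast
qed

text \<open>Consecutive stages overlap in the edge from \<open>a\<close> to \<open>b\<close>; hence the potential counts edges twice.\<close>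

lemma hop:
  assumes "Y0 \<in> N" "a \<in> Y0" "a \<in> final_region X" "adj a b" "walk (final_region X) b z l" "z \<in> sk X" "Y0 \<subset> X"
    and "\<And>Y. top_nb Y0 X Y \<Longrightarrow> \<not> (Y0 \<subset> tm b \<and> Y \<subset> nd b)"
    and "W a b + 2 * l \<le> real m * \<gamma>"
  shows "X \<in> reach (Suc m) Y0"
  using assms
proof (induction m arbitrary: Y0 a b l rule: less_induct)
  case (less m Y0 a b l)
  note a = less.prems
  have wa: "walk (final_region X) a z (W a b + l)" using walk_Cons a by blast
  have "z \<notin> Y0" using skel_notin[OF a(1,6,7)] .
  then obtain Y where Y: "top_nb Y0 X Y" using top_nb_ex[OF a(1,2) wa] by blast
  show ?case
  proof (cases "Y = X")
    case False
    define G where "G = {v. \<not> (Y0 \<subset> tm v \<and> Y \<subset> nd v)}"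
    have "walk (final_region X \<inter> G) a b (W a b)"
      using a(8)[OF Y] a(2,3,4) node_out[OF a(1)] walk_mem[OF a(5)] unfolding G_def by (intro walk_edge) auto
    from hop_stage[OF a(1,2) Y False a(6,7) G_def this a(5)] obtain p q l1 l3 where
      pq: "p \<in> Y" "p \<in> final_region X" "adj p q" "walk (final_region X) q z l3" "l = l1 + W p q + l3" "0 \<le> l1"
        "\<gamma> \<le> W a b + l1 + W p q"
      and nt: "\<And>Y'. top_nb Y X Y' \<Longrightarrow> \<not> (Y \<subset> tm q \<and> Y' \<subset> nd q)" by blast
    have le: "W p q + 2 * l3 + \<gamma> \<le> real m * \<gamma>" using a(9) pq(5-7) W_nonneg[of p q] by simp
    moreover have "0 \<le> W p q + 2 * l3" using W_nonneg[of p q] walk_nonneg[OF pq(4)] by simp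
    ultimately have "0 < real m * \<gamma>" using gamma_pos by linarith
    then have "m \<noteq> 0" by (intro notI) simp
    then obtain m' where m': "m = Suc m'" using not0_implies_Suc by blast
    have "W p q + 2 * l3 \<le> real m' * \<gamma>" using le unfolding m' by (simp add: algebra_simps)
    moreover have "Y \<in> N" "Y \<subset> X" using Y False nbs_nodes unfolding top_nb_def by auto
    ultimately have "X \<in> reach (Suc m') Y" using less.IH[of m', OF _ _ pq(1-4) a(6) _ nt] m' by blast
    then show ?thesis using Y m' by auto
  qed (use Y in auto)
qed

text \<open>The first stage has no preceding edge and its length is not charged. It is granted as
  one extra hop, and \<open>hop\<close> treats the rest.\<close>

lemma walk_reach:
  assumes "Y0 \<in> N" "a \<in> Y0" "walk (final_region X) a z l" "z \<in> sk X" "Y0 \<subset> X" "2 * l \<le> real m * \<gamma>"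
  shows "X \<in> reach (Suc (Suc m)) Y0"
proof -
  have "z \<notin> Y0" using skel_notin[OF assms(1,4,5)] .
  then obtain Y where Y: "top_nb Y0 X Y" using top_nb_ex[OF assms(1-3)] by blast
  show ?thesis
  proof (cases "Y = X")
    case False
    define G where "G = {v. \<not> (Y0 \<subset> tm v \<and> Y \<subset> nd v)}"
    have "walk (final_region X \<inter> G) a a 0"
      using node_out[OF assms(1,2)] walk_mem[OF assms(3)] unfolding G_def by (intro walk_nil) auto
    from hop_stage[OF assms(1,2) Y False assms(4,5) G_def this assms(3)] obtain p q l1 l3 where
      pq: "p \<in> Y" "p \<in> final_region X" "adj p q" "walk (final_region X) q z l3" "l = l1 + W p q + l3" "0 \<le> l1"
      and nt: "\<And>Y'. top_nb Y X Y' \<Longrightarrow> \<not> (Y \<subset> tm q \<and> Y' \<subset> nd q)" by blast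
    have "W p q + 2 * l3 \<le> real m * \<gamma>" using assms(6) pq(5,6) W_nonneg[of p q] by simp
    moreover have "Y \<in> N" "Y \<subset> X" using Y False nbs_nodes unfolding top_nb_def by auto
    ultimately have "X \<in> reach (Suc m) Y" using hop[OF _ pq(1-4) assms(4) _ nt] by blast
    then show ?thesis using Y by auto
  qed (use Y in auto)
qed

text \<open>Pascal's rule. \<open>F\<close> collects neighbours of \<open>Y\<close> above all
  targets, and \<open>j\<close> is the number of neighbours that may still be added. Let
  \<open>Y1\<close> be the topmost neighbour outside \<open>F\<close>. Targets strictly below
  \<open>Y1\<close> are counted with \<open>Y1\<close> added to \<open>F\<close>, which lowers
  \<open>j\<close>; for all others the first hop goes to \<open>Y1\<close>, which lowers
  \<open>m\<close>. The set \<open>F\<close> survives this hop because the neighbours of a node are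
  neighbours of each other, by \<open>node_clique\<close>.\<close>

lemma reach_card_aux:
  assumes "Y \<in> N" "F \<subseteq> K Y" "card F + j = k"
  shows "card {X \<in> reach m Y. \<forall>Z\<in>F. X \<subset> Z} + 1 \<le> (j + m) choose j"
  using assms
proof (induction "j + m" arbitrary: j m Y F rule: less_induct)
  case less
  define S where "S = {X \<in> reach m Y. \<forall>Z\<in>F. X \<subset> Z}"
  have pos: "1 \<le> (j + m) choose j" by (simp add: Suc_le_eq zero_less_binomial)
  have "card S + 1 \<le> (j + m) choose j"
  proof (cases "m = 0 \<or> K Y - F = {}")
    case True
    have "S = {}"
    proof (rule ccontr)
      assume "S \<noteq> {}"
      then obtain X where X: "X \<in> reach m Y" "\<forall>Z\<in>F. X \<subset> Z" unfolding S_def by blast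
      from X(1) obtain m' Y' where "m = Suc m'" "top_nb Y X Y'" by (rule reachE)
      then have "m \<noteq> 0" "Y' \<in> K Y" "Y' \<subseteq> X" unfolding top_nb_def by auto
      then show False using True X(2) \<open>m \<noteq> 0\<close> by blast
    qed
    then show ?thesis using pos by simp
  next
    case False
    then obtain m' where m: "m = Suc m'" using not0_implies_Suc by blast
    obtain Y1 where Y1: "Y1 \<in> K Y - F" "\<And>Z. Z \<in> K Y - F \<Longrightarrow> Z \<subseteq> Y1"
      using nbs_greatest[of "K Y - F" Y] False by blast
    have Y1N: "Y1 \<in> N" using Y1 nbs_nodes by blast
    have finF: "finite F" using less(3) finite_nbs finite_subset by blast
    have "F \<subset> K Y" using less(3) Y1 by blast
    then have "card F < k" using psubset_card_mono[OF finite_nbs] node_card[OF less(2)] by (meson less_le_trans)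
    then obtain i where j: "j = Suc i" using less(4) by (metis add.right_neutral nat_neq_iff not0_implies_Suc)
    define S1 where "S1 = {X \<in> reach m Y. \<forall>Z\<in>insert Y1 F. X \<subset> Z}"
    have c1: "card S1 + 1 \<le> (i + m) choose i"
      unfolding S1_def using less(1)[of i m Y "insert Y1 F"] less(2,3,4) Y1 finF j by simp
    define S2 where "S2 = {X \<in> reach m' Y1. \<forall>Z\<in>F. X \<subset> Z}"
    have fin: "finite S1" "finite S2" unfolding S1_def S2_def using finite_reach by auto
    have S_sub: "X \<in> S1 \<or> X = Y1 \<or> X \<in> S2" "X \<in> S1 \<or> Y1 \<subseteq> X" if "X \<in> S" for X
    proof -
      obtain Y' where Y': "top_nb Y X Y'" "X = Y' \<or> X \<in> reach m' Y'" and XF: "\<forall>Z\<in>F. X \<subset> Z"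
        using reachE[of X "Suc m'" Y] \<open>X \<in> S\<close> unfolding S_def m by blast
      have Y'F: "Y' \<in> K Y - F" using Y' XF unfolding top_nb_def by blast
      have cmp: "X \<subset> Y1 \<or> Y1 \<subseteq> X"
      proof -
        have "X \<in> N" using \<open>X \<in> S\<close> reach_nodes unfolding S_def by blast
        moreover have "Y \<subseteq> X" using Y'(1) nbs_psubset[of Y' Y] unfolding top_nb_def by blast
        moreover have "Y \<subseteq> Y1" using Y1(1) nbs_psubset[of Y1 Y] by blast
        moreover have "Y \<noteq> {}" using node_root[OF less(2)] by blast
        moreover have "X \<subseteq> Y1 \<or> Y1 \<subseteq> X \<or> X \<inter> Y1 = {}"
          using nodes_laminar[OF \<open>X \<in> N\<close> Y1N] .
        ultimately show ?thesis by blast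
      qed
      have inS: "X \<in> reach m Y" using \<open>X \<in> S\<close> unfolding S_def by blast
      show "X \<in> S1 \<or> Y1 \<subseteq> X" using cmp inS XF unfolding S1_def by blast
      show "X \<in> S1 \<or> X = Y1 \<or> X \<in> S2"
      proof (cases "X \<subset> Y1")
        case True
        then show ?thesis using inS XF unfolding S1_def by blast
      next
        case False
        then have "Y1 \<subseteq> X" using cmp by blast
        then have "Y1 \<subseteq> Y'" using Y' Y1(1) unfolding top_nb_def by blast
        then have "Y' = Y1" using Y1(2)[OF Y'F] by blast
        then show ?thesis using Y'(2) XF unfolding S2_def by blast
      qed
    qed
    have bin: "(j + m) choose j = (i + m choose i) + (j + m' choose j)"
      unfolding j m by simp
    show ?thesis
    proof (cases "F \<subseteq> K Y1")
      case True
      have c2: "card S2 + 1 \<le> (j + m') choose j"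
        unfolding S2_def using less(1)[OF _ Y1N True less(4)] m by simp
      have "S \<subseteq> insert Y1 (S1 \<union> S2)" using S_sub by blast
      then have "card S \<le> card (insert Y1 (S1 \<union> S2))" using fin by (intro card_mono) auto
      also have "\<dots> \<le> card S1 + card S2 + 1"
        using card_Un_le[of S1 S2] fin by (simp add: card_insert_if)
      finally show ?thesis using c1 c2 bin by simp
    next
      case False
      \<comment> \<open>A target above \<open>Y1\<close> would put \<open>Y1\<close> below every
        member of \<open>F\<close>, and then \<open>node_clique\<close> would yield
        \<open>F \<subseteq> K Y1\<close>.\<close>
      have "S \<subseteq> S1"
      proof
        fix X assume X: "X \<in> S"
        show "X \<in> S1"
        proof (rule ccontr)
          assume "X \<notin> S1"
          then have "Y1 \<subset> Z" if "Z \<in> F" for Z using S_sub(2)[OF X] X that unfolding S_def by blast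
          then have "F \<subseteq> K Y1" using node_clique[OF less(2) _ _] Y1(1) less(3) by blast
          then show False using False by blast
        qed
      qed
      then have "card S \<le> card S1" using fin by (intro card_mono)
      then show ?thesis using c1 bin by simp
    qed
  qed
  then show ?case unfolding S_def .
qed

lemma reach_card: "Y \<in> N \<Longrightarrow> card (reach m Y) + 1 \<le> (k + m) choose k"
  using reach_card_aux[of Y "{}" k m] by simp

end

section \<open>Coloured covers\<close>

text \<open>The element with the least \<open>f\<close> is coloured last; then all its conflicts are
  among those bounded by the hypothesis.\<close>

lemma greedy_colouring:
  fixes f :: "'b \<Rightarrow> nat"
  assumes "finite S" "\<And>x y. R x y \<Longrightarrow> R y x"
    and "\<And>x. x \<in> S \<Longrightarrow> card {y \<in> S. y \<noteq> x \<and> R x y \<and> f x \<le> f y} \<le> s"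
  shows "\<exists>col :: 'b \<Rightarrow> nat. (\<forall>x\<in>S. col x \<le> s) \<and> (\<forall>x\<in>S. \<forall>y\<in>S. x \<noteq> y \<longrightarrow> R x y \<longrightarrow> col x \<noteq> col y)"
  using assms(1,3)
proof (induction "card S" arbitrary: S)
  case 0
  then show ?case by auto
next
  case (Suc m)
  then have "f ` S \<noteq> {}" "finite (f ` S)" by auto
  from ex_min_if_finite[OF this(2,1)] obtain x where x: "x \<in> S" "\<And>y. y \<in> S \<Longrightarrow> f x \<le> f y"
    by (fastforce simp: not_less)
  have "card {y \<in> S - {x}. y \<noteq> z \<and> R z y \<and> f z \<le> f y} \<le> s" if "z \<in> S - {x}" for z
  proof -
    have "card {y \<in> S - {x}. y \<noteq> z \<and> R z y \<and> f z \<le> f y} \<le> card {y \<in> S. y \<noteq> z \<and> R z y \<and> f z \<le> f y}"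
      using Suc.prems(1) by (intro card_mono) auto
    then show ?thesis using Suc.prems(2)[of z] that by simp
  qed
  moreover have "m = card (S - {x})" using Suc.hyps(2) Suc.prems(1) x(1) by simp
  ultimately obtain col :: "'b \<Rightarrow> nat" where col: "\<And>y. y \<in> S - {x} \<Longrightarrow> col y \<le> s"
    "\<And>y z. y \<in> S - {x} \<Longrightarrow> z \<in> S - {x} \<Longrightarrow> y \<noteq> z \<Longrightarrow> R y z \<Longrightarrow> col y \<noteq> col z"
    using Suc.hyps(1)[of "S - {x}"] Suc.prems(1) by blast
  define B where "B = {y \<in> S. y \<noteq> x \<and> R x y}"
  have "B = {y \<in> S. y \<noteq> x \<and> R x y \<and> f x \<le> f y}" using x unfolding B_def by auto
  then have "card B \<le> s" using Suc.prems(2)[OF x(1)] by simp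
  moreover have "finite B" using Suc.prems(1) unfolding B_def by simp
  ultimately have "card (col ` B) < card {..s}" using card_image_le[of B col] by simp
  then have "\<not> {..s} \<subseteq> col ` B" using card_mono[of "col ` B" "{..s}"] \<open>finite B\<close> by auto
  then obtain c where c: "c \<le> s" "c \<notin> col ` B" by auto
  define col' where "col' = col(x := c)"
  have "col' y \<le> s" if "y \<in> S" for y using col(1)[of y] c that unfolding col'_def by auto
  moreover have "col' y \<noteq> col' z" if "y \<in> S" "z \<in> S" "y \<noteq> z" "R y z" for y z
  proof -
    consider "y = x" | "z = x" | "y \<noteq> x" "z \<noteq> x" by blast
    then show ?thesis
    proof cases
      case 1
      then have "z \<in> B" using that unfolding B_def by blast
      then show ?thesis using 1 c that unfolding col'_def by auto
    next
      case 2
      then have "y \<in> B" using that assms(2) unfolding B_def by blast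
      then show ?thesis using 2 c that unfolding col'_def by auto
    next
      case 3
      then show ?thesis using col(2)[of y z] that unfolding col'_def by auto
    qed
  qed
  ultimately show ?case by blast
qed

lemma card_UN_bound:
  assumes "finite I" "\<And>i. i \<in> I \<Longrightarrow> real (card (A i)) \<le> b"
  shows "real (card (\<Union>i\<in>I. A i)) \<le> real (card I) * b"
proof -
  have "real (card (\<Union>i\<in>I. A i)) \<le> real (\<Sum>i\<in>I. card (A i))"
    using card_UN_le[OF assms(1)] of_nat_le_iff by blast
  also have "\<dots> = (\<Sum>i\<in>I. real (card (A i)))" by simp
  also have "\<dots> \<le> real (card I) * b" using assms(2) by (intro sum_bounded_above) auto
  finally show ?thesis .
qed

text \<open>Bounding the cluster of \<open>x\<close> by a ball around \<open>x\<close>, rather than only its diameter, is what leads to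
  distortion \<open>3 + \<epsilon>\<close> instead of \<open>4 + \<epsilon>\<close>.\<close>

definition coloured_cover :: "'a set \<Rightarrow> ('a \<Rightarrow> 'a \<Rightarrow> real) \<Rightarrow> real \<Rightarrow> real \<Rightarrow> nat \<Rightarrow> (nat \<Rightarrow> 'a set set) \<Rightarrow> bool" where
  "coloured_cover V d R \<epsilon> s \<C> \<longleftrightarrow>
    (\<forall>c<s. \<forall>C\<in>\<C> c. C \<subseteq> V \<and> (\<forall>u\<in>C. \<forall>v\<in>C. d u v \<le> 5 * R)) \<and>
    (\<forall>c<s. \<forall>C\<in>\<C> c. \<forall>C'\<in>\<C> c. C \<noteq> C' \<longrightarrow> C \<inter> C' = {}) \<and>
    (\<forall>x\<in>V. \<exists>c<s. \<exists>C\<in>\<C> c. (\<forall>v\<in>V. d x v \<le> R \<longrightarrow> v \<in> C) \<and> (\<forall>v\<in>C. d x v \<le> (3 + \<epsilon>) * R))"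

context wgraph
begin

text \<open>Prefix lengths bound the distances from \<open>x\<close>. Hence balls are connected, as
  \<open>capture\<close> requires.\<close>

lemma walk_in_ball:
  assumes "walk V x v l"
  shows "walk {t \<in> V. gdist V x t \<le> l} x v l"
proof -
  have "walk V x v l \<Longrightarrow> walk {t \<in> V. gdist V x t \<le> l} x v l"
  proof (induction rule: walk.induct)
    case (walk_nil u)
    then show ?case using gdist_le[OF finite_V walk.walk_nil[OF walk_nil]] by (auto intro: walk.walk_nil)
  next
    case (walk_snoc u v l x)
    have "walk V u x (l + W v x)" using walk_snoc by (auto intro: walk.walk_snoc)
    then have "x \<in> {t \<in> V. gdist V u t \<le> l + W v x}" using gdist_le[OF finite_V] walk_snoc(3) by blast
    moreover have "walk {t \<in> V. gdist V u t \<le> l + W v x} u v l"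
      using walk_snoc(4) by (rule walk_mono) (use W_nonneg[of v x] in force)
    ultimately show ?case using walk.walk_snoc walk_snoc(2) by blast
  qed
  then show ?thesis using assms by blast
qed

end

section \<open>Clusters around net points of the skeletons\<close>

context cop_final
begin

lemma skel_final_region: "sk Y \<subseteq> final_region Y"
  unfolding skel_def final_region_def by auto

lemma full_final_region: "full nd tm Y \<subseteq> final_region Y"
  unfolding full_def final_region_def by auto

lemma to_skel:
  assumes "p \<in> V"
  shows "\<exists>t l. t \<in> sk (nd p) \<and> walk (final_region (nd p)) p t l \<and> l \<le> \<gamma> * k"
  using node_rad[OF V_assigned[OF assms]] walk_mono[OF _ full_final_region] unfolding rad_def by blast

lemma node_net:
  assumes "Y \<in> N" "0 < \<delta>"
  shows "\<exists>Z\<subseteq>sk Y. (\<forall>t\<in>sk Y. \<exists>z\<in>Z. \<exists>l\<le>\<delta>. walk (final_region Y) t z l) \<and>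
    (\<forall>q l. 0 \<le> l \<longrightarrow> real (card {z\<in>Z. \<exists>l'\<le>l. walk Y q z l'}) \<le> (real k + 1) * (2 * l / \<delta> + 2))"
proof -
  obtain r \<P> where P: "finite \<P>" "card \<P> \<le> k + 1" "\<Union>\<P> = sk Y" "\<And>P. P \<in> \<P> \<Longrightarrow> geo Y r P"
    using node_skel[OF assms(1)] by blast
  have finY: "finite Y" using node_root[OF assms(1)] in_nd finite_V finite_subset by (metis DiffD1)
  define net where "net = (\<lambda>P Z. Z \<subseteq> P \<and> (\<forall>t\<in>P. \<exists>z\<in>Z. \<exists>l\<le>\<delta>. walk P t z l) \<and>
    (\<forall>q l. 0 \<le> l \<longrightarrow> real (card {z\<in>Z. \<exists>l'\<le>l. walk Y q z l'}) \<le> 2 * l / \<delta> + 2))"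
  have "\<forall>P\<in>\<P>. \<exists>Z. net P Z"
    using geo_net[OF finY P(4) assms(2)] unfolding net_def by blast
  then obtain g where gn: "\<forall>P\<in>\<P>. net P (g P)" by (rule bchoice[THEN exE])
  have g: "P \<in> \<P> \<Longrightarrow> g P \<subseteq> P" 
    "P \<in> \<P> \<Longrightarrow> t \<in> P \<Longrightarrow> \<exists>z\<in>g P. \<exists>l\<le>\<delta>. walk P t z l"
    "P \<in> \<P> \<Longrightarrow> 0 \<le> l \<Longrightarrow> real (card {z\<in>g P. \<exists>l'\<le>l. walk Y q z l'}) \<le> 2 * l / \<delta> + 2" for P t q l
    using gn unfolding net_def by blast+
  define Z where "Z = (\<Union>P\<in>\<P>. g P)"
  have "Z \<subseteq> sk Y" using g(1) P(3) unfolding Z_def by blast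
  moreover have "\<exists>z\<in>Z. \<exists>l\<le>\<delta>. walk (final_region Y) t z l" if "t \<in> sk Y" for t
  proof -
    obtain Q where Q: "Q \<in> \<P>" "t \<in> Q" using \<open>t \<in> sk Y\<close> P(3) by blast
    have "Q \<subseteq> final_region Y" using Q P(3) skel_final_region by blast
    then show ?thesis using g(2)[OF Q] walk_mono[of Q t _ _ "final_region Y"] Q(1) unfolding Z_def by blast
  qed
  moreover have "real (card {z\<in>Z. \<exists>l'\<le>l. walk Y q z l'}) \<le> (real k + 1) * (2 * l / \<delta> + 2)" if l: "0 \<le> l" for q l
  proof -
    have "{z\<in>Z. \<exists>l'\<le>l. walk Y q z l'} = (\<Union>P\<in>\<P>. {z\<in>g P. \<exists>l'\<le>l. walk Y q z l'})" unfolding Z_def by blast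
    then have "real (card {z\<in>Z. \<exists>l'\<le>l. walk Y q z l'}) \<le> real (card \<P>) * (2 * l / \<delta> + 2)"
      using card_UN_bound[OF P(1), of "\<lambda>P. {z\<in>g P. \<exists>l'\<le>l. walk Y q z l'}"] g(3)[OF _ l] by simp
    also have "\<dots> \<le> (real k + 1) * (2 * l / \<delta> + 2)" using P(2) l assms(2) by (intro mult_right_mono) auto
    finally show ?thesis .
  qed
  ultimately show ?thesis by blast
qed

lemma clusters:
  assumes conn: "conn V" and R: "0 < R" and e: "0 < e" "e \<le> 1 / 4" and \<gamma>: "\<gamma> * (real k + 1) = e * R"
    and m: "20 * (real k + 1) \<le> real m * e"
    and s: "real ((k + m + 2) choose k) * ((real k + 1) * (12 / e)) \<le> real s"
  shows "\<exists>\<C>. coloured_cover V (gdist V) R (4 * e) (Suc s) \<C>"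
proof -
  have wV: "walk V u v (gdist V u v)" if "u \<in> V" "v \<in> V" for u v
    using walk_gdist[OF finite_V] conn that unfolding conn_def by blast
  define \<delta> where "\<delta> = e * R"
  have \<delta>: "0 < \<delta>" using R e unfolding \<delta>_def by simp
  define net_of where "net_of = (\<lambda>Y Z. Z \<subseteq> sk Y \<and> (\<forall>t\<in>sk Y. \<exists>z\<in>Z. \<exists>l\<le>\<delta>. walk (final_region Y) t z l) \<and>
    (\<forall>q l. 0 \<le> l \<longrightarrow> real (card {z\<in>Z. \<exists>l'\<le>l. walk Y q z l'}) \<le> (real k + 1) * (2 * l / \<delta> + 2)))"
  have "\<forall>Y\<in>N. \<exists>Z. net_of Y Z" using node_net[OF _ \<delta>] unfolding net_of_def by blast
  then obtain net where net': "\<forall>Y\<in>N. net_of Y (net Y)" by (rule bchoice[THEN exE])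
  have net: "Y \<in> N \<Longrightarrow> net Y \<subseteq> sk Y" 
    "Y \<in> N \<Longrightarrow> t \<in> sk Y \<Longrightarrow> \<exists>z\<in>net Y. \<exists>l\<le>\<delta>. walk (final_region Y) t z l"
    "Y \<in> N \<Longrightarrow> 0 \<le> l \<Longrightarrow> real (card {z\<in>net Y. \<exists>l'\<le>l. walk Y q z l'}) \<le> (real k + 1) * (2 * l / \<delta> + 2)" for Y t q l
    using net' unfolding net_of_def by blast+
  define S where "S = (\<Union>Y\<in>N. net Y)"
  have S_net: "z \<in> net (nd z) \<and> z \<in> sk (nd z) \<and> z \<in> V" if "z \<in> S" for z
    using that net(1) unfolding S_def skel_def by fastforce
  have finS: "finite S" using S_net finite_V by (meson finite_subset subsetI)
  \<comment> \<open>A vertex \<open>p\<close> of the ball of radius \<open>R\<close> around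
    \<open>x\<close> lies within \<open>2 * e * R\<close> of a net point: at most
    \<open>\<gamma> * k\<close> to the skeleton and \<open>\<delta>\<close> to the net. From there
    the ball is covered through \<open>p\<close> and \<open>x\<close> with radius
    \<open>\<rho>\<close>. Going back, \<open>R + 2 * e * R + \<rho>\<close> gives
    \<open>(3 + 4 * e) * R\<close>.\<close>
  define \<rho> where "\<rho> = (2 + 2 * e) * R"
  define C where "C = (\<lambda>z. {u. \<exists>l\<le>\<rho>. walk (final_region (nd z)) z u l})"
  have \<rho>: "0 \<le> \<rho>" "2 * \<rho> \<le> 5 * R" using R e unfolding \<rho>_def by (auto simp: field_simps)
  have CV: "C z \<subseteq> final_region (nd z)" for z unfolding C_def using walk_mem by blast
  have C_self: "z \<in> C z" if "z \<in> S" for z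
    using S_net[OF that] skel_final_region walk_nil[of z "final_region (nd z)"] \<rho>(1) unfolding C_def by blast
  have C_diam: "gdist V u v \<le> 5 * R" if uv: "u \<in> C z" "v \<in> C z" for u v z
  proof -
    obtain l1 l2 where l: "l1 \<le> \<rho>" "l2 \<le> \<rho>" "walk (final_region (nd z)) z u l1" "walk (final_region (nd z)) z v l2"
      using uv unfolding C_def by blast
    have "walk V u v (l1 + l2)"
      using walk_mono[OF walk_trans[OF l(4) walk_sym[OF l(3)]] final_region_sub(2)] .
    then show ?thesis using gdist_le[OF finite_V] l \<rho>(2) by fastforce
  qed
  define conf where "conf = (\<lambda>z z'. C z \<inter> C z' \<noteq> {})"
  \<comment> \<open>Nodes with a common vertex are comparable, and the one with at least as many
    vertices is the upper one; so only conflicts with clusters of the same node or above are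
    counted.\<close>
  define f where "f = (\<lambda>z. card (nd z))"
  have count: "card {z \<in> S. z \<noteq> z' \<and> conf z' z \<and> f z' \<le> f z} \<le> s" if z': "z' \<in> S" for z'
  proof -
    define Y0 where "Y0 = nd z'"
    have z'V: "z' \<in> V" "Y0 \<in> N" using S_net[OF z'] nd_node unfolding Y0_def by auto
    define \<X> where "\<X> = insert Y0 (reach (Suc (Suc m)) Y0)"
    have X_N: "X \<in> N" if "X \<in> \<X>" for X using that z'V reach_nodes unfolding \<X>_def by blast
    define A where "A = (\<lambda>X. {z\<in>net X. \<exists>l'\<le>2 * \<rho>. walk X z' z l'})"
    have sub: "{z \<in> S. z \<noteq> z' \<and> conf z' z \<and> f z' \<le> f z} \<subseteq> (\<Union>X\<in>\<X>. A X)"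
    proof
      fix z assume "z \<in> {z \<in> S. z \<noteq> z' \<and> conf z' z \<and> f z' \<le> f z}"
      then have z: "z \<in> S" "conf z' z" "f z' \<le> f z" by auto
      note zn = S_net[OF z(1)]
      obtain u where u: "u \<in> C z'" "u \<in> C z" using z(2) unfolding conf_def by blast
      have "u \<in> nd z'" "u \<in> nd z" using u CV final_region_sub by blast+
      then have "nd z' \<subseteq> nd z \<or> nd z \<subseteq> nd z'" using nd_comparable z'V zn by blast
      moreover have "\<not> nd z \<subset> nd z'"
      proof
        assume "nd z \<subset> nd z'"
        then have "card (nd z) < card (nd z')" 
          using psubset_card_mono in_nd[OF z'V(1)] finite_V finite_subset by metis
        then show False using z(3) unfolding f_def by simp
      qed
      ultimately have sup: "Y0 \<subseteq> nd z" unfolding Y0_def by blast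
      obtain l1 l2 where l: "l1 \<le> \<rho>" "l2 \<le> \<rho>" "walk (final_region Y0) z' u l1" "walk (final_region (nd z)) z u l2"
        using u unfolding C_def Y0_def by blast
      have w: "walk (final_region (nd z)) z' z (l1 + l2)"
        using walk_trans[OF walk_sym[OF l(4)] walk_mono[OF l(3) final_region_mono[OF sup]]] .
      \<comment> \<open>The centres are joined through \<open>u\<close> by a walk of length at most
        \<open>2 * \<rho> \<le> 5 * R\<close> below \<open>nd z\<close>. As
        \<open>walk_reach\<close> counts edges twice, \<open>10 * R\<close> would do;
        \<open>20 * R\<close> is available.\<close>
      have "nd z \<in> \<X>"
      proof (cases "nd z = Y0")
        case False
        have "2 * (l1 + l2) \<le> real m * \<gamma>"
        proof -
          have "20 * (real k + 1) * R \<le> real m * e * R" using m R by simp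
          also have "\<dots> = real m * \<gamma> * (real k + 1)" using \<gamma> by simp
          finally have "(20 * R) * (real k + 1) \<le> (real m * \<gamma>) * (real k + 1)" by (simp only: mult_ac)
          then have m20: "20 * R \<le> real m * \<gamma>" by (rule mult_right_le_imp_le) simp
          have "2 * (l1 + l2) \<le> 20 * R" using l(1,2) \<rho>(2) R by argo
          then show ?thesis using m20 by (rule order_trans)
        qed
        moreover have "z' \<in> Y0" using in_nd[OF z'V(1)] unfolding Y0_def by blast
        ultimately show ?thesis using walk_reach[OF z'V(2) _ w, of m] zn sup False unfolding \<X>_def by blast
      qed (simp add: \<X>_def)
      moreover have "l1 + l2 \<le> 2 * \<rho>" using add_mono[OF l(1,2)] by simp
      then have "z \<in> A (nd z)"
        using zn walk_mono[OF w final_region_sub(1)] unfolding A_def by blast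
      ultimately show "z \<in> (\<Union>X\<in>\<X>. A X)" by blast
    qed
    have finA: "finite (A X)" if "X \<in> \<X>" for X
      using finite_subset[OF _ finS, of "A X"] X_N[OF that] unfolding A_def S_def by blast
    have finX: "finite \<X>" unfolding \<X>_def using finite_reach by (simp del: reach.simps)
    have cardX: "card \<X> \<le> (k + m + 2) choose k"
    proof -
      have "card \<X> \<le> card (reach (Suc (Suc m)) Y0) + 1" unfolding \<X>_def using finite_reach[of "Suc (Suc m)" Y0]
        by (simp add: card_insert_if del: reach.simps)
      then show ?thesis using reach_card[OF z'V(2), of "Suc (Suc m)"] by (simp del: reach.simps)
    qed
    have cA: "real (card (A X)) \<le> (real k + 1) * (12 / e)" if "X \<in> \<X>" for X
    proof -
      have "real (card (A X)) \<le> (real k + 1) * (2 * (2 * \<rho>) / \<delta> + 2)"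
        using net(3)[OF X_N[OF that], of "2 * \<rho>" z'] \<rho> unfolding A_def by simp
      also have "\<dots> \<le> (real k + 1) * (12 / e)"
      proof (intro mult_left_mono)
        have "2 * (2 * \<rho>) / \<delta> \<le> 10 * R / \<delta>" using \<rho> \<delta> by (intro divide_right_mono) auto
        also have "\<dots> = 10 / e" using R unfolding \<delta>_def by simp
        finally show "2 * (2 * \<rho>) / \<delta> + 2 \<le> 12 / e" using e by (simp add: field_simps)
      qed simp
      finally show ?thesis .
    qed
    have "real (card {z \<in> S. z \<noteq> z' \<and> conf z' z \<and> f z' \<le> f z}) \<le> real (card (\<Union>X\<in>\<X>. A X))"
      using card_mono[OF _ sub] finX finA by simp
    also have "\<dots> \<le> real (card \<X>) * ((real k + 1) * (12 / e))" using card_UN_bound[OF finX cA] .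
    also have "\<dots> \<le> real ((k + m + 2) choose k) * ((real k + 1) * (12 / e))"
      using cardX e by (intro mult_right_mono) auto
    also have "\<dots> \<le> real s" by (rule s)
    finally show ?thesis by simp
  qed
  have "\<exists>col :: 'a \<Rightarrow> nat. (\<forall>x\<in>S. col x \<le> s) \<and> (\<forall>x\<in>S. \<forall>y\<in>S. x \<noteq> y \<longrightarrow> conf x y \<longrightarrow> col x \<noteq> col y)"
    by (rule greedy_colouring[OF finS _ count]) (auto simp: conf_def)
  then obtain col :: "'a \<Rightarrow> nat" where col: "\<And>x. x \<in> S \<Longrightarrow> col x \<le> s"
    "\<And>x y. x \<in> S \<Longrightarrow> y \<in> S \<Longrightarrow> x \<noteq> y \<Longrightarrow> conf x y \<Longrightarrow> col x \<noteq> col y" by blast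
  define \<C> where "\<C> = (\<lambda>c. C ` {z \<in> S. col z = c})"
  have "coloured_cover V (gdist V) R (4 * e) (Suc s) \<C>"
    unfolding coloured_cover_def
  proof (intro conjI allI impI ballI)
    fix c D assume "D \<in> \<C> c"
    then obtain z where z: "z \<in> S" "D = C z" "col z = c" unfolding \<C>_def by blast
    show "D \<subseteq> V" using CV final_region_sub z by blast
    show "gdist V u v \<le> 5 * R" if "u \<in> D" "v \<in> D" for u v using C_diam that z by blast
    fix D' assume "D' \<in> \<C> c" "D \<noteq> D'"
    then obtain z' where z': "z' \<in> S" "D' = C z'" "col z' = c" unfolding \<C>_def by blast
    then show "D \<inter> D' = {}" using col(2)[of z z'] z \<open>D \<noteq> D'\<close> unfolding conf_def by blast
  next
    fix x assume x: "x \<in> V"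
    define B where "B = {v \<in> V. gdist V x v \<le> R}"
    have wB: "walk B x v (gdist V x v)" if "v \<in> B" for v
    proof -
      have "v \<in> V" "gdist V x v \<le> R" using that unfolding B_def by auto
      then show ?thesis using walk_mono[OF walk_in_ball[OF wV[OF x]], of v B] unfolding B_def by force
    qed
    have xB: "x \<in> B" using gdist_le[OF finite_V walk_nil[OF x]] x R unfolding B_def by simp
    have "\<exists>l. walk B u v l" if "u \<in> B" "v \<in> B" for u v
      using walk_trans[OF wB[OF that(2)] walk_sym[OF wB[OF that(1)]]] by blast
    then have "conn B" unfolding conn_def using xB by blast
    then obtain p where p: "p \<in> B" "B \<subseteq> final_region (nd p)" using capture unfolding B_def by blast
    have pV: "p \<in> V" "gdist V x p \<le> R" using p unfolding B_def by auto
    obtain t l1 where t: "t \<in> sk (nd p)" "walk (final_region (nd p)) p t l1" "l1 \<le> \<gamma> * k" using to_skel[OF pV(1)] by blast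
    obtain z l2 where z: "z \<in> net (nd p)" "l2 \<le> \<delta>" "walk (final_region (nd p)) t z l2" using net(2)[OF nd_node[OF pV(1)] t(1)] by blast
    have zS: "z \<in> S" using z nd_node[OF pV(1)] unfolding S_def by blast
    have nz: "nd z = nd p" using net(1)[OF nd_node[OF pV(1)]] z(1) unfolding skel_def by blast
    have wpz: "walk (final_region (nd p)) p z (l1 + l2)" using walk_trans[OF z(3) t(2)] .
    have len: "l1 + l2 \<le> 2 * e * R"
      using t(3) z(2) \<gamma> gamma_pos unfolding \<delta>_def by (simp add: algebra_simps)
    have inC: "v \<in> C z" if "v \<in> V" "gdist V x v \<le> R" for v
    proof -
      have v: "v \<in> B" using that unfolding B_def by blast
      have "walk (final_region (nd p)) z v (l1 + l2 + (gdist V x p + gdist V x v))"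
        using walk_trans[OF walk_mono[OF walk_trans[OF wB[OF v] walk_sym[OF wB[OF p(1)]]] p(2)] walk_sym[OF wpz]] .
      moreover have "l1 + l2 + (gdist V x p + gdist V x v) \<le> \<rho>"
        using len pV that unfolding \<rho>_def by (simp add: algebra_simps)
      ultimately show ?thesis unfolding C_def nz by blast
    qed
    have outC: "gdist V x v \<le> (3 + 4 * e) * R" if v: "v \<in> C z" for v
    proof -
      obtain l3 where l3: "l3 \<le> \<rho>" "walk (final_region (nd p)) z v l3" using v unfolding C_def nz by blast
      have "walk V x v (gdist V x p + (l1 + l2 + l3))"
        using walk_trans[OF walk_mono[OF walk_trans[OF l3(2) wpz] final_region_sub(2)] wV[OF x pV(1)]] .
      then have "gdist V x v \<le> gdist V x p + (l1 + l2 + l3)" by (rule gdist_le[OF finite_V])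
      then show ?thesis using l3 len pV unfolding \<rho>_def by (simp add: algebra_simps)
    qed
    show "\<exists>c<Suc s. \<exists>D\<in>\<C> c. (\<forall>v\<in>V. gdist V x v \<le> R \<longrightarrow> v \<in> D) \<and> (\<forall>v\<in>D. gdist V x v \<le> (3 + 4 * e) * R)"
      using inC outC zS col(1)[OF zS] unfolding \<C>_def
      by (intro exI[of _ "col z"] conjI bexI[of _ "C z"]) auto
  qed
  then show ?thesis by blast
qed

end

lemma (in wgraph) minor_free_cover:
  assumes conn: "conn V" and nm: "\<not> complete_minor (k + 2)"
    and R: "0 < R" and e: "0 < e" "e \<le> 1 / 4" and m: "20 * (real k + 1) \<le> real m * e"
    and s: "real ((k + m + 2) choose k) * ((real k + 1) * (12 / e)) \<le> real s"
  shows "\<exists>\<C>. coloured_cover V (gdist V) R (4 * e) (Suc s) \<C>"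
proof -
  define \<gamma> where "\<gamma> = e * R / (real k + 1)"
  have \<gamma>: "0 < \<gamma>" "\<gamma> * (real k + 1) = e * R" using R e unfolding \<gamma>_def by simp_all
  obtain nd tm where st: "cop_state V adj W nd tm \<gamma> k" "free tm = {}"
    using cop_decomposition[OF \<gamma>(1) nm] by blast
  interpret cop_final V adj W nd tm \<gamma> k
    using st by (simp add: cop_final_def cop_final_axioms_def)
  show ?thesis by (rule clusters[OF conn R e \<gamma>(2) m s])
qed

section \<open>Embedding a metric with coloured covers\<close>

lemma pow2_le_iff: "0 < n \<Longrightarrow> 2 ^ a \<le> n \<longleftrightarrow> a \<le> floor_log n"
proof
  assume "0 < n" "2 ^ a \<le> n"
  then show "a \<le> floor_log n" using floor_log_le_iff[of "2 ^ a" n] by simp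
next
  assume n: "0 < n" "a \<le> floor_log n"
  then have "(2::nat) ^ a \<le> 2 ^ floor_log n" by simp
  then show "2 ^ a \<le> n" using floor_log_exp2_le[OF n(1)] by (rule order_trans)
qed

text \<open>Divided by \<open>8 ^ T\<close> the sum is at most 2/4 + 2/16 + 2/64 + ..., hence less
  than 2/3. The value 0 must be excluded, since its bound alone would contribute 2. With base 4 the
  series would be 1 + 1/2 + 1/4 + ..., which exceeds 1.\<close>

lemma sum_pow8:
  assumes "finite B" "\<And>x. x \<in> B \<Longrightarrow> 1 \<le> \<tau> x \<and> \<tau> x \<le> T"
    and "\<And>t. card {x \<in> B. \<tau> x \<le> t} \<le> 2 ^ (t + 1)"
  shows "(\<Sum>x\<in>B. 8 ^ (T - \<tau> x)) < (8::nat) ^ T"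
proof -
  have "(\<Sum>x\<in>B. 8 ^ (T - \<tau> x)) = (\<Sum>t\<in>{1..T}. \<Sum>x\<in>{x \<in> B. \<tau> x = t}. (8::nat) ^ (T - \<tau> x))"
    using assms(1,2) by (intro sum.group[symmetric]) auto
  also have "\<dots> \<le> (\<Sum>t\<in>{1..T}. 2 ^ (t + 1) * 8 ^ (T - t))"
  proof (intro sum_mono)
    fix t
    have "card {x \<in> B. \<tau> x = t} \<le> card {x \<in> B. \<tau> x \<le> t}" using assms(1) by (intro card_mono) auto
    then have "card {x \<in> B. \<tau> x = t} \<le> 2 ^ (t + 1)" using assms(3)[of t] by simp
    then show "(\<Sum>x\<in>{x \<in> B. \<tau> x = t}. (8::nat) ^ (T - \<tau> x)) \<le> 2 ^ (t + 1) * 8 ^ (T - t)" by simp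
  qed
  also have "\<dots> < 8 ^ T"
  proof -
    have "3 * (\<Sum>t\<in>{1..T}. 2 ^ (t + 1) * 8 ^ (T - t)) + 2 * 2 ^ T = 2 * (8::nat) ^ T"
    proof (induction T)
      case (Suc T)
      have "(\<Sum>t\<in>{1..Suc T}. 2 ^ (t + 1) * 8 ^ (Suc T - t)) =
        8 * (\<Sum>t\<in>{1..T}. 2 ^ (t + 1) * (8::nat) ^ (T - t)) + 2 ^ (T + 2)"
        by (simp add: sum_distrib_left Suc_diff_le mult_ac)
      then show ?case using Suc by simp
    qed simp
    moreover have "0 < (2::nat) ^ T" "0 < (8::nat) ^ T" by simp_all
    ultimately show ?thesis by linarith
  qed
  finally show ?thesis .
qed

text \<open>Codes are chosen greedily in the order of increasing \<open>\<tau>\<close>; then an earlier neighbour \<open>y\<close> forbids only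
  a fraction \<open>8 ^ - \<tau> y\<close> of all codes.\<close>

lemma prefix_codes:
  fixes \<tau> :: "'b \<Rightarrow> nat"
  assumes "finite S" and sym: "\<And>x y. near x y \<Longrightarrow> near y x"
    and "\<And>x y. \<lbrakk>x \<in> S; y \<in> S; x \<noteq> y; near x y\<rbrakk> \<Longrightarrow> 1 \<le> \<tau> x"
    and "\<And>x t. x \<in> S \<Longrightarrow> card {y \<in> S. y \<noteq> x \<and> near x y \<and> \<tau> y \<le> t} \<le> 2 ^ (t + 1)"
  shows "\<exists>code :: 'b \<Rightarrow> nat. \<forall>x\<in>S. \<forall>y\<in>S. x \<noteq> y \<longrightarrow> near x y \<longrightarrow>
    code x mod 8 ^ min (\<tau> x) (\<tau> y) \<noteq> code y mod 8 ^ min (\<tau> x) (\<tau> y)"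
  using assms(1,3,4)
proof (induction "card S" arbitrary: S)
  case 0
  then show ?case by auto
next
  case (Suc m)
  then have "S \<noteq> {}" "finite S" by auto
  then obtain x where x: "x \<in> S" "\<And>y. y \<in> S \<Longrightarrow> \<tau> y \<le> \<tau> x"
    using Max_in[of "\<tau> ` S"] Max_ge[of "\<tau> ` S"] by fastforce
  have "card {y \<in> S - {x}. y \<noteq> z \<and> near z y \<and> \<tau> y \<le> t} \<le> 2 ^ (t + 1)" if "z \<in> S - {x}" for z t
  proof -
    have "card {y \<in> S - {x}. y \<noteq> z \<and> near z y \<and> \<tau> y \<le> t} \<le> card {y \<in> S. y \<noteq> z \<and> near z y \<and> \<tau> y \<le> t}"
      using \<open>finite S\<close> by (intro card_mono) auto
    also have "\<dots> \<le> 2 ^ (t + 1)" using Suc.prems(3)[of z t] that by simp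
    finally show ?thesis .
  qed
  moreover have "m = card (S - {x})" using Suc.hyps(2) Suc.prems(1) x(1) by simp
  moreover have "1 \<le> \<tau> u" if "u \<in> S - {x}" "v \<in> S - {x}" "u \<noteq> v" "near u v" for u v
    using Suc.prems(2)[of u v] that by blast
  ultimately obtain code :: "'b \<Rightarrow> nat" where code: "\<And>y z. y \<in> S - {x} \<Longrightarrow> z \<in> S - {x} \<Longrightarrow> y \<noteq> z \<Longrightarrow> near y z \<Longrightarrow>
      code y mod 8 ^ min (\<tau> y) (\<tau> z) \<noteq> code z mod 8 ^ min (\<tau> y) (\<tau> z)"
    using Suc.hyps(1)[of "S - {x}"] Suc.prems(1) by blast
  define B where "B = {y \<in> S. y \<noteq> x \<and> near x y}"
  define T where "T = \<tau> x"
  have finB: "finite B" using \<open>finite S\<close> unfolding B_def by simp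
  have bT: "1 \<le> \<tau> y \<and> \<tau> y \<le> T" if "y \<in> B" for y
    using that x(2) Suc.prems(2)[of y x] sym x(1) unfolding B_def T_def by blast
  have "card {y \<in> B. \<tau> y \<le> t} \<le> 2 ^ (t + 1)" for t
    using Suc.prems(3)[OF x(1), of t] unfolding B_def by (simp add: conj_assoc)
  from sum_pow8[OF finB bT this] have sum: "(\<Sum>y\<in>B. 8 ^ (T - \<tau> y)) < (8::nat) ^ T" by blast
  \<comment> \<open>The code of \<open>x\<close> is sought below \<open>8 ^ T\<close>; prescribing
    its residue modulo \<open>8 ^ \<tau> y\<close> leaves at most \<open>8 ^ (T - \<tau> y)\<close>
    candidates.\<close>
  define forb where "forb = (\<lambda>y. {c \<in> {..<8 ^ T}. c mod 8 ^ \<tau> y = code y mod 8 ^ \<tau> y})"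
  have cf: "card (forb y) \<le> 8 ^ (T - \<tau> y)" if "y \<in> B" for y
  proof -
    have "inj_on (\<lambda>c. c div 8 ^ \<tau> y) (forb y)"
    proof (rule inj_onI)
      fix c c' assume "c \<in> forb y" "c' \<in> forb y" and e: "c div 8 ^ \<tau> y = c' div 8 ^ \<tau> y"
      then have "c mod 8 ^ \<tau> y = c' mod 8 ^ \<tau> y" unfolding forb_def by simp
      then show "c = c'" using e by (metis div_mult_mod_eq)
    qed
    moreover have "(\<lambda>c. c div 8 ^ \<tau> y) ` forb y \<subseteq> {..<8 ^ (T - \<tau> y)}"
    proof (intro image_subsetI)
      fix c assume "c \<in> forb y"
      then have "c < 8 ^ (T - \<tau> y) * 8 ^ \<tau> y" using bT[OF that] unfolding forb_def by (simp flip: power_add)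
      then show "c div 8 ^ \<tau> y \<in> {..<8 ^ (T - \<tau> y)}" by (simp add: less_mult_imp_div_less)
    qed
    ultimately have "card (forb y) \<le> card {..<(8::nat) ^ (T - \<tau> y)}" by (intro card_inj_on_le) auto
    then show ?thesis by simp
  qed
  have "card (\<Union>y\<in>B. forb y) \<le> (\<Sum>y\<in>B. card (forb y))" using card_UN_le[OF finB] .
  also have "\<dots> \<le> (\<Sum>y\<in>B. 8 ^ (T - \<tau> y))" using cf by (intro sum_mono)
  also have "\<dots> < 8 ^ T" by (rule sum)
  finally have "card (\<Union>y\<in>B. forb y) < card {..<(8::nat) ^ T}" by simp
  moreover have "finite (\<Union>y\<in>B. forb y)" using finB unfolding forb_def by simp
  ultimately have "\<not> {..<(8::nat) ^ T} \<subseteq> (\<Union>y\<in>B. forb y)" using card_mono by (metis not_le)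
  then obtain c where c: "c < 8 ^ T" "\<And>y. y \<in> B \<Longrightarrow> c \<notin> forb y" by auto
  have cy: "c mod 8 ^ \<tau> y \<noteq> code y mod 8 ^ \<tau> y" if "y \<in> B" for y
    using c(1) c(2)[OF that] unfolding forb_def by blast
  define code' where "code' = code(x := c)"
  have "code' y mod 8 ^ min (\<tau> y) (\<tau> z) \<noteq> code' z mod 8 ^ min (\<tau> y) (\<tau> z)"
    if a: "y \<in> S" "z \<in> S" "y \<noteq> z" "near y z" for y z
  proof -
    consider "y = x" | "z = x" | "y \<noteq> x" "z \<noteq> x" by blast
    then show ?thesis
    proof cases
      case 1
      then have "z \<in> B" using a unfolding B_def by blast
      then show ?thesis using cy[of z] bT[of z] 1 a(3) unfolding code'_def T_def by (simp add: min_absorb2)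
    next
      case 2
      then have "y \<in> B" using a sym unfolding B_def by blast
      then show ?thesis using cy[of y] bT[of y] 2 a(3) unfolding code'_def T_def by (simp add: min_absorb1)
    next
      case 3
      then show ?thesis using code[of y z] a unfolding code'_def by simp
    qed
  qed
  then show ?case by blast
qed

lemma code_bit:
  assumes "c mod 8 ^ t \<noteq> c' mod (8::nat) ^ t"
  shows "\<exists>i<t. \<exists>b<3. bit c (3 * i + b) \<noteq> bit c' (3 * i + b)"
proof -
  have "take_bit (3 * t) c \<noteq> take_bit (3 * t) c'"
    using assms by (simp add: take_bit_eq_mod power_mult)
  then obtain j where j: "j < 3 * t" "bit c j \<noteq> bit c' j"
    by (auto simp: bit_eq_iff bit_take_bit_iff)
  have "j = 3 * (j div 3) + j mod 3" by simp
  moreover have "j div 3 < t" using j(1) by auto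
  moreover have "j mod 3 < 3" by simp
  ultimately show ?thesis using j(2) by metis
qed

section \<open>Finite metrics, sizes of balls and 1-Lipschitz functions\<close>

locale fmetric =
  fixes V :: "'a set" and d :: "'a \<Rightarrow> 'a \<Rightarrow> real"
  assumes finV: "finite V" and neV: "V \<noteq> {}"
    and d_self: "x \<in> V \<Longrightarrow> d x x = 0"
    and d_nonneg: "x \<in> V \<Longrightarrow> y \<in> V \<Longrightarrow> 0 \<le> d x y"
    and d_sym: "x \<in> V \<Longrightarrow> y \<in> V \<Longrightarrow> d x y = d y x"
    and d_tri: "x \<in> V \<Longrightarrow> y \<in> V \<Longrightarrow> z \<in> V \<Longrightarrow> d x z \<le> d x y + d y z"
begin

definition lip :: "('a \<Rightarrow> real) \<Rightarrow> bool" where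
  "lip f \<longleftrightarrow> (\<forall>u\<in>V. \<forall>v\<in>V. f u \<le> f v + d u v)"

definition ball_card :: "'a \<Rightarrow> real \<Rightarrow> nat" where
  "ball_card x t = card {v \<in> V. d x v \<le> t}"

definition rho :: "nat \<Rightarrow> 'a \<Rightarrow> real" where
  "rho m x = Min {t \<in> d x ` V. m \<le> ball_card x t}"

text \<open>The cap \<open>R\<close> provides a value also if \<open>C\<close> exhausts
  \<open>V\<close>, and keeps small scales from disturbing larger ones.\<close>

definition phi :: "real \<Rightarrow> 'a set \<Rightarrow> 'a \<Rightarrow> real" where
  "phi R C u = Min (insert R (d u ` (V - C)))"

definition clamp :: "real \<Rightarrow> real \<Rightarrow> real \<Rightarrow> real" where
  "clamp \<kappa> R t = max 0 (min R (t - \<kappa> * R))"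

lemma bc_mono: "t \<le> t' \<Longrightarrow> ball_card x t \<le> ball_card x t'"
  unfolding ball_card_def using finV by (intro card_mono) auto

lemma bc_pos: "x \<in> V \<Longrightarrow> 0 \<le> t \<Longrightarrow> 0 < ball_card x t"
  unfolding ball_card_def using finV d_self by (auto simp: card_gt_0_iff)

text \<open>\<open>rho\<close> and \<open>ball_card\<close> form a Galois connection, through which
  the later estimates of \<open>rho\<close> are obtained.\<close>

lemma rho_le_iff:
  assumes "x \<in> V" "1 \<le> m" "m \<le> card V"
  shows "rho m x \<le> t \<longleftrightarrow> m \<le> ball_card x t"
proof -
  define S where "S = {t \<in> d x ` V. m \<le> ball_card x t}"
  have fin: "finite S" using finV unfolding S_def by simp
  have *: "\<exists>t'\<in>S. t' \<le> t" if mt: "m \<le> ball_card x t" for t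
  proof -
    define B where "B = {v \<in> V. d x v \<le> t}"
    have "card B \<noteq> 0" using mt assms(2) unfolding B_def ball_card_def by linarith
    then have "0 < card B" by simp
    then have "finite B" "B \<noteq> {}" by (auto simp: card_gt_0_iff)
    then have M: "Max (d x ` B) \<in> d x ` B" "\<And>v. v \<in> B \<Longrightarrow> d x v \<le> Max (d x ` B)" by auto
    have "B \<subseteq> {v \<in> V. d x v \<le> Max (d x ` B)}" using M(2) unfolding B_def by blast
    then have "m \<le> ball_card x (Max (d x ` B))"
      using mt card_mono[of "{v \<in> V. d x v \<le> Max (d x ` B)}" B] finV unfolding ball_card_def B_def by simp
    then have "Max (d x ` B) \<in> S" using M(1) unfolding S_def B_def by blast
    moreover have "Max (d x ` B) \<le> t" using M(1) unfolding B_def by auto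
    ultimately show ?thesis by blast
  qed
  have "ball_card x (Max (d x ` V)) = card V" unfolding ball_card_def
    using finV by (intro arg_cong[of _ _ card]) auto
  then have "S \<noteq> {}" using *[of "Max (d x ` V)"] assms(3) by auto
  show ?thesis
  proof
    assume "rho m x \<le> t"
    then obtain t' where "t' \<in> S" "t' \<le> t" using Min_in[OF fin \<open>S \<noteq> {}\<close>] unfolding rho_def S_def by blast
    then show "m \<le> ball_card x t" using bc_mono[of t' t x] unfolding S_def by simp
  next
    assume "m \<le> ball_card x t"
    then obtain t' where "t' \<in> S" "t' \<le> t" using * by blast
    then show "rho m x \<le> t" using Min_le[OF fin] unfolding rho_def S_def by fastforce
  qed
qed

lemma lip_rho:
  assumes "1 \<le> m" "m \<le> card V"
  shows "lip (rho m)"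
  unfolding lip_def
proof (intro ballI)
  fix u v assume uv: "u \<in> V" "v \<in> V"
  have "m \<le> ball_card v (rho m v)" using rho_le_iff[OF uv(2) assms, of "rho m v"] by simp
  also have "\<dots> \<le> ball_card u (rho m v + d u v)"
    unfolding ball_card_def using finV d_tri[OF uv] by (intro card_mono) (auto, fastforce)
  finally show "rho m u \<le> rho m v + d u v" using rho_le_iff[OF uv(1) assms] by blast
qed

lemma finite_phi: "finite (insert R (d u ` (V - C)))"
  using finV by simp

lemma lip_phi: "lip (phi R C)"
  unfolding lip_def
proof (intro ballI)
  fix u v assume uv: "u \<in> V" "v \<in> V"
  have "phi R C v \<in> insert R (d v ` (V - C))" unfolding phi_def by (rule Min_in[OF finite_phi]) simp
  then show "phi R C u \<le> phi R C v + d u v"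
  proof
    assume "phi R C v = R"
    moreover have "phi R C u \<le> R" unfolding phi_def by (rule Min_le[OF finite_phi]) simp
    ultimately show ?thesis using d_nonneg[OF uv] by simp
  next
    assume "phi R C v \<in> d v ` (V - C)"
    then obtain w where w: "w \<in> V - C" "phi R C v = d v w" by blast
    have "phi R C u \<le> d u w" unfolding phi_def using w by (intro Min_le[OF finite_phi]) simp
    then show ?thesis using d_tri[of u v w] uv w by simp
  qed
qed

lemma phi_zero: 
  assumes "u \<in> V" "u \<notin> C"
  shows "phi R C u \<le> 0"
proof -
  have "0 \<in> insert R (d u ` (V - C))" using assms d_self[of u] by force
  then show ?thesis unfolding phi_def using Min_le[OF finite_phi] by blast
qed

lemma phi_full: 
  assumes "\<forall>v\<in>V. d u v \<le> R \<longrightarrow> v \<in> C"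
  shows "phi R C u = R"
  unfolding phi_def
proof (rule Min_eqI[OF finite_phi])
  fix t assume "t \<in> insert R (d u ` (V - C))"
  then show "R \<le> t" using assms by force
qed simp

lemma lip_clamp: 
  assumes "lip f" shows "lip (\<lambda>u. clamp \<kappa> R (f u))"
  unfolding lip_def
proof (intro ballI)
  fix u v assume uv: "u \<in> V" "v \<in> V"
  then have "f u \<le> f v + d u v" "0 \<le> d u v" using assms d_nonneg unfolding lip_def by auto
  then show "clamp \<kappa> R (f u) \<le> clamp \<kappa> R (f v) + d u v" unfolding clamp_def by (simp add: max_def min_def)
qed

lemma lip_min: 
  assumes "lip f" "lip g" shows "lip (\<lambda>u. min (f u) (g u))"
  unfolding lip_def
proof (intro ballI)
  fix u v assume uv: "u \<in> V" "v \<in> V"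
  then have "f u \<le> f v + d u v" "g u \<le> g v + d u v" using assms unfolding lip_def by auto
  then show "min (f u) (g u) \<le> min (f v) (g v) + d u v" by (simp add: min_def)
qed

lemma lip_Max:
  assumes "finite S" "\<And>s. s \<in> S \<Longrightarrow> lip (g s)"
  shows "lip (\<lambda>u. Max (insert 0 ((\<lambda>s. g s u) ` S)))"
  unfolding lip_def
proof (intro ballI)
  fix u v assume uv: "u \<in> V" "v \<in> V"
  have "t \<le> Max (insert 0 ((\<lambda>s. g s v) ` S)) + d u v" if t: "t \<in> insert 0 ((\<lambda>s. g s u) ` S)" for t
  proof (cases "t = 0")
    case True
    have "0 \<le> Max (insert 0 ((\<lambda>s. g s v) ` S))" using assms(1) by simp
    then show ?thesis using True d_nonneg[OF uv] by simp
  next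
    case False
    then obtain s where s: "s \<in> S" "t = g s u" using t by blast
    then have "t \<le> g s v + d u v" using assms(2) uv unfolding lip_def by blast
    moreover have "g s v \<le> Max (insert 0 ((\<lambda>s. g s v) ` S))" using assms(1) s by simp
    ultimately show ?thesis by linarith
  qed
  then show "Max (insert 0 ((\<lambda>s. g s u) ` S)) \<le> Max (insert 0 ((\<lambda>s. g s v) ` S)) + d u v"
    using assms(1) by (intro Max.boundedI) auto
qed

text \<open>Otherwise the ball of radius \<open>24 * R\<close> around \<open>x\<close> would contain two disjoint balls with at least
  \<open>2 ^ floor_log (ball_card x R)\<close> points each.\<close>

lemma heavy_pair:
  assumes xy: "x \<in> V" "y \<in> V" and R: "0 < R" "d x y \<le> 4 * R"
    and heavy: "ball_card x (24 * R) < 2 ^ Suc (floor_log (ball_card x R))"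
  shows "rho (2 ^ floor_log (ball_card x R)) x + (d x y - 2 * R) \<le> rho (2 ^ floor_log (ball_card x R)) y"
proof -
  define M where "M = (2::nat) ^ floor_log (ball_card x R)"
  have bp: "0 < ball_card x R" using bc_pos xy R by simp
  have M: "1 \<le> M" "M \<le> ball_card x R" unfolding M_def using floor_log_exp2_le[OF bp] by simp_all
  have "ball_card x R \<le> card V" unfolding ball_card_def using finV by (intro card_mono) auto
  then have MV: "M \<le> card V" using M(2) by simp
  have rx: "rho M x \<le> R" using rho_le_iff[OF xy(1) M(1) MV] M(2) by blast
  have ry: "d x y - R \<le> rho M y"
  proof (rule ccontr)
    assume "\<not> ?thesis"
    then have r: "rho M y < d x y - R" by simp
    define A where "A = {v \<in> V. d x v \<le> R}"
    define B where "B = {v \<in> V. d y v \<le> rho M y}"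
    have dis: "A \<inter> B = {}"
    proof (rule ccontr)
      assume "A \<inter> B \<noteq> {}"
      then obtain v where "v \<in> V" "d x v \<le> R" "d y v \<le> rho M y" unfolding A_def B_def by blast
      then show False using d_tri[OF xy(1) _ xy(2), of v] d_sym[OF xy(2), of v] r by auto
    qed
    have "M \<le> card B" using rho_le_iff[OF xy(2) M(1) MV, of "rho M y"] unfolding B_def ball_card_def by simp
    moreover have "M \<le> card A" using M(2) unfolding A_def ball_card_def .
    moreover have "card (A \<union> B) = card A + card B" 
      using dis finV unfolding A_def B_def by (intro card_Un_disjoint) auto
    moreover have "card (A \<union> B) \<le> ball_card x (24 * R)"
    proof -
      have "d x v \<le> 24 * R" if "v \<in> B" for v
        using that d_tri[OF xy, of v] r R unfolding B_def by auto
      then have "A \<union> B \<subseteq> {v \<in> V. d x v \<le> 24 * R}" using R unfolding A_def B_def by auto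
      then show ?thesis unfolding ball_card_def using finV by (intro card_mono) auto
    qed
    ultimately show False using heavy unfolding M_def by simp
  qed
  then show ?thesis using rx unfolding M_def by simp
qed

end

section \<open>Telling apart the clusters of one scale and colour\<close>

context fmetric
begin

abbreviation "lgc \<equiv> \<lambda>C :: 'a set. floor_log (card C)"

text \<open>A cluster spends one octal digit on each doubling between its own size and that of the
  ball of radius \<open>24 * R\<close>. This is enough: the near clusters of the same size class
  with \<open>\<tau> C' \<le> t\<close> are disjoint, have at least \<open>2 ^ lgc C\<close> points
  each, and fit into a ball with fewer than \<open>2 ^ (lgc C + t + 1)\<close> points.\<close>

lemma cluster_codes:
  assumes R: "0 < R" and D: "\<And>C. C \<in> \<D> \<Longrightarrow> C \<subseteq> V"
    and diam: "\<And>C u v. C \<in> \<D> \<Longrightarrow> u \<in> C \<Longrightarrow> v \<in> C \<Longrightarrow> d u v \<le> 5 * R"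
    and disj: "\<And>C C'. C \<in> \<D> \<Longrightarrow> C' \<in> \<D> \<Longrightarrow> C \<noteq> C' \<Longrightarrow> C \<inter> C' = {}"
  shows "\<exists>code :: 'a set \<Rightarrow> nat. \<forall>C\<in>\<D>. \<forall>C'\<in>\<D>. \<forall>x\<in>C. \<forall>y\<in>C'. C \<noteq> C' \<longrightarrow> lgc C = lgc C' \<longrightarrow> d x y \<le> 4 * R \<longrightarrow>
    (\<exists>i. \<exists>b<3. 2 ^ (lgc C + i + 1) \<le> ball_card x (24 * R) \<and> bit (code C) (3 * i + b) \<noteq> bit (code C') (3 * i + b))"
proof -
  define S where "S = \<D> - {{}}"
  have SD: "C \<in> \<D>" "C \<subseteq> V" "C \<noteq> {}" "finite C" "0 < card C" if "C \<in> S" for C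
    using that D finite_subset[OF _ finV] unfolding S_def by (auto simp: card_gt_0_iff)
  have finS: "finite S" using D finite_subset[of S "Pow V"] finV unfolding S_def by auto
  define near where "near = (\<lambda>C C'. lgc C = lgc C' \<and> (\<exists>x\<in>C. \<exists>y\<in>C'. x \<in> V \<and> y \<in> V \<and> d x y \<le> 4 * R))"
  \<comment> \<open>The minimum makes every digit of the code of \<open>C\<close> available at all
    points of \<open>C\<close>.\<close>
  define Ns where "Ns = (\<lambda>C. Min ((\<lambda>x. ball_card x (24 * R)) ` C))"
  define \<tau> where "\<tau> = (\<lambda>C. floor_log (Ns C) - lgc C)"
  have Ns_le: "Ns C \<le> ball_card x (24 * R)" if "C \<in> S" "x \<in> C" for C x
    unfolding Ns_def using SD[OF that(1)] that(2) by (intro Min_le) auto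
  have Ns_in: "\<exists>x\<in>C. Ns C = ball_card x (24 * R)" if "C \<in> S" for C
  proof -
    have "Ns C \<in> (\<lambda>x. ball_card x (24 * R)) ` C" 
      unfolding Ns_def using SD(3,4)[OF that] by (intro Min_in) auto
    then show ?thesis by blast
  qed
  have Ns_pos: "0 < Ns C" if "C \<in> S" for C
  proof -
    obtain x where "x \<in> C" "Ns C = ball_card x (24 * R)" using Ns_in[OF \<open>C \<in> S\<close>] by blast
    then show ?thesis using bc_pos[of x "24 * R"] SD(2)[OF \<open>C \<in> S\<close>] R by auto
  qed
  have lg_le: "2 ^ lgc C \<le> card C" if "C \<in> S" for C
    using floor_log_exp2_le SD(5)[OF that] by blast
  \<comment> \<open>Three clusters of diameter at most \<open>5 * R\<close> and two gaps of at most
    \<open>4 * R\<close> span \<open>23 * R\<close>; this is the most demanding use of the radius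
    \<open>24 * R\<close>.\<close>
  have sub_ball: "C' \<subseteq> {v \<in> V. d x v \<le> 24 * R}" if h: "C \<in> S" "C' \<in> S" "C'' \<in> S" "near C C'" "near C C''" "x \<in> C''" for C C' C'' x
  proof
    fix v assume v: "v \<in> C'"
    obtain a b where a: "a \<in> C" "b \<in> C'" "d a b \<le> 4 * R" using h(4) unfolding near_def by blast
    obtain a' b' where a': "a' \<in> C" "b' \<in> C''" "d a' b' \<le> 4 * R" using h(5) unfolding near_def by blast
    have inV: "v \<in> V" "a \<in> V" "b \<in> V" "a' \<in> V" "b' \<in> V" "x \<in> V" using SD(2) h v a a' by blast+
    have 1: "d x b' \<le> 5 * R" "d a' a \<le> 5 * R" "d b v \<le> 5 * R" using diam SD(1) h a a' v by blast+
    have 2: "d b' a' \<le> 4 * R" using a'(3) d_sym inV by simp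
    have "d x v \<le> d x b' + d b' v" "d b' v \<le> d b' a' + d a' v" "d a' v \<le> d a' a + d a v" "d a v \<le> d a b + d b v"
      using d_tri inV by blast+
    then have "d x v \<le> 23 * R" using 1 2 a(3) by argo
    then show "v \<in> {v \<in> V. d x v \<le> 24 * R}" using inV R by simp
  qed
  have near_sym: "near C' C" if "near C C'" for C C'
    using that d_sym unfolding near_def by metis
  have self_near: "near C C" if CS: "C \<in> S" for C
  proof -
    obtain x where "x \<in> C" "x \<in> V" using SD(2,3)[OF CS] by blast
    then show ?thesis using d_self[of x] R unfolding near_def by (intro conjI bexI[of _ x]) auto
  qed
  have one: "1 \<le> \<tau> C" if C: "C \<in> S" "C' \<in> S" "C \<noteq> C'" "near C C'" for C C'
  proof -
    obtain x where x: "x \<in> C" "Ns C = ball_card x (24 * R)" using Ns_in[OF C(1)] by blast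
    have "C \<union> C' \<subseteq> {v \<in> V. d x v \<le> 24 * R}"
      using sub_ball[OF C(1) C(2) C(1) C(4) self_near[OF C(1)] x(1)]
        sub_ball[OF C(1) C(1) C(1) self_near[OF C(1)] self_near[OF C(1)] x(1)] by blast
    then have "card (C \<union> C') \<le> Ns C" unfolding x(2) ball_card_def using finV by (intro card_mono) auto
    moreover have "card (C \<union> C') = card C + card C'"
      using disj SD C by (intro card_Un_disjoint) auto
    ultimately have "2 ^ lgc C + 2 ^ lgc C' \<le> Ns C" using lg_le[OF C(1)] lg_le[OF C(2)] by linarith
    then have "2 ^ (lgc C + 1) \<le> Ns C" using C(4) unfolding near_def by simp
    then have "lgc C + 1 \<le> floor_log (Ns C)" using pow2_le_iff[OF Ns_pos[OF C(1)]] by blast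
    then show ?thesis unfolding \<tau>_def by simp
  qed
  have cnt: "card {C' \<in> S. C' \<noteq> C \<and> near C C' \<and> \<tau> C' \<le> t} \<le> 2 ^ (t + 1)" if C: "C \<in> S" for C t
  proof -
    define Q where "Q = {C' \<in> S. C' \<noteq> C \<and> near C C' \<and> \<tau> C' \<le> t}"
    have QS: "C' \<in> S" "near C C'" "lgc C' = lgc C" "\<tau> C' \<le> t" if "C' \<in> Q" for C'
      using that unfolding Q_def near_def by auto
    have "card Q \<le> 2 ^ (t + 1)"
    proof (cases "Q = {}")
      case False
      then obtain C1 where C1: "C1 \<in> Q" by blast
      obtain x where x: "x \<in> C1" "Ns C1 = ball_card x (24 * R)" using Ns_in[OF QS(1)[OF C1]] by blast
      have "card Q * 2 ^ lgc C \<le> (\<Sum>C'\<in>Q. card C')"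
        using sum_bounded_below[of Q "2 ^ lgc C" card] lg_le QS(1,3) by fastforce
      also have "\<dots> = card (\<Union>Q)"
        using SD(4) QS(1) disj SD(1) by (intro card_Union_disjoint[symmetric]) (auto simp: pairwise_def disjnt_def)
      also have "\<dots> \<le> ball_card x (24 * R)"
        unfolding ball_card_def using finV sub_ball[OF C QS(1) QS(1)[OF C1] QS(2) QS(2)[OF C1] x(1)]
        by (intro card_mono) auto
      also have "\<dots> < 2 ^ (lgc C + (t + 1))"
      proof -
        have "\<not> lgc C + (t + 1) \<le> floor_log (Ns C1)" using QS(3,4)[OF C1] unfolding \<tau>_def by simp
        then show ?thesis using pow2_le_iff[OF Ns_pos[OF QS(1)[OF C1]]] x(2) by (metis not_le)
      qed
      finally have "card Q * 2 ^ lgc C < 2 ^ (t + 1) * 2 ^ lgc C" by (simp add: power_add mult_ac)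
      then show ?thesis by simp
    qed simp
    then show ?thesis unfolding Q_def .
  qed
  have "\<exists>code :: 'a set \<Rightarrow> nat. \<forall>x\<in>S. \<forall>y\<in>S. x \<noteq> y \<longrightarrow> near x y \<longrightarrow>
    code x mod 8 ^ min (\<tau> x) (\<tau> y) \<noteq> code y mod 8 ^ min (\<tau> x) (\<tau> y)"
    by (rule prefix_codes[OF finS]) (fact near_sym one cnt)+
  then obtain code :: "'a set \<Rightarrow> nat" where code: "\<And>C C'. C \<in> S \<Longrightarrow> C' \<in> S \<Longrightarrow> C \<noteq> C' \<Longrightarrow> near C C' \<Longrightarrow>
    code C mod 8 ^ min (\<tau> C) (\<tau> C') \<noteq> code C' mod 8 ^ min (\<tau> C) (\<tau> C')"
    by blast
  have "\<exists>i. \<exists>b<3. 2 ^ (lgc C + i + 1) \<le> ball_card x (24 * R) \<and> bit (code C) (3 * i + b) \<noteq> bit (code C') (3 * i + b)"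
    if a: "C \<in> \<D>" "C' \<in> \<D>" "x \<in> C" "y \<in> C'" "C \<noteq> C'" "lgc C = lgc C'" "d x y \<le> 4 * R" for C C' x y
  proof -
    have S: "C \<in> S" "C' \<in> S" using a unfolding S_def by auto
    have "near C C'" using a SD(2)[OF S(1)] SD(2)[OF S(2)] unfolding near_def by blast
    from code_bit[OF code[OF S a(5) this]] obtain i b where
      ib: "i < min (\<tau> C) (\<tau> C')" "b < 3" "bit (code C) (3 * i + b) \<noteq> bit (code C') (3 * i + b)" by blast
    have "i < floor_log (Ns C) - lgc C" using ib(1) unfolding \<tau>_def by simp
    then have "lgc C + i + 1 \<le> floor_log (Ns C)" by linarith
    then have "2 ^ (lgc C + i + 1) \<le> Ns C" using pow2_le_iff[OF Ns_pos[OF S(1)]] by blast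
    then show ?thesis using Ns_le[OF S(1) a(3)] ib by (meson order_trans)
  qed
  then show ?thesis by blast
qed

text \<open>The nine types are three comparisons of the size exponent \<open>\<alpha>\<close> with
  the level \<open>\<mu>\<close>, the three bits of the octal digit belonging to that level, and
  their negations. Negations are included because the cluster of \<open>x\<close> has to be on and
  that of \<open>y\<close> off.\<close>

definition switched_on :: "nat \<Rightarrow> nat \<Rightarrow> nat \<Rightarrow> nat \<Rightarrow> bool" where
  "switched_on t \<mu> \<alpha> c \<longleftrightarrow>
    (if t = 0 then \<mu> \<le> \<alpha> + 1 else if t = 1 then \<mu> \<le> \<alpha> else if t = 2 then \<alpha> < \<mu>
     else if t < 6 then \<alpha> < \<mu> \<and> bit c (3 * (\<mu> - \<alpha> - 1) + (t - 3))
     else \<alpha> < \<mu> \<and> \<not> bit c (3 * (\<mu> - \<alpha> - 1) + (t - 6)))"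

text \<open>Clusters of different sizes are separated by comparing the sizes with \<open>2 ^ \<mu>\<close>, those of about the same size
  by their codes.\<close>

lemma light_pair:
  assumes R: "0 < R" and D: "\<And>C. C \<in> \<D> \<Longrightarrow> C \<subseteq> V"
    and diam: "\<And>C u v. C \<in> \<D> \<Longrightarrow> u \<in> C \<Longrightarrow> v \<in> C \<Longrightarrow> d u v \<le> 5 * R"
    and disj: "\<And>C C'. C \<in> \<D> \<Longrightarrow> C' \<in> \<D> \<Longrightarrow> C \<noteq> C' \<Longrightarrow> C \<inter> C' = {}"
    and code: "\<And>C C' x y. \<lbrakk>C \<in> \<D>; C' \<in> \<D>; x \<in> C; y \<in> C'; C \<noteq> C'; lgc C = lgc C'; d x y \<le> 4 * R\<rbrakk> \<Longrightarrow>
      \<exists>i. \<exists>b<3. 2 ^ (lgc C + i + 1) \<le> ball_card x (24 * R) \<and> bit (code C) (3 * i + b) \<noteq> bit (code C') (3 * i + b)"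
    and xy: "x \<in> V" "y \<in> V" "d x y \<le> 4 * R"
    and C: "C \<in> \<D>" "\<forall>v\<in>V. d x v \<le> R \<longrightarrow> v \<in> C" "y \<notin> C"
    and \<nu>: "\<nu> = floor_log (ball_card x R)" and light: "2 ^ Suc \<nu> \<le> ball_card x (24 * R)"
  shows "\<exists>t<9. \<exists>\<mu>. \<nu> < \<mu> \<and> 2 ^ \<mu> \<le> ball_card x (24 * R) \<and> switched_on t \<mu> (lgc C) (code C) \<and>
    (\<forall>C'\<in>\<D>. y \<in> C' \<longrightarrow> \<not> switched_on t \<mu> (lgc C') (code C'))"
proof -
  have xC: "x \<in> C" using C(2) xy(1) d_self[of x] R by auto
  have finC: "finite C" using D[OF C(1)] finV finite_subset by blast
  have cC: "0 < card C" using xC finC by (auto simp: card_gt_0_iff)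
  have ball_sub: "{v \<in> V. d x v \<le> R} \<subseteq> C" using C(2) by blast
  then have "ball_card x R \<le> card C" unfolding ball_card_def using finC by (intro card_mono)
  then have \<nu>C: "\<nu> \<le> lgc C" unfolding \<nu> by (rule floor_log_le_iff)
  have near_ball: "E \<subseteq> {v \<in> V. d x v \<le> 24 * R}" if E: "E \<in> \<D>" "z \<in> E" "d x z \<le> 4 * R" for E z
  proof
    fix v assume v: "v \<in> E"
    have "d x v \<le> d x z + d z v" using d_tri[OF xy(1), of z v] D[OF E(1)] E v by blast
    then have "d x v \<le> 9 * R" using diam[OF E(1,2) v] E(3) by linarith
    then show "v \<in> {v \<in> V. d x v \<le> 24 * R}" using v D[OF E(1)] R by auto
  qed
  have lg_ball: "2 ^ lgc E \<le> ball_card x (24 * R)" if E: "E \<in> \<D>" "z \<in> E" "d x z \<le> 4 * R" for E z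
  proof -
    have "finite E" using D[OF E(1)] finV finite_subset by blast
    then have "2 ^ lgc E \<le> card E" using E(2) by (intro floor_log_exp2_le) (auto simp: card_gt_0_iff)
    also have "\<dots> \<le> ball_card x (24 * R)" unfolding ball_card_def using near_ball[OF E] finV by (intro card_mono) auto
    finally show ?thesis .
  qed
  have uniq: "C'' = C'" if "C' \<in> \<D>" "y \<in> C'" "C'' \<in> \<D>" "y \<in> C''" for C' C''
    using disj that by blast
  show ?thesis
  proof (cases "\<exists>C'\<in>\<D>. y \<in> C'")
    case False
    then show ?thesis using \<nu>C light by (intro exI[of _ 0] exI[of _ "Suc \<nu>"]) (auto simp: switched_on_def)
  next
    case True
    then obtain C' where C': "C' \<in> \<D>" "y \<in> C'" by blast
    have red: ?thesis if "t < 9" "\<nu> < \<mu>" "2 ^ \<mu> \<le> ball_card x (24 * R)" "switched_on t \<mu> (lgc C) (code C)" 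
      "\<not> switched_on t \<mu> (lgc C') (code C')" for t \<mu>
      using that uniq[OF C'] by blast
    have x4: "d x x \<le> 4 * R" using d_self[OF xy(1)] R by simp
    consider "lgc C' < \<nu>" | "\<nu> \<le> lgc C'" "lgc C' < lgc C" | "lgc C < lgc C'" | "lgc C' = lgc C" by linarith
    then show ?thesis
    proof cases
      case 1
      \<comment> \<open>\<open>lgc C\<close> may equal \<open>\<nu>\<close> while the level must
        exceed \<open>\<nu>\<close>; the shift in \<open>\<mu> \<le> \<alpha> + 1\<close> is made
        for this case.\<close>
      show ?thesis by (rule red[of 0 "Suc \<nu>"]) (use 1 \<nu>C light in \<open>auto simp: switched_on_def\<close>)
    next
      case 2
      have "(2::nat) ^ Suc (lgc C') \<le> 2 ^ lgc C" using 2 by (intro power_increasing) auto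
      then have "2 ^ Suc (lgc C') \<le> ball_card x (24 * R)" using lg_ball[OF C(1) xC x4] by (rule order_trans)
      then show ?thesis using red[of 1 "Suc (lgc C')"] 2 by (auto simp: switched_on_def)
    next
      case 3
      have "(2::nat) ^ Suc (lgc C) \<le> 2 ^ lgc C'" using 3 by (intro power_increasing) auto
      then have "2 ^ Suc (lgc C) \<le> ball_card x (24 * R)" using lg_ball[OF C' xy(3)] by (rule order_trans)
      then show ?thesis using red[of 2 "Suc (lgc C)"] 3 \<nu>C by (auto simp: switched_on_def)
    next
      case 4
      have "C \<noteq> C'" using C(3) C'(2) by blast
      from code[OF C(1) C'(1) xC C'(2) this 4[symmetric] xy(3)] obtain i b where
        ib: "b < 3" "2 ^ (lgc C + i + 1) \<le> ball_card x (24 * R)" "bit (code C) (3 * i + b) \<noteq> bit (code C') (3 * i + b)" by blast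
      show ?thesis
      proof (cases "bit (code C) (3 * i + b)")
        case True
        then show ?thesis using red[of "3 + b" "lgc C + i + 1"] ib 4 \<nu>C by (auto simp: switched_on_def)
      next
        case False
        then show ?thesis using red[of "6 + b" "lgc C + i + 1"] ib 4 \<nu>C by (auto simp: switched_on_def)
      qed
    qed
  qed
qed

end

lemma coloured_coverD:
  assumes "coloured_cover V d R \<epsilon> s \<C>"
  shows "c < s \<Longrightarrow> C \<in> \<C> c \<Longrightarrow> C \<subseteq> V"
    and "c < s \<Longrightarrow> C \<in> \<C> c \<Longrightarrow> u \<in> C \<Longrightarrow> v \<in> C \<Longrightarrow> d u v \<le> 5 * R"
    and "c < s \<Longrightarrow> C \<in> \<C> c \<Longrightarrow> C' \<in> \<C> c \<Longrightarrow> C \<noteq> C' \<Longrightarrow> C \<inter> C' = {}"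
    and "x \<in> V \<Longrightarrow> \<exists>c<s. \<exists>C\<in>\<C> c. (\<forall>v\<in>V. d x v \<le> R \<longrightarrow> v \<in> C) \<and> (\<forall>v\<in>C. d x v \<le> (3 + \<epsilon>) * R)"
proof -
  note a = assms[unfolded coloured_cover_def]
  show "c < s \<Longrightarrow> C \<in> \<C> c \<Longrightarrow> C \<subseteq> V" using a[THEN conjunct1] by blast
  show "c < s \<Longrightarrow> C \<in> \<C> c \<Longrightarrow> u \<in> C \<Longrightarrow> v \<in> C \<Longrightarrow> d u v \<le> 5 * R" using a[THEN conjunct1] by blast
  show "c < s \<Longrightarrow> C \<in> \<C> c \<Longrightarrow> C' \<in> \<C> c \<Longrightarrow> C \<noteq> C' \<Longrightarrow> C \<inter> C' = {}"
    using a[THEN conjunct2, THEN conjunct1] by blast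
  show "x \<in> V \<Longrightarrow> \<exists>c<s. \<exists>C\<in>\<C> c. (\<forall>v\<in>V. d x v \<le> R \<longrightarrow> v \<in> C) \<and> (\<forall>v\<in>C. d x v \<le> (3 + \<epsilon>) * R)"
    using a[THEN conjunct2, THEN conjunct2] by (rule bspec)
qed

section \<open>Coordinates shared by many scales\<close>

context fmetric
begin

text \<open>The truncation by \<^const>\<open>clamp\<close> silences near \<open>u\<close>
  all scales that are much larger than the distance \<open>rho (2 ^ \<mu>) u\<close>.\<close>

definition coord :: "real \<Rightarrow> (nat \<Rightarrow> real) \<Rightarrow> (nat \<Rightarrow> nat \<Rightarrow> 'a set set) \<Rightarrow> (nat \<Rightarrow> nat \<Rightarrow> 'a set \<Rightarrow> nat) \<Rightarrow>
    nat \<Rightarrow> nat \<Rightarrow> nat \<Rightarrow> nat \<Rightarrow> nat \<Rightarrow> nat \<Rightarrow> 'a \<Rightarrow> real" where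
  "coord \<kappa> Rs \<C> code L m \<mu> j c t u = Max (insert 0
     ((\<lambda>p. min (clamp \<kappa> (Rs (fst p)) (rho (2 ^ \<mu>) u)) (phi (Rs (fst p)) (snd p) u)) `
      {(i, C). i \<le> L \<and> i mod m = j \<and> C \<in> \<C> i c \<and> switched_on t \<mu> (lgc C) (code i c C)}))"

lemma finite_coord_index:
  fixes \<C> :: "nat \<Rightarrow> nat \<Rightarrow> 'a set set"
  assumes "\<And>i C. C \<in> \<C> i c \<Longrightarrow> C \<subseteq> V"
  shows "finite {(i, C). i \<le> L \<and> i mod m = j \<and> C \<in> \<C> i c \<and> switched_on t \<mu> (lgc C) (code i c C)}"
proof (rule finite_subset)
  show "{(i, C). i \<le> L \<and> i mod m = j \<and> C \<in> \<C> i c \<and> switched_on t \<mu> (lgc C) (code i c C)} \<subseteq> {..L} \<times> Pow V"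
    using assms by blast
  show "finite ({..L} \<times> Pow V)" using finV by simp
qed

lemma lip_coord:
  assumes "\<And>i C. C \<in> \<C> i c \<Longrightarrow> C \<subseteq> V" "2 ^ \<mu> \<le> card V"
  shows "lip (coord \<kappa> Rs \<C> code L m \<mu> j c t)"
  unfolding coord_def
  by (rule lip_Max[OF finite_coord_index[OF assms(1)]])
    (auto intro!: lip_min lip_clamp lip_rho lip_phi assms(2))

text \<open>At \<open>x\<close> the term of \<open>C\<close> is at least
  \<open>(1 - \<kappa>) * Rs i\<close>, because \<open>rho (2 ^ \<mu>) x\<close> exceeds
  \<open>Rs i\<close>. At \<open>y\<close> no term exceeds \<open>\<kappa> * Rs i\<close>: smaller
  scales are capped, at scale \<open>i\<close> the clusters containing \<open>y\<close> are off and
  all others vanish at \<open>y\<close>, and larger scales are truncated to 0. The factor 28 is 24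
  for \<open>rho (2 ^ \<mu>) x\<close> plus 4 for the way from \<open>x\<close> to
  \<open>y\<close>.\<close>

lemma coord_separates:
  assumes cov: "\<And>i C. C \<in> \<C> i c \<Longrightarrow> C \<subseteq> V"
    and Rs: "\<And>i. 0 < Rs i" "\<And>i i'. i < i' \<Longrightarrow> i mod m = i' mod m \<Longrightarrow> 28 * Rs i \<le> \<kappa> * Rs i'" and \<kappa>: "0 < \<kappa>" "\<kappa> \<le> 1"
    and xy: "x \<in> V" "y \<in> V" "d x y \<le> 4 * Rs i" and i: "i \<le> L" and C: "C \<in> \<C> i c" "\<forall>v\<in>V. d x v \<le> Rs i \<longrightarrow> v \<in> C"
    and \<mu>: "floor_log (ball_card x (Rs i)) < \<mu>" "2 ^ \<mu> \<le> ball_card x (24 * Rs i)"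
    and on: "switched_on t \<mu> (lgc C) (code i c C)"
    and off: "\<forall>C'\<in>\<C> i c. y \<in> C' \<longrightarrow> \<not> switched_on t \<mu> (lgc C') (code i c C')"
  shows "(1 - 2 * \<kappa>) * Rs i \<le> coord \<kappa> Rs \<C> code L m \<mu> (i mod m) c t x - coord \<kappa> Rs \<C> code L m \<mu> (i mod m) c t y"
proof -
  define S where "S = {(i', C). i' \<le> L \<and> i' mod m = i mod m \<and> C \<in> \<C> i' c \<and> switched_on t \<mu> (lgc C) (code i' c C)}"
  define g where "g = (\<lambda>u p. min (clamp \<kappa> (Rs (fst p)) (rho (2 ^ \<mu>) u)) (phi (Rs (fst p)) (snd p) u))"
  have finS: "finite S" unfolding S_def by (rule finite_coord_index[OF cov])
  have F: "coord \<kappa> Rs \<C> code L m \<mu> (i mod m) c t u = Max (insert 0 (g u ` S))" for u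
    unfolding coord_def S_def g_def ..
  have R: "0 < Rs i" using Rs(1) .
  have "ball_card x (24 * Rs i) \<le> card V" unfolding ball_card_def using finV by (intro card_mono) auto
  then have \<mu>V: "1 \<le> (2::nat) ^ \<mu>" "2 ^ \<mu> \<le> card V" using \<mu>(2) by auto
  have "\<not> 2 ^ \<mu> \<le> ball_card x (Rs i)" using pow2_le_iff[OF bc_pos[OF xy(1)], of "Rs i"] R \<mu>(1) by simp
  then have rx1: "Rs i < rho (2 ^ \<mu>) x" using rho_le_iff[OF xy(1) \<mu>V] by (metis not_le)
  have rx2: "rho (2 ^ \<mu>) x \<le> 24 * Rs i" using rho_le_iff[OF xy(1) \<mu>V] \<mu>(2) by blast
  have ry: "rho (2 ^ \<mu>) y \<le> 28 * Rs i"
    using lip_rho[OF \<mu>V] xy rx2 d_sym[OF xy(1,2)] unfolding lip_def by fastforce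
  have "(1 - \<kappa>) * Rs i \<le> clamp \<kappa> (Rs i) (rho (2 ^ \<mu>) x)"
  proof -
    have "(1 - \<kappa>) * Rs i \<le> Rs i" using R \<kappa> by (simp add: mult_left_le_one_le)
    moreover have "(1 - \<kappa>) * Rs i \<le> rho (2 ^ \<mu>) x - \<kappa> * Rs i" using rx1 by (simp add: algebra_simps)
    ultimately show ?thesis unfolding clamp_def by simp
  qed
  moreover have "(1 - \<kappa>) * Rs i \<le> phi (Rs i) C x"
    using phi_full[OF C(2)] R \<kappa> by (simp add: mult_left_le_one_le)
  ultimately have "(1 - \<kappa>) * Rs i \<le> g x (i, C)" unfolding g_def by simp
  moreover have "g x (i, C) \<le> Max (insert 0 (g x ` S))"
    using i C(1) on finS unfolding S_def by (intro Max_ge) auto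
  ultimately have Fx: "(1 - \<kappa>) * Rs i \<le> Max (insert 0 (g x ` S))" by (rule order_trans)
  have pos: "0 \<le> \<kappa> * Rs i" using \<kappa> R by simp
  have "g y p \<le> \<kappa> * Rs i" if p: "p \<in> S" for p
  proof -
    obtain i' C' where p': "p = (i', C')" "i' mod m = i mod m" "C' \<in> \<C> i' c" "switched_on t \<mu> (lgc C') (code i' c C')"
      using p unfolding S_def by blast
    consider "i' < i" | "i' = i" | "i < i'" by linarith
    then show ?thesis
    proof cases
      case 1
      have "28 * Rs i' \<le> \<kappa> * Rs i" using Rs(2)[OF 1 p'(2)] .
      then have "Rs i' \<le> \<kappa> * Rs i" using Rs(1)[of i'] by argo
      moreover have "g y p \<le> Rs i'" unfolding g_def clamp_def p'(1) using Rs(1)[of i'] by auto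
      ultimately show ?thesis by simp
    next
      case 2
      then have "y \<notin> C'" using off p' by blast
      then have "g y p \<le> 0" using phi_zero[OF xy(2), of C' "Rs i'"] unfolding g_def p'(1) by simp
      then show ?thesis using pos by simp
    next
      case 3
      have "rho (2 ^ \<mu>) y \<le> \<kappa> * Rs i'" using ry Rs(2)[OF 3 p'(2)[symmetric]] by simp
      then have "clamp \<kappa> (Rs i') (rho (2 ^ \<mu>) y) = 0" unfolding clamp_def using Rs(1)[of i'] by simp
      then have "g y p \<le> 0" unfolding g_def p'(1) by simp
      then show ?thesis using pos by simp
    qed
  qed
  then have "Max (insert 0 (g y ` S)) \<le> \<kappa> * Rs i" using finS pos by (intro Max.boundedI) auto
  then show ?thesis using Fx unfolding F by (simp add: algebra_simps)
qed

text \<open>A pair at distance \<open>D\<close> is treated at the last scale with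
  \<open>(3 + e) * Rs i < D\<close>, where the cluster of \<open>x\<close> cannot contain
  \<open>y\<close>. The ratio \<open>1 + e\<close> of consecutive scales enters the distortion, and
  \<open>m\<close> is large enough for scales of equal residue to differ by the factor
  \<open>28 / \<kappa>\<close>.\<close>

theorem metric_embedding:
  assumes e: "0 < e" "e \<le> 1 / 5" and \<kappa>: "0 < \<kappa>" "\<kappa> \<le> 1" and m: "1 \<le> m" "28 / \<kappa> \<le> (1 + e) ^ m"
    and covers: "\<And>R. 0 < R \<Longrightarrow> \<exists>\<C>. coloured_cover V d R e s \<C>"
  shows "\<exists>Fam. finite Fam \<and> card Fam \<le> (floor_log (card V) + 1) * (1 + m * s * 9) \<and> (\<forall>f\<in>Fam. lip f) \<and>
    (\<forall>x\<in>V. \<forall>y\<in>V. \<exists>f\<in>Fam. min (1 / 3) ((1 - 2 * \<kappa>) / ((3 + e) * (1 + e))) * d x y \<le> \<bar>f x - f y\<bar>)"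
proof -
  define Ds where "Ds = {t \<in> (\<lambda>(x, y). d x y) ` (V \<times> V). 0 < t}"
  have finD: "finite Ds" using finV unfolding Ds_def by simp
  define r0 where "r0 = Min (insert 1 Ds)"
  have r0: "0 < r0" "\<And>t. t \<in> Ds \<Longrightarrow> r0 \<le> t"
    using finD unfolding r0_def Ds_def by auto
  \<comment> \<open>Then \<open>(3 + e) * R0\<close> is half of \<open>r0\<close>, so that scale 0
    is too small for every positive distance.\<close>
  define R0 where "R0 = r0 / (2 * (3 + e))"
  have "3 + e \<noteq> 0" using e by simp
  then have "(3 + e) * R0 = r0 / 2" unfolding R0_def by (simp only: times_divide_eq_right) (simp add: field_simps)
  then have R0: "0 < R0" "(3 + e) * R0 < r0" using r0(1) e unfolding R0_def by auto
  define Rs where "Rs = (\<lambda>i. R0 * (1 + e) ^ i)"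
  have Rs_pos: "0 < Rs i" for i using R0 e unfolding Rs_def by simp
  obtain L where L: "Max (insert 1 Ds) / ((3 + e) * R0) < (1 + e) ^ L" using real_arch_pow[of "1 + e"] e by auto
  have L': "t \<le> (3 + e) * Rs L" if "t \<in> Ds" for t
  proof -
    have "t \<le> Max (insert 1 Ds)" using finD that by simp
    also have "\<dots> \<le> (3 + e) * R0 * (1 + e) ^ L" using L R0(1) e by (simp add: divide_less_eq mult.commute)
    finally show ?thesis unfolding Rs_def by (simp add: mult.assoc)
  qed
  have Rs_gap: "28 * Rs i \<le> \<kappa> * Rs i'" if "i < i'" "i mod m = i' mod m" for i i'
  proof -
    have "m \<le> i' - i" using that m(1) by (metis dvd_imp_le mod_eq_dvd_iff_nat less_imp_le_nat zero_less_diff)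
    then have "i' = i + m + (i' - i - m)" using that(1) by simp
    then have "(1 + e) ^ i' = (1 + e) ^ i * (1 + e) ^ m * (1 + e) ^ (i' - i - m)" by (metis power_add)
    moreover have "28 / \<kappa> * 1 \<le> (1 + e) ^ m * (1 + e) ^ (i' - i - m)"
      using m(2) \<kappa> e by (intro mult_mono) auto
    moreover have "0 \<le> (1 + e) ^ i" using e by simp
    ultimately have "(1 + e) ^ i * (28 / \<kappa> * 1) \<le> (1 + e) ^ i'"
      by (simp only: mult.assoc) (rule mult_left_mono)
    then have "28 / \<kappa> * (1 + e) ^ i \<le> (1 + e) ^ i'" by (simp only: mult_1_right mult.commute)
    from mult_left_mono[OF this less_imp_le[OF R0(1)]]
    have "28 / \<kappa> * Rs i \<le> Rs i'" unfolding Rs_def by (simp only: mult.left_commute)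
    then show ?thesis using \<kappa> by (simp add: field_simps)
  qed
  define cc where "cc = (\<lambda>i \<C>. coloured_cover V d (Rs i) e s \<C>)"
  have "\<forall>i. \<exists>\<C>. cc i \<C>" unfolding cc_def using covers Rs_pos by blast
  then obtain \<C>' where C': "\<And>i. cc i (\<C>' i)" by metis
  define \<C> where "\<C> = (\<lambda>i c. if c < s then \<C>' i c else {})"
  have cs: "c < s" "C \<in> \<C>' i c" if "C \<in> \<C> i c" for i c C
    using that unfolding \<C>_def by (auto split: if_splits)
  note cov = coloured_coverD[OF C'[unfolded cc_def]]
  have CV: "C \<subseteq> V" if "C \<in> \<C> i c" for i c C
    using cov(1)[OF cs[OF that]] .
  have Cdiam: "d u v \<le> 5 * Rs i" if "C \<in> \<C> i c" "u \<in> C" "v \<in> C" for i c C u v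
    using cov(2)[OF cs[OF that(1)] that(2,3)] .
  have Cdisj: "C \<inter> D = {}" if "C \<in> \<C> i c" "D \<in> \<C> i c" "C \<noteq> D" for i c C D
    using cov(3)[OF cs[OF that(1)] cs(2)[OF that(2)] that(3)] .
  have Ccov: "\<exists>c<s. \<exists>C\<in>\<C> i c. (\<forall>v\<in>V. d x v \<le> Rs i \<longrightarrow> v \<in> C) \<and> (\<forall>v\<in>C. d x v \<le> (3 + e) * Rs i)" if "x \<in> V" for i x
    using cov(4)[OF that, of i] unfolding \<C>_def by fastforce
  define ok where "ok = (\<lambda>i c (code :: 'a set \<Rightarrow> nat). \<forall>C\<in>\<C> i c. \<forall>C'\<in>\<C> i c. \<forall>x\<in>C. \<forall>y\<in>C'. C \<noteq> C' \<longrightarrow> lgc C = lgc C' \<longrightarrow> d x y \<le> 4 * Rs i \<longrightarrow>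
    (\<exists>k. \<exists>b<3. 2 ^ (lgc C + k + 1) \<le> ball_card x (24 * Rs i) \<and> bit (code C) (3 * k + b) \<noteq> bit (code C') (3 * k + b)))"
  have "\<forall>i c. \<exists>code. ok i c code" unfolding ok_def
    by (intro allI cluster_codes[OF Rs_pos CV Cdiam Cdisj])
  then obtain code where code: "\<And>i c. ok i c (code i c)" by metis
  define B where "B = {\<mu>. 2 ^ \<mu> \<le> card V}"
  have cV: "0 < card V" using finV neV by (simp add: card_gt_0_iff)
  have B: "B = {..floor_log (card V)}" unfolding B_def using pow2_le_iff[OF cV] by auto
  define cf where "cf = (\<lambda>(\<mu>, j, c, t). coord \<kappa> Rs \<C> code L m \<mu> j c t)"
  define Fam where "Fam = (\<lambda>\<mu>. rho (2 ^ \<mu>)) ` B \<union> cf ` (B \<times> {..<m} \<times> {..<s} \<times> {..<9})"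
  have "finite Fam" unfolding Fam_def B by simp
  moreover have "card Fam \<le> (floor_log (card V) + 1) * (1 + m * s * 9)"
  proof -
    have "card Fam \<le> card ((\<lambda>\<mu>. rho (2 ^ \<mu>)) ` B) + card (cf ` (B \<times> {..<m} \<times> {..<s} \<times> {..<9::nat}))"
      unfolding Fam_def by (rule card_Un_le)
    also have "\<dots> \<le> card B + card (B \<times> {..<m} \<times> {..<s} \<times> {..<9::nat})"
      unfolding B by (intro add_mono card_image_le) auto
    also have "\<dots> = (floor_log (card V) + 1) * (1 + m * s * 9)"
      unfolding B by (simp add: card_cartesian_product algebra_simps)
    finally show ?thesis .
  qed
  moreover have lipF: "lip f" if f: "f \<in> Fam" for f
  proof -
    have "lip (rho (2 ^ \<mu>))" if "\<mu> \<in> B" for \<mu> using that lip_rho unfolding B_def by simp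
    moreover have "lip (coord \<kappa> Rs \<C> code L m \<mu> j c t)" if "\<mu> \<in> B" for \<mu> j c t
      using that lip_coord[OF CV] unfolding B_def by simp
    ultimately show ?thesis using f unfolding Fam_def cf_def by auto
  qed
  moreover have "\<exists>f\<in>Fam. min (1 / 3) ((1 - 2 * \<kappa>) / ((3 + e) * (1 + e))) * d x y \<le> \<bar>f x - f y\<bar>" if xy: "x \<in> V" "y \<in> V" for x y
  \<comment> \<open>Distinct points may have distance 0; any member of the family serves for
    them.\<close>
  proof (cases "d x y = 0")
    case True
    have "0 \<in> B" unfolding B by simp
    then show ?thesis using True unfolding Fam_def by auto
  next
    case False
    define D where "D = d x y"
    have D: "0 < D" "D \<in> Ds" using False d_nonneg[OF xy] xy unfolding D_def Ds_def by auto
    \<comment> \<open>By the choice of \<open>R0\<close> this index is positive; its predecessor is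
      the scale of the pair.\<close>
    define j where "j = (LEAST j. D \<le> (3 + e) * Rs j)"
    have j: "D \<le> (3 + e) * Rs j" "j \<le> L"
      unfolding j_def using L'[OF D(2)] by (rule LeastI, rule Least_le)
    have "j \<noteq> 0"
    proof
      assume "j = 0"
      then have "D \<le> (3 + e) * R0" using j(1) unfolding Rs_def by simp
      then show False using R0(2) r0(2)[OF D(2)] by simp
    qed
    then obtain i where ji: "j = Suc i" using not0_implies_Suc by blast
    have i: "(3 + e) * Rs i < D" "i \<le> L"
      using not_less_Least[of i "\<lambda>j. D \<le> (3 + e) * Rs j"] j(2) ji unfolding j_def by auto
    have Du: "D \<le> (3 + e) * (1 + e) * Rs i" using j(1) unfolding ji Rs_def by (simp add: mult_ac)
    have D4: "D \<le> 4 * Rs i"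
    proof -
      have "(3 + e) * (1 + e) \<le> 16 / 5 * (6 / 5)" using e by (intro mult_mono) auto
      then have "(3 + e) * (1 + e) * Rs i \<le> 4 * Rs i" using Rs_pos[of i] by (intro mult_right_mono) auto
      then show ?thesis using Du by simp
    qed
    have bp: "0 < ball_card x (Rs i)" using bc_pos[OF xy(1)] Rs_pos[of i] by simp
    have bV: "ball_card x t \<le> card V" for t unfolding ball_card_def using finV by (intro card_mono) auto
    define \<nu> where "\<nu> = floor_log (ball_card x (Rs i))"
    show ?thesis
    proof (cases "ball_card x (24 * Rs i) < 2 ^ Suc \<nu>")
      case True
      have inB: "\<nu> \<in> B" using floor_log_le_iff[OF bV] unfolding B \<nu>_def by simp
      have "rho (2 ^ \<nu>) x + (D - 2 * Rs i) \<le> rho (2 ^ \<nu>) y"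
        using heavy_pair[OF xy Rs_pos] D4 True unfolding D_def \<nu>_def by blast
      moreover have "1 / 3 * D \<le> D - 2 * Rs i"
      proof -
        have "3 * Rs i \<le> (3 + e) * Rs i" using e Rs_pos[of i] by (intro mult_right_mono) auto
        then show ?thesis using i(1) by linarith
      qed
      moreover have "min (1 / 3) ((1 - 2 * \<kappa>) / ((3 + e) * (1 + e))) * D \<le> 1 / 3 * D"
        using D(1) by (intro mult_right_mono) auto
      ultimately have "min (1 / 3) ((1 - 2 * \<kappa>) / ((3 + e) * (1 + e))) * D \<le> \<bar>rho (2 ^ \<nu>) x - rho (2 ^ \<nu>) y\<bar>"
        by linarith
      then show ?thesis using inB unfolding Fam_def D_def by blast
    next
      case False
      then have light: "2 ^ Suc \<nu> \<le> ball_card x (24 * Rs i)" by simp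
      obtain c C where c: "c < s" "C \<in> \<C> i c" "\<forall>v\<in>V. d x v \<le> Rs i \<longrightarrow> v \<in> C" "\<forall>v\<in>C. d x v \<le> (3 + e) * Rs i"
        using Ccov[OF xy(1)] by blast
      have yC: "y \<notin> C" using c(4) i(1) unfolding D_def by force
      have "\<exists>t<9. \<exists>\<mu>. \<nu> < \<mu> \<and> 2 ^ \<mu> \<le> ball_card x (24 * Rs i) \<and> switched_on t \<mu> (lgc C) (code i c C) \<and>
        (\<forall>C'\<in>\<C> i c. y \<in> C' \<longrightarrow> \<not> switched_on t \<mu> (lgc C') (code i c C'))"
      proof (rule light_pair[OF Rs_pos CV Cdiam Cdisj _ xy _ c(2,3) yC \<nu>_def light])
        show "d x y \<le> 4 * Rs i" using D4 unfolding D_def .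
        fix C C' x y assume "C \<in> \<C> i c" "C' \<in> \<C> i c" "x \<in> C" "y \<in> C'" "C \<noteq> C'" "lgc C = lgc C'" "d x y \<le> 4 * Rs i"
        then show "\<exists>k. \<exists>b<3. 2 ^ (lgc C + k + 1) \<le> ball_card x (24 * Rs i) \<and> bit (code i c C) (3 * k + b) \<noteq> bit (code i c C') (3 * k + b)"
          using code[of i c] unfolding ok_def by blast
      qed
      then obtain t \<mu> where t: "t < 9" "\<nu> < \<mu>" "2 ^ \<mu> \<le> ball_card x (24 * Rs i)" "switched_on t \<mu> (lgc C) (code i c C)"
        "\<forall>C'\<in>\<C> i c. y \<in> C' \<longrightarrow> \<not> switched_on t \<mu> (lgc C') (code i c C')" by blast
      define f where "f = coord \<kappa> Rs \<C> code L m \<mu> (i mod m) c t"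
      have sep: "(1 - 2 * \<kappa>) * Rs i \<le> f x - f y" unfolding f_def
      proof (rule coord_separates[where Rs = Rs and \<C> = \<C> and code = code])
        show "d x y \<le> 4 * Rs i" using D4 unfolding D_def .
        show "floor_log (ball_card x (Rs i)) < \<mu>" using t(2) unfolding \<nu>_def .
        show "C \<subseteq> V" if "C \<in> \<C> i c" for i C using CV[OF that] .
        show "28 * Rs i \<le> \<kappa> * Rs i'" if "i < i'" "i mod m = i' mod m" for i i' using Rs_gap[OF that] .
      qed (fact Rs_pos \<kappa> xy i(2) c(2,3) t(3-5))+
      have "f \<in> Fam"
      proof -
        have "\<mu> \<in> B" using t(3) bV[of "24 * Rs i"] unfolding B_def by simp
        then have "(\<mu>, i mod m, c, t) \<in> B \<times> {..<m} \<times> {..<s} \<times> {..<9}" using c(1) t(1) m(1) by simp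
        moreover have "f = cf (\<mu>, i mod m, c, t)" unfolding f_def cf_def by simp
        ultimately show ?thesis unfolding Fam_def by blast
      qed
      moreover have "min (1 / 3) ((1 - 2 * \<kappa>) / ((3 + e) * (1 + e))) * D \<le> \<bar>f x - f y\<bar>"
      proof (cases "0 \<le> 1 - 2 * \<kappa>")
        case True
        have "min (1 / 3) ((1 - 2 * \<kappa>) / ((3 + e) * (1 + e))) * D \<le> (1 - 2 * \<kappa>) / ((3 + e) * (1 + e)) * D"
          using D(1) by (intro mult_right_mono) auto
        also have "\<dots> \<le> (1 - 2 * \<kappa>) / ((3 + e) * (1 + e)) * ((3 + e) * (1 + e) * Rs i)"
          using Du True e by (intro mult_left_mono) auto
        also have "\<dots> = (1 - 2 * \<kappa>) * Rs i"
        proof -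
          have "(3 + e) * (1 + e) \<noteq> 0" using e by simp
          then show ?thesis by (simp only: times_divide_eq_left) simp
        qed
        finally show ?thesis using sep by simp
      next
        case False
        then have "(1 - 2 * \<kappa>) / ((3 + e) * (1 + e)) \<le> 0" using e by (intro divide_nonpos_nonneg) auto
        then have "min (1 / 3) ((1 - 2 * \<kappa>) / ((3 + e) * (1 + e))) * D \<le> 0"
          using D(1) by (intro mult_nonpos_nonneg) auto
        then show ?thesis using abs_ge_zero order_trans by blast
      qed
      ultimately show ?thesis unfolding D_def by blast
    qed
  qed
  ultimately show ?thesis by blast
qed

end

section \<open>Numerical bounds\<close>

text \<open>A single term of the expansion of \<open>(1 + 1 / B) ^ N\<close> is at most
  \<open>exp (N / B)\<close>. For \<open>N\<close> of order \<open>(k + 1) * B\<close> this leaves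
  no factor growing like \<open>k ^ k\<close>.\<close>

lemma binomial_le_exp:
  assumes "0 < B" "real N \<le> (real k + 1) * B"
  shows "real (N choose k) \<le> B ^ k * 3 ^ (k + 1)"
proof -
  define x where "x = 1 / B"
  have x: "0 < x" using assms unfolding x_def by simp
  have "real (N choose k) * x ^ k \<le> (1 + x) ^ N"
  proof (cases "k \<le> N")
    case True
    have "(x + 1) ^ N = (\<Sum>j\<le>N. real (N choose j) * x ^ j * 1 ^ (N - j))" by (rule binomial_ring)
    moreover have "real (N choose k) * x ^ k * 1 ^ (N - k) \<le> (\<Sum>j\<le>N. real (N choose j) * x ^ j * 1 ^ (N - j))"
      using True x by (intro member_le_sum) auto
    ultimately show ?thesis by (simp add: add.commute)
  qed (use x in \<open>simp add: binomial_eq_0\<close>)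
  also have "\<dots> \<le> exp x ^ N" using x exp_ge_add_one_self[of x] by (intro power_mono) auto
  also have "\<dots> = exp (real N * x)" by (simp add: exp_of_nat_mult)
  also have "\<dots> \<le> exp (real (k + 1))"
    using assms unfolding x_def by (simp add: divide_le_eq add.commute)
  also have "\<dots> = exp 1 ^ (k + 1)" using exp_of_nat_mult[of "k + 1" "1::real"] by simp
  also have "\<dots> \<le> 3 ^ (k + 1)" using exp_le by (intro power_mono) auto
  finally have "real (N choose k) * x ^ k \<le> 3 ^ (k + 1)" .
  then have "real (N choose k) * x ^ k * B ^ k \<le> 3 ^ (k + 1) * B ^ k"
    using assms(1) by (intro mult_right_mono) auto
  then have "real (N choose k) * (x ^ k * B ^ k) \<le> 3 ^ (k + 1) * B ^ k" by (simp only: mult.assoc)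
  moreover have "x ^ k * B ^ k = 1" using assms(1) unfolding x_def by (simp flip: power_mult_distrib)
  ultimately show ?thesis by (simp only: mult_1_right mult.commute)
qed

lemma ln2_ge_half: "1 / 2 \<le> ln (2::real)"
proof -
  have "exp (1 / 2 :: real) ^ 2 = exp 1" by (simp flip: exp_of_nat_mult)
  also have "\<dots> \<le> 2 ^ 2" using exp_le by simp
  finally have "exp (1 / 2 :: real) \<le> 2" by (rule power2_le_imp_le) simp
  then show ?thesis using ln_ge_iff[of 2 "1 / 2 :: real"] by linarith
qed

lemma real_nat_ceiling_le: "0 \<le> t \<Longrightarrow> real (nat \<lceil>t\<rceil>) \<le> t + 1"
  by linarith

text \<open>The covers are taken with \<open>e = \<epsilon> / 80\<close>, whence 1600 = 20 * 80 and
  960 = 12 * 80. In 9612 = 1602 * 3 * 2 the 3 stems from \<open>binomial_le_exp\<close>, and the 2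
  absorbs the factor \<open>k + 1 \<le> 2 ^ k\<close>.\<close>

lemma colours_bound:
  fixes \<epsilon> :: real
  assumes \<epsilon>: "0 < \<epsilon>" "\<epsilon> < 1 / 2"
    and M: "M = nat \<lceil>1600 * (real k + 1) / \<epsilon>\<rceil>"
    and s: "s = nat \<lceil>real ((k + M + 2) choose k) * ((real k + 1) * (960 / \<epsilon>))\<rceil>"
  shows "real (Suc s) \<le> (9612 / \<epsilon>) ^ (k + 1)"
proof -
  define b where "b = real ((k + M + 2) choose k)"
  have k1: "1 \<le> real k + 1" by simp
  have M1: "real M \<le> 1600 * (real k + 1) / \<epsilon> + 1" unfolding M using \<epsilon> by (intro real_nat_ceiling_le) simp
  have e1: "2 \<le> 1 / \<epsilon>" using \<epsilon> by (simp add: field_simps)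
  have "real (k + M + 2) \<le> (real k + 1) * 3 + 1600 * (real k + 1) / \<epsilon>" using M1 by simp
  also have "\<dots> = (real k + 1) * 3 + (real k + 1) * (1600 / \<epsilon>)" by (simp add: mult.commute)
  also have "\<dots> \<le> (real k + 1) * (2 * (1 / \<epsilon>)) + (real k + 1) * (1600 / \<epsilon>)"
    using e1 by (intro add_mono mult_left_mono) auto
  also have "\<dots> = (real k + 1) * (1602 / \<epsilon>)" by (simp add: divide_inverse algebra_simps)
  finally have "real (k + M + 2) \<le> (real k + 1) * (1602 / \<epsilon>)" .
  then have b_le: "b \<le> (1602 / \<epsilon>) ^ k * 3 ^ (k + 1)"
    unfolding b_def using \<epsilon> by (intro binomial_le_exp) auto
  have b1: "1 \<le> b" unfolding b_def by (simp add: Suc_le_eq zero_less_binomial)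
  have bk: "1 \<le> b * (real k + 1)" using mult_mono[OF b1 k1] b1 by simp
  have "real s \<le> b * ((real k + 1) * (960 / \<epsilon>)) + 1"
    unfolding s b_def[symmetric] using b1 \<epsilon> by (intro real_nat_ceiling_le) simp
  then have "real (Suc s) \<le> b * ((real k + 1) * (960 / \<epsilon>)) + 2" by simp
  also have "\<dots> \<le> b * (real k + 1) * (960 / \<epsilon>) + b * (real k + 1) * (2 / \<epsilon>)"
    using mult_mono[OF bk, of 2 "2 / \<epsilon>"] e1 bk by (simp add: mult.assoc)
  also have "\<dots> = b * (real k + 1) * (962 / \<epsilon>)" by (simp add: divide_inverse algebra_simps)
  also have "\<dots> \<le> ((1602 / \<epsilon>) ^ k * 3 ^ (k + 1)) * 2 ^ k * (962 / \<epsilon>)"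
  proof (intro mult_right_mono mult_mono)
    have "k + 1 \<le> 2 ^ k" using Suc_leI[OF less_exp[of k]] by simp
    then have "real (k + 1) \<le> real (2 ^ k)" by (rule of_nat_mono)
    then show "real k + 1 \<le> 2 ^ k" by simp
  qed (use b_le \<epsilon> b1 in auto)
  also have "\<dots> = (9612 / \<epsilon>) ^ k * (2886 / \<epsilon>)"
  proof -
    have "(9612 / \<epsilon>) ^ k = (1602 / \<epsilon>) ^ k * 3 ^ k * 2 ^ k" by (simp flip: power_mult_distrib)
    then show ?thesis by simp
  qed
  also have "\<dots> \<le> (9612 / \<epsilon>) ^ k * (9612 / \<epsilon>)" using \<epsilon> by (intro mult_left_mono divide_right_mono) auto
  finally show ?thesis by (simp add: mult.commute)
qed

text \<open>Here \<open>1120 / \<epsilon>\<close> is \<open>28 / \<kappa>\<close> for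
  \<open>\<kappa> = \<epsilon> / 40\<close>. As 1120 < 2^11, the numerator is at most
  \<open>12 * ln (1 / \<epsilon>)\<close>; the denominator is at least
  \<open>\<epsilon> / 40\<close>, which gives 480, and rounding up is absorbed in 481.\<close>

lemma scales_bound:
  fixes \<epsilon> :: real
  assumes \<epsilon>: "0 < \<epsilon>" "\<epsilon> < 1 / 2" and m: "m = nat \<lceil>ln (1120 / \<epsilon>) / ln (1 + \<epsilon> / 20)\<rceil>"
  shows "1120 / \<epsilon> \<le> (1 + \<epsilon> / 20) ^ m" "1 \<le> m" "real m \<le> 481 / \<epsilon> * ln (1 / \<epsilon>)"
proof -
  define L where "L = ln (1 / \<epsilon>)"
  have e1: "2 \<le> 1 / \<epsilon>" using \<epsilon> by (simp add: field_simps)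
  have "ln 2 \<le> L" unfolding L_def using e1 \<epsilon> by simp
  then have L: "1 / 2 \<le> L" "ln 2 \<le> L" using ln2_ge_half by auto
  have big: "1 < 1120 / \<epsilon>" using \<epsilon> by simp
  have q: "\<epsilon> / 40 \<le> ln (1 + \<epsilon> / 20)"
  proof -
    have "\<epsilon> / 20 - (\<epsilon> / 20)\<^sup>2 \<le> ln (1 + \<epsilon> / 20)"
      using \<epsilon> by (intro ln_one_plus_pos_lower_bound) auto
    moreover have "(\<epsilon> / 20)\<^sup>2 \<le> \<epsilon> / 20 * (1 / 2)"
      unfolding power2_eq_square using \<epsilon> by (intro mult_left_mono) auto
    ultimately show ?thesis by simp
  qed
  then have q0: "0 < ln (1 + \<epsilon> / 20)" using \<epsilon> by linarith
  have num: "0 < ln (1120 / \<epsilon>)" using big by (rule ln_gt_zero)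
  have frac: "0 < ln (1120 / \<epsilon>) / ln (1 + \<epsilon> / 20)" using num q0 by simp
  then have m1: "ln (1120 / \<epsilon>) / ln (1 + \<epsilon> / 20) \<le> real m" unfolding m by linarith
  show "1 \<le> m" using m1 frac by (cases m) auto
  have "ln (1120 / \<epsilon>) \<le> real m * ln (1 + \<epsilon> / 20)" using m1 q0 by (simp add: divide_le_eq)
  also have "\<dots> = ln ((1 + \<epsilon> / 20) ^ m)" using \<epsilon> by (simp add: ln_realpow)
  finally show "1120 / \<epsilon> \<le> (1 + \<epsilon> / 20) ^ m" using \<epsilon> by (subst (asm) ln_le_cancel_iff) auto
  have "ln (1120 / \<epsilon>) \<le> 12 * L"
  proof -
    have "ln (1120 / \<epsilon>) = ln 1120 + L" unfolding L_def using \<epsilon> by (simp add: ln_div)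
    moreover have "ln (1120::real) \<le> ln (2 ^ 11)" by simp
    moreover have "ln ((2::real) ^ 11) = 11 * ln 2" by (subst ln_realpow) auto
    ultimately show ?thesis using L(2) by linarith
  qed
  then have "ln (1120 / \<epsilon>) / ln (1 + \<epsilon> / 20) \<le> 12 * L / (\<epsilon> / 40)"
    using q L \<epsilon> num by (intro frac_le) auto
  moreover have "real m \<le> ln (1120 / \<epsilon>) / ln (1 + \<epsilon> / 20) + 1"
    unfolding m using frac by (intro real_nat_ceiling_le) simp
  ultimately have "real m \<le> 480 / \<epsilon> * L + 1" by simp
  moreover have "1 \<le> 1 / \<epsilon> * L" using mult_mono[OF e1 L(1)] \<epsilon> by simp
  moreover have "481 / \<epsilon> * L = 480 / \<epsilon> * L + 1 / \<epsilon> * L" by (simp add: divide_inverse algebra_simps)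
  ultimately show "real m \<le> 481 / \<epsilon> * ln (1 / \<epsilon>)" unfolding L_def[symmetric] by linarith
qed

text \<open>4330 is 9 * 481 + 1. Of the exponent \<open>k + 3\<close> the colours use
  \<open>k + 1\<close> and the number of scales uses one; the last factor is slack. The estimate
  \<open>2 * n \<le> n / \<epsilon>\<close> pays for the \<open>+ 1\<close> beside
  \<open>floor_log n\<close>.\<close>

lemma dimension_bound:
  fixes \<epsilon> :: real
  assumes \<epsilon>: "0 < \<epsilon>" "\<epsilon> < 1 / 2" and n: "0 < n"
    and m: "real m \<le> 481 / \<epsilon> * ln (1 / \<epsilon>)" and s: "real s \<le> (9612 / \<epsilon>) ^ (k + 1)"
  shows "real ((floor_log n + 1) * (1 + m * s * 9)) \<le> (9612 / \<epsilon>) ^ (k + 3) * ln (1 / \<epsilon>) * ln (real n / \<epsilon>)"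
proof -
  define A where "A = 9612 / \<epsilon>"
  define L where "L = ln (1 / \<epsilon>)"
  have e1: "2 \<le> 1 / \<epsilon>" using \<epsilon> by (simp add: field_simps)
  have "ln 2 \<le> L" unfolding L_def using e1 \<epsilon> by simp
  then have L: "1 / 2 \<le> L" using ln2_ge_half by auto
  have A: "1 \<le> A" unfolding A_def using \<epsilon> by (simp add: field_simps)
  then have Ak: "1 \<le> A ^ (k + 1)" by (rule one_le_power)
  have eL: "1 \<le> 1 / \<epsilon> * L" using mult_mono[OF e1 L] \<epsilon> by simp
  have "real (1 + m * s * 9) \<le> 1 + 481 / \<epsilon> * L * A ^ (k + 1) * 9"
    using mult_mono[OF m s] L \<epsilon> unfolding A_def[symmetric] L_def[symmetric] by simp
  also have "\<dots> \<le> 1 / \<epsilon> * L * A ^ (k + 1) + 481 / \<epsilon> * L * A ^ (k + 1) * 9"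
    using mult_mono[OF eL Ak] eL by (intro add_right_mono) simp
  also have "\<dots> = 4330 / \<epsilon> * L * A ^ (k + 1)" by (simp add: field_simps)
  finally have 1: "real (1 + m * s * 9) \<le> 4330 / \<epsilon> * L * A ^ (k + 1)" .
  have 2: "real (floor_log n + 1) \<le> 2 * ln (real n / \<epsilon>)"
  proof -
    have "real (2 ^ floor_log n) \<le> real n" using floor_log_exp2_le[OF n] by (rule of_nat_mono)
    then have "2 ^ (floor_log n + 1) \<le> 2 * real n" by simp
    also have "\<dots> \<le> real n / \<epsilon>" using mult_right_mono[OF e1, of "real n"] by simp
    finally have "ln (2 ^ (floor_log n + 1)) \<le> ln (real n / \<epsilon>)" using n \<epsilon> by (subst ln_le_cancel_iff) auto
    then have "real (floor_log n + 1) * ln 2 \<le> ln (real n / \<epsilon>)" by (subst (asm) ln_realpow) auto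
    moreover have "real (floor_log n + 1) * (1 / 2) \<le> real (floor_log n + 1) * ln 2"
      using ln2_ge_half by (intro mult_left_mono) auto
    ultimately have "real (floor_log n + 1) * (1 / 2) \<le> ln (real n / \<epsilon>)" by (rule order_trans[rotated])
    then show ?thesis by simp
  qed
  have ln0: "0 \<le> ln (real n / \<epsilon>)" using 2 by simp
  have "real ((floor_log n + 1) * (1 + m * s * 9)) \<le> 2 * ln (real n / \<epsilon>) * (4330 / \<epsilon> * L * A ^ (k + 1))"
    unfolding of_nat_mult by (rule mult_mono[OF 2 1[unfolded of_nat_mult]]) (use ln0 in auto)
  also have "\<dots> = 8660 / \<epsilon> * (A ^ (k + 1) * L * ln (real n / \<epsilon>))" by (simp add: field_simps)
  also have "\<dots> \<le> A ^ 2 * (A ^ (k + 1) * L * ln (real n / \<epsilon>))"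
  proof (rule mult_right_mono)
    have "8660 / \<epsilon> \<le> A" unfolding A_def using \<epsilon> by (intro divide_right_mono) auto
    also have "\<dots> \<le> A ^ 2" using A by (simp add: power2_eq_square mult_le_cancel_left1)
    finally show "8660 / \<epsilon> \<le> A ^ 2" .
  qed (use A L ln0 in simp)
  also have "\<dots> = A ^ (k + 3) * L * ln (real n / \<epsilon>)" by (simp add: power_add power2_eq_square power3_eq_cube mult_ac)
  finally show ?thesis unfolding A_def L_def .
qed

lemma distortion_bound:
  fixes \<epsilon> :: real
  assumes "0 < \<epsilon>" "\<epsilon> < 1 / 2"
  shows "1 / (3 + \<epsilon>) \<le> min (1 / 3) ((1 - 2 * (\<epsilon> / 40)) / ((3 + \<epsilon> / 20) * (1 + \<epsilon> / 20)))"
proof -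
  have "(3 + \<epsilon> / 20) * (1 + \<epsilon> / 20) \<le> (1 - 2 * (\<epsilon> / 40)) * (3 + \<epsilon>)"
  proof -
    have "\<epsilon> * \<epsilon> \<le> \<epsilon> * (1 / 2)" using assms by (intro mult_left_mono) auto
    then show ?thesis by (simp add: algebra_simps) (use assms in argo)
  qed
  moreover have "0 < (3 + \<epsilon> / 20) * (1 + \<epsilon> / 20)" using assms by (intro mult_pos_pos) auto
  ultimately have "1 / (3 + \<epsilon>) \<le> (1 - 2 * (\<epsilon> / 40)) / ((3 + \<epsilon> / 20) * (1 + \<epsilon> / 20))"
    using assms by (simp add: divide_le_eq le_divide_eq)
  moreover have "1 / (3 + \<epsilon>) \<le> 1 / 3" using assms by (intro frac_le) auto
  ultimately show ?thesis by simp
qed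

section \<open>Weighted graphs excluding a complete minor\<close>

text \<open>Weights of arcs become weights of pairs. The default 0 keeps nonnegativity and symmetry
  valid for nonadjacent pairs.\<close>

definition edge_weight :: "('a, 'b) pre_digraph \<Rightarrow> ('b \<Rightarrow> real) \<Rightarrow> 'a \<Rightarrow> 'a \<Rightarrow> real" where
  "edge_weight G w u v = (if (u, v) \<in> arcs_ends G
     then w (SOME a. a \<in> arcs G \<and> tail G a = u \<and> head G a = v) else 0)"

context weighted_graph
begin

lemma arcs_ends_iff: "(u, v) \<in> arcs_ends G \<longleftrightarrow> (\<exists>a\<in>arcs G. tail G a = u \<and> head G a = v)"
  unfolding arcs_ends_conv by auto

lemma arcs_ends_sym: "(u, v) \<in> arcs_ends G \<Longrightarrow> (v, u) \<in> arcs_ends G"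
  using sym_arcs unfolding symmetric_def by (rule symD)

lemma edge_weight_some:
  assumes "(u, v) \<in> arcs_ends G"
  shows "\<exists>a\<in>arcs G. tail G a = u \<and> head G a = v \<and> edge_weight G w u v = w a"
proof -
  have "\<exists>a. a \<in> arcs G \<and> tail G a = u \<and> head G a = v" using assms arcs_ends_iff by blast
  from someI_ex[OF this] show ?thesis using assms unfolding edge_weight_def by auto
qed

lemma edge_weight_arc:
  assumes "a \<in> arcs G"
  shows "edge_weight G w (tail G a) (head G a) = w a"
proof -
  have "(tail G a, head G a) \<in> arcs_ends G" using assms arcs_ends_iff by blast
  from edge_weight_some[OF this] obtain a' where "a' \<in> arcs G" "tail G a' = tail G a" "head G a' = head G a"
    "edge_weight G w (tail G a) (head G a) = w a'" by blast
  moreover from this have "a' = a" using no_multi_arcs[of a' a] assms by (simp add: arc_to_ends_def)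
  ultimately show ?thesis by simp
qed

sublocale wg: wgraph "verts G" "\<lambda>u v. (u, v) \<in> arcs_ends G" "edge_weight G w"
proof
  fix u v
  show "(v, u) \<in> arcs_ends G" if "(u, v) \<in> arcs_ends G" using arcs_ends_sym[OF that] .
  show "u \<in> verts G \<and> v \<in> verts G" if "(u, v) \<in> arcs_ends G"
    using that arcs_ends_iff by auto
  show "0 \<le> edge_weight G w u v"
    using edge_weight_some[of u v] weight_nonneg unfolding edge_weight_def by (cases "(u, v) \<in> arcs_ends G") auto
  show "edge_weight G w u v = edge_weight G w v u"
  proof (cases "(u, v) \<in> arcs_ends G")
    case True
    obtain a where "a \<in> arcs G" "tail G a = u" "head G a = v" "edge_weight G w u v = w a"
      using edge_weight_some[OF True] by blast
    moreover obtain a' where "a' \<in> arcs G" "tail G a' = v" "head G a' = u" "edge_weight G w v u = w a'"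
      using edge_weight_some[OF arcs_ends_sym[OF True]] by blast
    ultimately show ?thesis using weight_sym[of a a'] by simp
  next
    case False
    then have "(v, u) \<notin> arcs_ends G" using arcs_ends_sym by blast
    then show ?thesis using False unfolding edge_weight_def by simp
  qed
qed simp

lemma awalk_walk: "awalk u p v \<Longrightarrow> wg.walk (verts G) u v (awalk_cost w p)"
proof (induction p arbitrary: u)
  case Nil
  then show ?case by (auto simp: awalk_Nil_iff intro: wg.walk_nil)
next
  case (Cons a p)
  then have a: "a \<in> arcs G" "u = tail G a" "awalk (head G a) p v" by (auto simp: awalk_Cons_iff)
  then have "(u, head G a) \<in> arcs_ends G" using arcs_ends_iff by blast
  from wg.walk_Cons[OF this _ Cons.IH[OF a(3)]] show ?case using a edge_weight_arc[OF a(1)] by simp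
qed

lemma walk_awalk: "wg.walk (verts G) u v l \<Longrightarrow> \<exists>p. awalk u p v \<and> awalk_cost w p = l"
proof (induction rule: wg.walk.induct)
  case (walk_nil u)
  then show ?case by (intro exI[of _ "[]"]) (simp add: awalk_Nil_iff)
next
  case (walk_snoc u v l x)
  then obtain p where p: "awalk u p v" "awalk_cost w p = l" by blast
  obtain a where a: "a \<in> arcs G" "tail G a = v" "head G a = x" "edge_weight G w v x = w a"
    using edge_weight_some[OF walk_snoc(2)] by blast
  then have "awalk v [a] x" by (auto simp: awalk_Cons_iff awalk_Nil_iff)
  from awalk_appendI[OF p(1) this] show ?case using p(2) a by (intro exI[of _ "p @ [a]"]) simp
qed

lemma connected_walk:
  assumes "Digraph_Component.connected G"
  shows "wg.conn (verts G)"
proof -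
  have "strongly_connected G" using symmetric_connected_imp_strongly_connected[OF sym_arcs assms] .
  then have "verts G \<noteq> {}" "\<And>u v. u \<in> verts G \<Longrightarrow> v \<in> verts G \<Longrightarrow> u \<rightarrow>\<^sup>*\<^bsub>G\<^esub> v"
    unfolding strongly_connected_def by auto
  then show ?thesis unfolding wg.conn_def using awalk_walk by (metis reachable_awalk)
qed

lemma sp_dist_eq_gdist:
  assumes conn: "Digraph_Component.connected G" and uv: "u \<in> verts G" "v \<in> verts G"
  shows "sp_dist G w u v = wg.gdist (verts G) u v"
proof -
  obtain l where l: "wg.walk (verts G) u v l" using connected_walk[OF conn] uv unfolding wg.conn_def by blast
  have "u \<rightarrow>\<^sup>*\<^bsub>G\<^esub> v" using walk_awalk[OF l] reachable_awalk by blast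
  then obtain p where p: "apath u p v" "\<mu> w u v = ereal (awalk_cost w p)"
    using min_cost_awalk[of u v w] weight_nonneg by blast
  have "wg.gdist (verts G) u v \<le> awalk_cost w p"
    using wg.gdist_le[OF finite_verts awalk_walk] p(1) unfolding apath_def by blast
  moreover obtain p' where p': "awalk u p' v" "awalk_cost w p' = wg.gdist (verts G) u v"
    using walk_awalk[OF wg.walk_gdist[OF finite_verts l]] by blast
  have "ereal (awalk_cost w p) \<le> ereal (wg.gdist (verts G) u v)"
    using min_cost_le_walk_cost[OF p'(1), of w] p(2) p'(2) by simp
  ultimately show ?thesis unfolding sp_dist_def p(2) by simp
qed

lemma conn_induce_connected:
  assumes "wg.conn B" "B \<subseteq> verts G"
  shows "Digraph_Component.connected (induce_subgraph G B)"
proof -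
  interpret I: wf_digraph "induce_subgraph G B" by (rule wellformed_induce_subgraph)
  have ends: "(x, y) \<in> arcs_ends (induce_subgraph G B)" if "(x, y) \<in> arcs_ends G" "x \<in> B" "y \<in> B" for x y
    using that unfolding arcs_ends_conv induce_subgraph_def by auto
  have reach: "wg.walk B u v l \<Longrightarrow> u \<rightarrow>\<^sup>*\<^bsub>induce_subgraph G B\<^esub> v" for u v l
  proof (induction rule: wg.walk.induct)
    case (walk_snoc u v l x)
    then have "v \<in> B" using wg.walk_mem by blast
    then show ?case using walk_snoc ends I.reachable_adj_trans by blast
  qed (simp add: I.reachable_refl)
  have "u \<rightarrow>\<^sup>*\<^bsub>induce_subgraph G B\<^esub> v" if "u \<in> B" "v \<in> B" for u v
    using assms(1) that reach unfolding wg.conn_def by blast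
  moreover have "B \<noteq> {}" using assms(1) unfolding wg.conn_def by blast
  ultimately have "strongly_connected (induce_subgraph G B)"
    unfolding strongly_connected_def by simp
  then show ?thesis unfolding connected_def strongly_connected_def
    using I.reachable_mk_symmetricI by auto
qed

lemma complete_minor_not_excluded:
  assumes "wg.complete_minor r"
  shows "\<not> excludes_complete_minor r G"
proof -
  obtain B where B0: "\<forall>i<r. B i \<subseteq> verts G \<and> wg.conn (B i)"
    "\<forall>i<r. \<forall>j<r. i \<noteq> j \<longrightarrow> B i \<inter> B j = {} \<and> (\<exists>u\<in>B i. \<exists>v\<in>B j. (u, v) \<in> arcs_ends G)"
    using assms[unfolded wg.complete_minor_def] by (elim exE conjE)
  have B: "i < r \<Longrightarrow> B i \<subseteq> verts G \<and> wg.conn (B i)"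
    "i < r \<Longrightarrow> j < r \<Longrightarrow> i \<noteq> j \<Longrightarrow> B i \<inter> B j = {} \<and> (\<exists>u\<in>B i. \<exists>v\<in>B j. (u, v) \<in> arcs_ends G)" for i j
    using B0 by simp_all
  define K :: "(nat, nat \<times> nat) pre_digraph" where
    "K = \<lparr>verts = {..<r}, arcs = {(i, j). i < r \<and> j < r \<and> i \<noteq> j}, tail = fst, head = snd\<rparr>"
  have ends: "arcs_ends K = {(i, j). i < r \<and> j < r \<and> i \<noteq> j}"
    unfolding arcs_ends_conv K_def by force
  have "finite {(i, j). i < r \<and> j < r \<and> i \<noteq> j}"
    by (rule finite_subset[of _ "{..<r} \<times> {..<r}"]) auto
  then have "graph K"
    by unfold_locales (auto simp: K_def arc_to_ends_def symmetric_conv)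
  then have "complete_digraph r K" unfolding complete_digraph_def ends by (auto simp: K_def)
  moreover have "minor_of K G"
    unfolding minor_of_def
  proof (intro exI[of _ B] conjI ballI allI impI)
    fix i assume "i \<in> verts K"
    then show "B i \<subseteq> verts G" "Digraph_Component.connected (induce_subgraph G (B i))"
      using B(1)[of i] conn_induce_connected unfolding K_def by auto
    fix j assume "j \<in> verts K" "i \<noteq> j"
    then show "B i \<inter> B j = {}" using B(2)[of i j] \<open>i \<in> verts K\<close> unfolding K_def by auto
  next
    fix i j assume "(i, j) \<in> arcs_ends K"
    then show "\<exists>u\<in>B i. \<exists>v\<in>B j. (u, v) \<in> arcs_ends G" using B(2)[of i j] unfolding ends by auto
  qed
  ultimately show ?thesis unfolding excludes_complete_minor_def by blast
qed

lemma fmetric_gdist: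
  assumes "wg.conn (verts G)"
  shows "fmetric (verts G) (wg.gdist (verts G))"
proof
  have w: "wg.walk (verts G) x y (wg.gdist (verts G) x y)" if "x \<in> verts G" "y \<in> verts G" for x y
    using wg.walk_gdist[OF finite_verts] assms that unfolding wg.conn_def by blast
  show "verts G \<noteq> {}" using assms unfolding wg.conn_def by blast
  fix x y z
  show nonneg: "0 \<le> wg.gdist (verts G) x y" if "x \<in> verts G" "y \<in> verts G" for x y
    using wg.walk_nonneg[OF w[OF that]] .
  show "wg.gdist (verts G) x x = 0" if "x \<in> verts G"
    using wg.gdist_le[OF finite_verts wg.walk_nil[OF that]] nonneg[OF that that] by simp
  have le: "wg.gdist (verts G) x y \<le> wg.gdist (verts G) y x" if "x \<in> verts G" "y \<in> verts G" for x y
    using wg.gdist_le[OF finite_verts wg.walk_sym[OF w[OF that(2,1)]]] .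
  show "wg.gdist (verts G) x y = wg.gdist (verts G) y x" if "x \<in> verts G" "y \<in> verts G"
    using le[OF that] le[OF that(2,1)] by simp
  show "wg.gdist (verts G) x z \<le> wg.gdist (verts G) x y + wg.gdist (verts G) y z"
    if "x \<in> verts G" "y \<in> verts G" "z \<in> verts G"
    using wg.gdist_le[OF finite_verts wg.walk_trans[OF w[OF that(2,3)] w[OF that(1,2)]]] .
qed simp

end

section \<open>From families of 1-Lipschitz functions to embeddings\<close>

lemma linf_norm_le_iff: "0 \<le> b \<Longrightarrow> linf_norm k z \<le> b \<longleftrightarrow> (\<forall>i<k. \<bar>z i\<bar> \<le> b)"
  unfolding linf_norm_def by auto

lemma linf_norm_ge: "i < k \<Longrightarrow> \<bar>z i\<bar> \<le> linf_norm k z"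
  unfolding linf_norm_def by (intro Max_ge) auto

lemma embedding_of_family:
  fixes d :: "'a \<Rightarrow> 'a \<Rightarrow> real"
  assumes fin: "finite Fam" and D: "0 < D"
    and lip: "\<And>f x y. \<lbrakk>f \<in> Fam; x \<in> V; y \<in> V\<rbrakk> \<Longrightarrow> \<bar>f x - f y\<bar> \<le> d x y"
    and sep: "\<And>x y. \<lbrakk>x \<in> V; y \<in> V\<rbrakk> \<Longrightarrow> \<exists>f\<in>Fam. 1 / D * d x y \<le> \<bar>f x - f y\<bar>"
  shows "\<exists>F. has_distortion V d (card Fam) F D"
proof -
  obtain h where h: "bij_betw h {..<card Fam} Fam"
    using ex_bij_betw_nat_finite[OF fin] by (auto simp: atLeast0LessThan)
  have "has_distortion V d (card Fam) (\<lambda>x i. h i x) D"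
    unfolding has_distortion_def
  proof (rule exI[of _ D], rule exI[of _ 1], intro conjI ballI)
    fix x y assume xy: "x \<in> V" "y \<in> V"
    obtain f where f: "f \<in> Fam" "1 / D * d x y \<le> \<bar>f x - f y\<bar>" using sep[OF xy] by blast
    have "f \<in> h ` {..<card Fam}" using f(1) h unfolding bij_betw_def by simp
    then obtain i where "i < card Fam" "h i = f" by blast
    then show "1 / D * d x y \<le> linf_norm (card Fam) (\<lambda>i. h i x - h i y)"
      using linf_norm_ge[of i "card Fam" "\<lambda>i. h i x - h i y"] f(2) by simp
    have "0 \<le> d x y" using lip[OF f(1) xy] abs_ge_zero order_trans by blast
    then have "linf_norm (card Fam) (\<lambda>i. h i x - h i y) \<le> d x y"
      using lip[OF _ xy] bij_betwE[OF h] by (subst linf_norm_le_iff) auto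
    then show "linf_norm (card Fam) (\<lambda>i. h i x - h i y) \<le> 1 * d x y" by simp
  qed (use D in auto)
  then show ?thesis by blast
qed

lemma (in weighted_graph) minor_free_embedding:
  fixes \<epsilon> :: real
  assumes \<epsilon>: "0 < \<epsilon>" "\<epsilon> < 1 / 2" and conn: "Digraph_Component.connected G" and ex: "excludes_complete_minor r G"
  shows "\<exists>k f. real k \<le> (9612 / \<epsilon>) ^ (r + 1) * ln (1 / \<epsilon>) * ln (real (card (verts G)) / \<epsilon>) \<and>
    has_distortion (verts G) (sp_dist G w) k f (3 + \<epsilon>)"
proof -
  define V where "V = verts G"
  define d where "d = wg.gdist V"
  have cV: "wg.conn V" using connected_walk[OF conn] unfolding V_def .
  interpret fm: fmetric V d unfolding V_def d_def by (rule fmetric_gdist[OF cV[unfolded V_def]])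
  have nm: "\<not> wg.complete_minor r" using complete_minor_not_excluded ex by blast
  \<comment> \<open>A connected graph has complete minors on 0 and on 1 vertices, so
    \<open>r\<close> is at least 2 and \<open>k = r - 2\<close> is legitimate.\<close>
  have "wg.complete_minor 0" "wg.complete_minor 1"
    unfolding wg.complete_minor_def using cV unfolding V_def by (auto intro: exI[of _ "\<lambda>_. verts G"])
  then have "r \<noteq> 0" "r \<noteq> 1" using nm by metis+
  then obtain k where r: "r = k + 2" by (metis One_nat_def add_2_eq_Suc' not0_implies_Suc)
  define M where "M = nat \<lceil>1600 * (real k + 1) / \<epsilon>\<rceil>"
  define s where "s = nat \<lceil>real ((k + M + 2) choose k) * ((real k + 1) * (960 / \<epsilon>))\<rceil>"
  define m where "m = nat \<lceil>ln (1120 / \<epsilon>) / ln (1 + \<epsilon> / 20)\<rceil>"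
  have M: "20 * (real k + 1) \<le> real M * (\<epsilon> / 80)"
  proof -
    have "1600 * (real k + 1) / \<epsilon> \<le> real M" unfolding M_def by linarith
    then have "1600 * (real k + 1) \<le> real M * \<epsilon>" using \<epsilon> by (simp add: divide_le_eq)
    then show ?thesis by simp
  qed
  have cover: "\<exists>\<C>. coloured_cover V d R (\<epsilon> / 20) (Suc s) \<C>" if R: "0 < R" for R
  proof -
    have "\<exists>\<C>. coloured_cover V (wg.gdist V) R (4 * (\<epsilon> / 80)) (Suc s) \<C>"
      unfolding V_def
    proof (rule wg.minor_free_cover[OF cV[unfolded V_def] _ R _ _ M])
      show "\<not> wg.complete_minor (k + 2)" using nm unfolding r .
      have eq: "12 / (\<epsilon> / 80) = 960 / \<epsilon>" by simp
      show "real ((k + M + 2) choose k) * ((real k + 1) * (12 / (\<epsilon> / 80))) \<le> real s"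
        unfolding s_def eq by (rule real_nat_ceiling_ge)
    qed (use \<epsilon> in auto)
    then show ?thesis unfolding d_def by simp
  qed
  note m = scales_bound[OF \<epsilon> m_def]
  have m28: "28 / (\<epsilon> / 40) \<le> (1 + \<epsilon> / 20) ^ m" using m(1) by simp
  have "\<exists>Fam. finite Fam \<and> card Fam \<le> (floor_log (card V) + 1) * (1 + m * Suc s * 9) \<and> (\<forall>f\<in>Fam. fm.lip f) \<and>
    (\<forall>x\<in>V. \<forall>y\<in>V. \<exists>f\<in>Fam.
      min (1 / 3) ((1 - 2 * (\<epsilon> / 40)) / ((3 + \<epsilon> / 20) * (1 + \<epsilon> / 20))) * d x y \<le> \<bar>f x - f y\<bar>)"
    by (rule fm.metric_embedding[OF _ _ _ _ m(2) m28 cover]) (use \<epsilon> in simp_all)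
  then obtain Fam where Fam: "finite Fam" "card Fam \<le> (floor_log (card V) + 1) * (1 + m * Suc s * 9)"
    "\<And>f. f \<in> Fam \<Longrightarrow> fm.lip f"
    "\<And>x y. x \<in> V \<Longrightarrow> y \<in> V \<Longrightarrow>
      \<exists>f\<in>Fam. min (1 / 3) ((1 - 2 * (\<epsilon> / 40)) / ((3 + \<epsilon> / 20) * (1 + \<epsilon> / 20))) * d x y \<le> \<bar>f x - f y\<bar>"
    by blast
  have sp: "sp_dist G w x y = d x y" if "x \<in> V" "y \<in> V" for x y
    using sp_dist_eq_gdist[OF conn] that unfolding d_def V_def by blast
  have "\<exists>F. has_distortion V (sp_dist G w) (card Fam) F (3 + \<epsilon>)"
  proof (rule embedding_of_family[OF Fam(1)])
    show "\<bar>f x - f y\<bar> \<le> sp_dist G w x y" if "f \<in> Fam" "x \<in> V" "y \<in> V" for f x y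
    proof -
      have "f x \<le> f y + d x y" "f y \<le> f x + d y x" using Fam(3)[OF that(1)] that unfolding fm.lip_def by auto
      then show ?thesis using sp[OF that(2,3)] fm.d_sym[OF that(2,3)] by simp
    qed
    show "\<exists>f\<in>Fam. 1 / (3 + \<epsilon>) * sp_dist G w x y \<le> \<bar>f x - f y\<bar>" if "x \<in> V" "y \<in> V" for x y
    proof -
      obtain f where f: "f \<in> Fam" "min (1 / 3) ((1 - 2 * (\<epsilon> / 40)) / ((3 + \<epsilon> / 20) * (1 + \<epsilon> / 20))) * d x y \<le> \<bar>f x - f y\<bar>"
        using Fam(4)[OF \<open>x \<in> V\<close> \<open>y \<in> V\<close>] by blast
      have "1 / (3 + \<epsilon>) * d x y \<le> min (1 / 3) ((1 - 2 * (\<epsilon> / 40)) / ((3 + \<epsilon> / 20) * (1 + \<epsilon> / 20))) * d x y"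
        by (rule mult_right_mono[OF distortion_bound[OF \<epsilon>] fm.d_nonneg[OF that]])
      then show ?thesis using f(1) order_trans[OF _ f(2)] unfolding sp[OF that] by blast
    qed
  qed (use \<epsilon> in simp)
  moreover have "real (card Fam) \<le> (9612 / \<epsilon>) ^ (r + 1) * ln (1 / \<epsilon>) * ln (real (card V) / \<epsilon>)"
  proof -
    have "0 < card V" using fm.finV fm.neV by (simp add: card_gt_0_iff)
    note dim = dimension_bound[OF \<epsilon> this m(3) colours_bound[OF \<epsilon> M_def s_def]]
    have "k + 3 = r + 1" unfolding r by simp
    then show ?thesis using order_trans[OF of_nat_mono[OF Fam(2)] dim] by (simp only:)
  qed
  ultimately show ?thesis unfolding V_def by blast
qed

theorem theorem1p4:
  shows "\<exists>C::real. 0 < C \<and>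
    (\<forall>(r::nat) (n::nat) (\<epsilon>::real) (G :: ('a, 'b) pre_digraph) (w :: 'b \<Rightarrow> real).
       0 < \<epsilon> \<and> \<epsilon> < 1 / 2 \<and> weighted_graph G w \<and> Digraph_Component.connected G \<and>
       card (verts G) = n \<and> excludes_complete_minor r G \<longrightarrow>
       (\<exists>(k::nat) (f :: 'a \<Rightarrow> nat \<Rightarrow> real).
          real k \<le> (C / \<epsilon>) ^ (r + 1) * ln (1 / \<epsilon>) * ln (real n / \<epsilon>) \<and>
          has_distortion (verts G) (sp_dist G w) k f (3 + \<epsilon>)))"
proof (rule exI[of _ 9612], intro conjI allI impI)
  fix r n :: nat and \<epsilon> :: real and G :: "('a, 'b) pre_digraph" and w :: "'b \<Rightarrow> real"
  assume "0 < \<epsilon> \<and> \<epsilon> < 1 / 2 \<and> weighted_graph G w \<and> Digraph_Component.connected G \<and>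
    card (verts G) = n \<and> excludes_complete_minor r G"
  then show "\<exists>(k::nat) (f :: 'a \<Rightarrow> nat \<Rightarrow> real).
      real k \<le> (9612 / \<epsilon>) ^ (r + 1) * ln (1 / \<epsilon>) * ln (real n / \<epsilon>) \<and>
      has_distortion (verts G) (sp_dist G w) k f (3 + \<epsilon>)"
    using weighted_graph.minor_free_embedding by blast
qed simp

end
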